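(* Let $(M=G/H,ds^2)$ be a connected Lorentz $G$-geodesic orbit nilmanifold, where $G=N\rtimes H$ with $N$ nilpotent. Let $\langle\cdot,\cdot\rangle$ be the inner product on the Lie algebra $\mathfrak n$ of $N$ defined by $ds^2$. Suppose that the restriction of $\langle\cdot,\cdot\rangle$ to $[\mathfrak n,\mathfrak n]$ is degenerate. Then $(\mathfrak n,\langle\cdot,\cdot\rangle)$ is a Lorentz double extension of the metric Lie algebra $(\mathfrak m_0,\langle\cdot,\cdot\rangle_0)$ corresponding to a Riemannian geodesic orbit nilmanifold (and $\mathfrak m_0$ is necessarily abelian or $2$-step nilpotent).
   Context: Setting. A pseudo-Riemannian nilmanifold is a pseudo-Riemannian manifold admitting a transitive nilpotent Lie group of isometries; it is Lorentz if its metric has signature $(\dim M-1,1)$. Here $G\subset I(M,ds^2)$ is a Lie group of isometries of the form $G=N\rtimes H$, where $N$ is a nilpotent Lie group acting simply transitively on $M$ (so $M$ is identified with $N$ with a left-invariant Lorentz metric) and $H$ is the isotropy subgroup at the base point, acting by isometric automorphisms of $N$. The Lie algebras are $\mathfrak g,\mathfrak h,\mathfrak n$, and $\mathfrak g=\mathfrak h\oplus\mathfrak n$ is a reductive decomposition (vector space direct sum with $[\mathfrak h,\mathfrak n]\subset\mathfrak n$). The space $\mathfrak n$ is identified with the tangent space of $M$ at the base point, so $ds^2$ induces a nondegenerate symmetric bilinear form ("inner product") $\langle\cdot,\cdot\rangle$ on $\mathfrak n$; $\mathfrak h$ acts on $\mathfrak n$ by skew-symmetric derivations. Geodesic orbit.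 $(M=G/H,ds^2)$ is $G$-geodesic orbit ($G$-GO) if every geodesic of $M$ is, up to reparametrization, an orbit of a $1$-parameter subgroup of $G$. By the Geodesic Lemma this holds if and only if for every $T\in\mathfrak n$ there exist $A=A(T)\in\mathfrak h$ and $k=k(T)\in\mathbb R$ such that $\langle[T+A,T']_{\mathfrak n},T\rangle=k\langle T,T'\rangle$ for all $T'\in\mathfrak n$, where the subscript $\mathfrak n$ denotes the $\mathfrak n$-component in $\mathfrak g=\mathfrak h\oplus\mathfrak n$. A metric Lie algebra $(\mathfrak m_0,\langle\cdot,\cdot\rangle_0)$ (a Lie algebra with a nondegenerate inner product) with $\mathfrak m_0$ nilpotent and $\langle\cdot,\cdot\rangle_0$ positive definite corresponds to a Riemannian GO nilmanifold if the simply connected Lie group with Lie algebra $\mathfrak m_0$ and the left-invariant Riemannian metric given by $\langle\cdot,\cdot\rangle_0$ is a geodesic orbit manifold (every geodesic is an orbit of a $1$-parameter group of isometries); equivalently, for every $X\in\mathfrak m_0$ there is a skew-symmetric derivation $D$ of $(\mathfrak m_0,\langle\cdot,\cdot\rangle_0)$ with $\langle[X,Y]_0+DY,X\rangle_0=0$ for all $Y\in\mathfrak m_0$. Lorentz double extension. Let $(\mathfrak m_0,[\cdot,\cdot]_0,\langle\cdot,\cdot\rangle_0)$ be a metric Lie algebra. Let $\mathfrak m_1=\mathbb Re\oplus\mathfrak m_0$ (vector space direct sum) be a central extension $0\to\mathbb Re\to\mathfrak m_1\to\mathfrak m_0\to0$ (an exact sequence of Lie algebra homomorphisms), with $e\neq0$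 central in $\mathfrak m_1$. Let $\mathfrak m_2=\mathbb Rf\oplus\mathfrak m_1$ (vector space direct sum) be an extension of $\mathfrak m_1$ by a nonzero derivation, i.e. $0\to\mathfrak m_1\to\mathfrak m_2\to\mathbb Rf\to0$ is an exact sequence of Lie algebras with $\mathrm{ad}_{\mathfrak m_2}(f)|_{\mathfrak m_1}\in\mathrm{Der}(\mathfrak m_1)$ nonzero. Equip $\mathfrak m_2$ with the inner product $\langle\cdot,\cdot\rangle$ such that $\langle\cdot,\cdot\rangle|_{\mathfrak m_0}=\langle\cdot,\cdot\rangle_0$, $\langle e,\mathfrak m_0\rangle=\langle f,\mathfrak m_0\rangle=0$, $\langle e,e\rangle=\langle f,f\rangle=0$, $\langle e,f\rangle=1$. If $\langle\cdot,\cdot\rangle_0$ is positive definite (so $\langle\cdot,\cdot\rangle$ is Lorentz), then $(\mathfrak m_2,\langle\cdot,\cdot\rangle)$ is called a Lorentz double extension of $(\mathfrak m_0,\langle\cdot,\cdot\rangle_0)$. *)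

theory Defs
  imports "HOL-Algebra.Bij" "HOL-Algebra.Generated_Groups" "HOL-Algebra.Group_Action" "HOL-Analysis.Analysis"
begin

subsection \<open>Smooth manifolds\<close>

text \<open>
  A manifold is a topological space with an atlas of charts \<open>(U, \<phi>)\<close>. The charts take values in a
  linear subspace \<open>model M\<close> of a Euclidean space, so that manifolds of several dimensions can live
  over one type \<open>'v\<close>. All derivatives are taken within the model space and evaluated only in
  directions of the model space, where they are unique.
\<close>

type_synonym ('m, 'v) chart = "'m set \<times> ('m \<Rightarrow> 'v)"

record ('m, 'v) manifold =
  mtop :: "'m topology"
  model :: "'v set"
  atlas :: "('m, 'v) chart set"

text \<open>\<open>S\<close> is meant to be a relatively open subset of the linear subspace \<open>V\<close>.\<close>

primrec C_on ::
  "nat \<Rightarrow> 'a::euclidean_space set \<Rightarrow> 'a set \<Rightarrow> ('a \<Rightarrow> 'b::euclidean_space) \<Rightarrow> bool" where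
  "C_on 0 V S f \<longleftrightarrow> continuous_on S f"
| "C_on (Suc k) V S f \<longleftrightarrow>
     (\<exists>f'. (\<forall>x\<in>S. (f has_derivative f' x) (at x within V)) \<and> (\<forall>v\<in>V. C_on k V S (\<lambda>x. f' x v)))"

definition smooth_on ::
  "'a::euclidean_space set \<Rightarrow> 'a set \<Rightarrow> ('a \<Rightarrow> 'b::euclidean_space) \<Rightarrow> bool" where
  "smooth_on V S f \<longleftrightarrow> (\<forall>k. C_on k V S f)"

abbreviation D_in :: "'a::euclidean_space set \<Rightarrow> ('a \<Rightarrow> 'b::euclidean_space) \<Rightarrow> 'a \<Rightarrow> 'a \<Rightarrow> 'b" where
  "D_in V f x \<equiv> frechet_derivative f (at x within V)"

abbreviation chart_inv :: "('m, 'v) chart \<Rightarrow> 'v \<Rightarrow> 'm" where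
  "chart_inv c \<equiv> inv_into (fst c) (snd c)"

text \<open>The expression of \<open>f\<close> in the charts \<open>c\<close> (source) and \<open>d\<close> (target).\<close>

definition in_charts :: "('m, 'v) chart \<Rightarrow> ('n, 'w) chart \<Rightarrow> ('m \<Rightarrow> 'n) \<Rightarrow> 'v \<Rightarrow> 'w" where
  "in_charts c d f = snd d \<circ> f \<circ> chart_inv c"

definition smooth_manifold :: "('m, 'v::euclidean_space) manifold \<Rightarrow> bool" where
  "smooth_manifold M \<longleftrightarrow>
     subspace (model M) \<and> Hausdorff_space (mtop M) \<and> second_countable (mtop M) \<and>
     (\<Union>c\<in>atlas M. fst c) = topspace (mtop M) \<and>
     (\<forall>c\<in>atlas M.
        openin (mtop M) (fst c) \<and>
        openin (top_of_set (model M)) (snd c ` fst c) \<and>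
        homeomorphic_map (subtopology (mtop M) (fst c)) (top_of_set (snd c ` fst c)) (snd c)) \<and>
     (\<forall>c\<in>atlas M. \<forall>d\<in>atlas M.
        smooth_on (model M) (snd c ` (fst c \<inter> fst d)) (in_charts c d (\<lambda>p. p)))"

definition smooth_map ::
  "('m, 'v::euclidean_space) manifold \<Rightarrow> ('n, 'w::euclidean_space) manifold \<Rightarrow> ('m \<Rightarrow> 'n) \<Rightarrow> bool"
  where
  "smooth_map M M' f \<longleftrightarrow>
     continuous_map (mtop M) (mtop M') f \<and>
     (\<forall>c\<in>atlas M. \<forall>d\<in>atlas M'.
        smooth_on (model M) (snd c ` {p \<in> fst c. f p \<in> fst d}) (in_charts c d f))"

definition prod_manifold ::
  "('m, 'v) manifold \<Rightarrow> ('n, 'w) manifold \<Rightarrow> ('m \<times> 'n, 'v \<times> 'w) manifold" where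
  "prod_manifold M M' =
     \<lparr>mtop = prod_topology (mtop M) (mtop M'), model = model M \<times> model M',
      atlas = {(fst c \<times> fst d, map_prod (snd c) (snd d)) |c d. c \<in> atlas M \<and> d \<in> atlas M'}\<rparr>"

definition real_line :: "(real, real) manifold" where
  "real_line = \<lparr>mtop = euclidean, model = UNIV, atlas = {(UNIV, \<lambda>t. t)}\<rparr>"

definition simply_connected_space :: "'a topology \<Rightarrow> bool" where
  "simply_connected_space X \<longleftrightarrow>
     path_connected_space X \<and>
     (\<forall>p. continuous_map (top_of_set {0..1::real}) X p \<and> p 0 = p 1 \<longrightarrow>
        (\<exists>a\<in>topspace X.
           homotopic_with (\<lambda>q. q 0 = q 1) (top_of_set {0..1::real}) X p (\<lambda>_. a)))"


subsection \<open>Pseudo-Riemannian metrics, geodesics and isometries\<close>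

definition symmetric_form :: "'v::euclidean_space set \<Rightarrow> ('v \<Rightarrow> 'v \<Rightarrow> real) \<Rightarrow> bool" where
  "symmetric_form V B \<longleftrightarrow>
     (\<forall>x\<in>V. \<forall>y\<in>V. B x y = B y x) \<and>
     (\<forall>x\<in>V. \<forall>y\<in>V. \<forall>z\<in>V. B (x + y) z = B x z + B y z) \<and>
     (\<forall>a. \<forall>x\<in>V. \<forall>y\<in>V. B (a *\<^sub>R x) y = a * B x y)"

definition degenerate_on :: "'v::euclidean_space set \<Rightarrow> ('v \<Rightarrow> 'v \<Rightarrow> real) \<Rightarrow> bool" where
  "degenerate_on W B \<longleftrightarrow> (\<exists>x\<in>W. x \<noteq> 0 \<and> (\<forall>y\<in>W. B x y = 0))"

definition positive_definite_on :: "'v::euclidean_space set \<Rightarrow> ('v \<Rightarrow> 'v \<Rightarrow> real) \<Rightarrow> bool" where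
  "positive_definite_on W B \<longleftrightarrow> (\<forall>x\<in>W. x \<noteq> 0 \<longrightarrow> B x x > 0)"

text \<open>Signature \<open>(p, q)\<close>: there is an orthogonal basis of \<open>p\<close> vectors of square \<open>1\<close> and \<open>q\<close> of square \<open>- 1\<close>.\<close>

definition has_signature :: "'v::euclidean_space set \<Rightarrow> ('v \<Rightarrow> 'v \<Rightarrow> real) \<Rightarrow> nat \<Rightarrow> nat \<Rightarrow> bool" where
  "has_signature V B p q \<longleftrightarrow>
     (\<exists>P Q. finite P \<and> finite Q \<and> P \<inter> Q = {} \<and> card P = p \<and> card Q = q \<and>
        independent (P \<union> Q) \<and> span (P \<union> Q) = V \<and>
        (\<forall>x\<in>P \<union> Q. \<forall>y\<in>P \<union> Q. x \<noteq> y \<longrightarrow> B x y = 0) \<and>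
        (\<forall>x\<in>P. B x x = 1) \<and> (\<forall>x\<in>Q. B x x = -1))"

text \<open>
  A metric is given by its coordinate expressions: \<open>g c u v w\<close> is the inner product of the tangent
  vectors at the point of the chart \<open>c\<close> with coordinates \<open>u\<close> that have the components \<open>v\<close>
  and \<open>w\<close> in \<open>c\<close>.
\<close>

type_synonym ('m, 'v) metric_tensor = "('m, 'v) chart \<Rightarrow> 'v \<Rightarrow> 'v \<Rightarrow> 'v \<Rightarrow> real"

definition preserves_metric ::
  "('m, 'v::euclidean_space) manifold \<Rightarrow> ('m, 'v) metric_tensor \<Rightarrow> ('m \<Rightarrow> 'm) \<Rightarrow> bool" where
  "preserves_metric M g f \<longleftrightarrow>
     (\<forall>c\<in>atlas M. \<forall>d\<in>atlas M. \<forall>p. p \<in> fst c \<and> f p \<in> fst d \<longrightarrow>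
        (\<forall>v\<in>model M. \<forall>w\<in>model M.
           g d (snd d (f p)) (D_in (model M) (in_charts c d f) (snd c p) v)
                             (D_in (model M) (in_charts c d f) (snd c p) w)
           = g c (snd c p) v w))"

text \<open>For the identity map, \<^const>\<open>preserves_metric\<close> is the transformation law of a covariant 2-tensor.\<close>

definition pseudo_riemannian_metric ::
  "('m, 'v::euclidean_space) manifold \<Rightarrow> nat \<Rightarrow> nat \<Rightarrow> ('m, 'v) metric_tensor \<Rightarrow> bool" where
  "pseudo_riemannian_metric M p q g \<longleftrightarrow>
     (\<forall>c\<in>atlas M.
        (\<forall>u\<in>snd c ` fst c.
           symmetric_form (model M) (g c u) \<and> has_signature (model M) (g c u) p q) \<and>
        (\<forall>v\<in>model M. \<forall>w\<in>model M. smooth_on (model M) (snd c ` fst c) (\<lambda>u. g c u v w))) \<and>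
     preserves_metric M g (\<lambda>x. x)"

definition riemannian_metric ::
  "('m, 'v::euclidean_space) manifold \<Rightarrow> ('m, 'v) metric_tensor \<Rightarrow> bool" where
  "riemannian_metric M g \<longleftrightarrow> pseudo_riemannian_metric M (dim (model M)) 0 g"

definition lorentz_metric ::
  "('m, 'v::euclidean_space) manifold \<Rightarrow> ('m, 'v) metric_tensor \<Rightarrow> bool" where
  "lorentz_metric M g \<longleftrightarrow> pseudo_riemannian_metric M (dim (model M) - 1) 1 g"

text \<open>
  The full isometry group \<open>I(M, g)\<close>, as a group of (extensional) permutations of \<open>M\<close>.
\<close>

definition isometry_group ::
  "('m, 'v::euclidean_space) manifold \<Rightarrow> ('m, 'v) metric_tensor \<Rightarrow> ('m \<Rightarrow> 'm) monoid" where
  "isometry_group M g =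
     (BijGroup (topspace (mtop M)))
       \<lparr>carrier := {f \<in> Bij (topspace (mtop M)). smooth_map M M f \<and>
                     smooth_map M M (inv_into (topspace (mtop M)) f) \<and> preserves_metric M g f}\<rparr>"

text \<open>
  The geodesic equation \<open>\<nabla>\<^bsub>x'\<^esub> x' = 0\<close> in local coordinates, paired with an arbitrary vector \<open>w\<close>.
  With the Christoffel symbols of the first kind this reads
  \<open>g(x'', w) + (\<partial>\<^bsub>x'\<^esub> g)(x', w) - 1/2 (\<partial>\<^bsub>w\<^esub> g)(x', x') = 0\<close>.
\<close>

definition geodesic ::
  "('m, 'v::euclidean_space) manifold \<Rightarrow> ('m, 'v) metric_tensor \<Rightarrow> real set \<Rightarrow> (real \<Rightarrow> 'm) \<Rightarrow> bool"
  where
  "geodesic M g I \<gamma> \<longleftrightarrow>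
     open I \<and> is_interval I \<and> I \<noteq> {} \<and> continuous_map (top_of_set I) (mtop M) \<gamma> \<and>
     (\<forall>c\<in>atlas M. \<forall>t\<in>I. \<gamma> t \<in> fst c \<longrightarrow>
        (let x = (\<lambda>s. snd c (\<gamma> s));
             x' = (\<lambda>s. vector_derivative x (at s));
             x'' = (\<lambda>s. vector_derivative x' (at s))
         in x differentiable (at t) \<and> x' differentiable (at t) \<and>
            (\<forall>w\<in>model M.
               g c (x t) (x'' t) w
               + D_in (model M) (\<lambda>u. g c u (x' t) w) (x t) (x' t)
               - 1/2 * D_in (model M) (\<lambda>u. g c u (x' t) (x' t)) (x t) w = 0)))"

text \<open>
  One-parameter subgroups of a group \<open>G\<close> of diffeomorphisms of \<open>M\<close>: homomorphisms from the reals
  to \<open>G\<close> whose action on \<open>M\<close> is smooth.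
\<close>

definition one_parameter_subgroup ::
  "('m, 'v::euclidean_space) manifold \<Rightarrow> ('m \<Rightarrow> 'm) set \<Rightarrow> (real \<Rightarrow> 'm \<Rightarrow> 'm) \<Rightarrow> bool" where
  "one_parameter_subgroup M G \<phi> \<longleftrightarrow>
     (\<forall>t. \<phi> t \<in> G) \<and>
     (\<forall>s t. \<phi> (s + t) = compose (topspace (mtop M)) (\<phi> s) (\<phi> t)) \<and>
     smooth_map (prod_manifold real_line M) M (\<lambda>(t, p). \<phi> t p)"

text \<open>
  Every geodesic is, up to reparametrization, an orbit of a one-parameter subgroup of \<open>G\<close>. The
  reparametrization \<open>s\<close> is a diffeomorphism of a parameter interval around the given \<open>t0\<close> onto its
  image. It cannot be required on the whole domain: when \<open>s\<close> is not affine (which happens for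
  null geodesics), a complete orbit may cover only part of a maximal geodesic.
\<close>

definition geodesic_orbit ::
  "('m, 'v::euclidean_space) manifold \<Rightarrow> ('m, 'v) metric_tensor \<Rightarrow> ('m \<Rightarrow> 'm) set \<Rightarrow> bool" where
  "geodesic_orbit M g G \<longleftrightarrow>
     (\<forall>I \<gamma>. geodesic M g I \<gamma> \<longrightarrow>
        (\<forall>t0\<in>I. \<exists>\<phi> s J.
           one_parameter_subgroup M G \<phi> \<and>
           open J \<and> is_interval J \<and> t0 \<in> J \<and> J \<subseteq> I \<and>
           smooth_on UNIV J s \<and> (\<forall>t\<in>J. deriv s t \<noteq> (0::real)) \<and> s t0 = 0 \<and>
           (\<forall>t\<in>J. \<gamma> t = \<phi> (s t) (\<gamma> t0))))"

text \<open>
  In the Riemannian case the speed is constant along both the geodesic and the orbit, so no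
  reparametrization is needed and whole geodesics are covered.
\<close>

definition riemannian_geodesic_orbit ::
  "('m, 'v::euclidean_space) manifold \<Rightarrow> ('m, 'v) metric_tensor \<Rightarrow> bool" where
  "riemannian_geodesic_orbit M g \<longleftrightarrow>
     (\<forall>I \<gamma>. geodesic M g I \<gamma> \<longrightarrow>
        (\<exists>\<phi>. \<exists>p\<in>topspace (mtop M).
           one_parameter_subgroup M (carrier (isometry_group M g)) \<phi> \<and> (\<forall>t\<in>I. \<gamma> t = \<phi> t p)))"


subsection \<open>Lie groups\<close>

definition lie_group :: "'g monoid \<Rightarrow> ('g, 'v::euclidean_space) manifold \<Rightarrow> bool" where
  "lie_group N M \<longleftrightarrow>
     group N \<and> smooth_manifold M \<and> carrier N = topspace (mtop M) \<and>
     smooth_map (prod_manifold M M) M (\<lambda>(x, y). x \<otimes>\<^bsub>N\<^esub> y) \<and>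
     smooth_map M M (\<lambda>x. inv\<^bsub>N\<^esub> x)"

text \<open>
  A chart \<open>c\<close> around the identity element identifies the tangent space there with \<open>model M\<close>. The
  Lie bracket is the commutator of left-invariant vector fields, written in the chart \<open>c\<close>.
\<close>

definition left_invariant_field ::
  "'g monoid \<Rightarrow> ('g, 'v::euclidean_space) manifold \<Rightarrow> ('g, 'v) chart \<Rightarrow> 'v \<Rightarrow> 'v \<Rightarrow> 'v" where
  "left_invariant_field N M c a u =
     D_in (model M) (in_charts c c (\<lambda>y. chart_inv c u \<otimes>\<^bsub>N\<^esub> y)) (snd c \<one>\<^bsub>N\<^esub>) a"

definition lie_bracket ::
  "'g monoid \<Rightarrow> ('g, 'v::euclidean_space) manifold \<Rightarrow> ('g, 'v) chart \<Rightarrow> 'v \<Rightarrow> 'v \<Rightarrow> 'v" where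
  "lie_bracket N M c a b =
     D_in (model M) (left_invariant_field N M c b) (snd c \<one>\<^bsub>N\<^esub>) a
     - D_in (model M) (left_invariant_field N M c a) (snd c \<one>\<^bsub>N\<^esub>) b"

definition left_translations :: "'g monoid \<Rightarrow> ('g \<Rightarrow> 'g) set" where
  "left_translations N = (\<lambda>n. \<lambda>x\<in>carrier N. n \<otimes>\<^bsub>N\<^esub> x) ` carrier N"

primrec group_lower_central :: "'g monoid \<Rightarrow> nat \<Rightarrow> 'g set" where
  "group_lower_central N 0 = carrier N"
| "group_lower_central N (Suc k) =
     generate N {x \<otimes>\<^bsub>N\<^esub> y \<otimes>\<^bsub>N\<^esub> inv\<^bsub>N\<^esub> x \<otimes>\<^bsub>N\<^esub> inv\<^bsub>N\<^esub> y |x y.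
       x \<in> carrier N \<and> y \<in> group_lower_central N k}"

definition nilpotent_group :: "'g monoid \<Rightarrow> bool" where
  "nilpotent_group N \<longleftrightarrow> (\<exists>k. group_lower_central N k = {\<one>\<^bsub>N\<^esub>})"

definition semidirect_product :: "'g monoid \<Rightarrow> 'g set \<Rightarrow> 'g set \<Rightarrow> bool" where
  "semidirect_product G K H \<longleftrightarrow>
     K \<lhd> G \<and> subgroup H G \<and> K \<inter> H = {\<one>\<^bsub>G\<^esub>} \<and> K <#>\<^bsub>G\<^esub> H = carrier G"


subsection \<open>Metric Lie algebras on subspaces of a Euclidean space\<close>

definition lie_algebra :: "'v::euclidean_space set \<Rightarrow> ('v \<Rightarrow> 'v \<Rightarrow> 'v) \<Rightarrow> bool" where
  "lie_algebra V br \<longleftrightarrow>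
     subspace V \<and>
     (\<forall>x\<in>V. \<forall>y\<in>V. br x y \<in> V) \<and>
     (\<forall>x\<in>V. \<forall>y\<in>V. \<forall>z\<in>V. br (x + y) z = br x z + br y z \<and> br z (x + y) = br z x + br z y) \<and>
     (\<forall>a. \<forall>x\<in>V. \<forall>y\<in>V. br (a *\<^sub>R x) y = a *\<^sub>R br x y \<and> br x (a *\<^sub>R y) = a *\<^sub>R br x y) \<and>
     (\<forall>x\<in>V. br x x = 0) \<and>
     (\<forall>x\<in>V. \<forall>y\<in>V. \<forall>z\<in>V. br x (br y z) + br y (br z x) + br z (br x y) = 0)"

definition metric_lie_algebra ::
  "'v::euclidean_space set \<Rightarrow> ('v \<Rightarrow> 'v \<Rightarrow> 'v) \<Rightarrow> ('v \<Rightarrow> 'v \<Rightarrow> real) \<Rightarrow> bool" where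
  "metric_lie_algebra V br ip \<longleftrightarrow>
     lie_algebra V br \<and> symmetric_form V ip \<and> \<not> degenerate_on V ip"

definition derived_algebra :: "'v::euclidean_space set \<Rightarrow> ('v \<Rightarrow> 'v \<Rightarrow> 'v) \<Rightarrow> 'v set" where
  "derived_algebra V br = span {br x y |x y. x \<in> V \<and> y \<in> V}"

primrec lower_central :: "'v::euclidean_space set \<Rightarrow> ('v \<Rightarrow> 'v \<Rightarrow> 'v) \<Rightarrow> nat \<Rightarrow> 'v set" where
  "lower_central V br 0 = V"
| "lower_central V br (Suc k) = span {br x y |x y. x \<in> V \<and> y \<in> lower_central V br k}"

definition nilpotent_lie :: "'v::euclidean_space set \<Rightarrow> ('v \<Rightarrow> 'v \<Rightarrow> 'v) \<Rightarrow> bool" where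
  "nilpotent_lie V br \<longleftrightarrow> (\<exists>k. lower_central V br k = {0})"

definition abelian_lie :: "'v::euclidean_space set \<Rightarrow> ('v \<Rightarrow> 'v \<Rightarrow> 'v) \<Rightarrow> bool" where
  "abelian_lie V br \<longleftrightarrow> (\<forall>x\<in>V. \<forall>y\<in>V. br x y = 0)"

definition two_step_nilpotent_lie :: "'v::euclidean_space set \<Rightarrow> ('v \<Rightarrow> 'v \<Rightarrow> 'v) \<Rightarrow> bool" where
  "two_step_nilpotent_lie V br \<longleftrightarrow> lower_central V br 2 = {0} \<and> lower_central V br 1 \<noteq> {0}"

definition lie_hom ::
  "'v::euclidean_space set \<Rightarrow> ('v \<Rightarrow> 'v \<Rightarrow> 'v) \<Rightarrow> 'v set \<Rightarrow> ('v \<Rightarrow> 'v \<Rightarrow> 'v) \<Rightarrow> ('v \<Rightarrow> 'v) \<Rightarrow> bool"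
  where
  "lie_hom V br W br' h \<longleftrightarrow>
     h ` V \<subseteq> W \<and>
     (\<forall>x\<in>V. \<forall>y\<in>V. h (x + y) = h x + h y) \<and>
     (\<forall>a. \<forall>x\<in>V. h (a *\<^sub>R x) = a *\<^sub>R h x) \<and>
     (\<forall>x\<in>V. \<forall>y\<in>V. h (br x y) = br' (h x) (h y))"

text \<open>\<open>0 \<rightarrow> A \<rightarrow> B \<rightarrow> C \<rightarrow> 0\<close> is an exact sequence of Lie algebras, where \<open>A \<rightarrow> B\<close> is the inclusion.\<close>

definition lie_extension ::
  "'v::euclidean_space set \<Rightarrow> ('v \<Rightarrow> 'v \<Rightarrow> 'v) \<Rightarrow> 'v set \<Rightarrow> ('v \<Rightarrow> 'v \<Rightarrow> 'v) \<Rightarrow>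
   'v set \<Rightarrow> ('v \<Rightarrow> 'v \<Rightarrow> 'v) \<Rightarrow> ('v \<Rightarrow> 'v) \<Rightarrow> bool" where
  "lie_extension A brA B brB C brC p \<longleftrightarrow>
     lie_algebra A brA \<and> lie_algebra B brB \<and> lie_algebra C brC \<and>
     lie_hom A brA B brB (\<lambda>x. x) \<and> lie_hom B brB C brC p \<and>
     p ` B = C \<and> {x\<in>B. p x = 0} = A"

definition lie_derivation ::
  "'v::euclidean_space set \<Rightarrow> ('v \<Rightarrow> 'v \<Rightarrow> 'v) \<Rightarrow> ('v \<Rightarrow> 'v) \<Rightarrow> bool" where
  "lie_derivation V br d \<longleftrightarrow>
     d ` V \<subseteq> V \<and>
     (\<forall>x\<in>V. \<forall>y\<in>V. d (x + y) = d x + d y) \<and>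
     (\<forall>a. \<forall>x\<in>V. d (a *\<^sub>R x) = a *\<^sub>R d x) \<and>
     (\<forall>x\<in>V. \<forall>y\<in>V. d (br x y) = br (d x) y + br x (d y))"

text \<open>
  The underlying vector space of \<open>m0\<close> is a subspace of \<open>m2\<close>, but \<open>m0\<close> need not be a subalgebra:
  its bracket \<open>br0\<close> is in general not the restriction of \<open>br\<close>. The projections \<open>p\<close> and \<open>q\<close> are those
  of the vector space decompositions \<open>m1 = \<real>e \<oplus> m0\<close> and \<open>m2 = \<real>f \<oplus> m1\<close>.
\<close>

definition lorentz_double_extension ::
  "'v::euclidean_space set \<Rightarrow> ('v \<Rightarrow> 'v \<Rightarrow> 'v) \<Rightarrow> ('v \<Rightarrow> 'v \<Rightarrow> real) \<Rightarrow>
   'v set \<Rightarrow> ('v \<Rightarrow> 'v \<Rightarrow> 'v) \<Rightarrow> ('v \<Rightarrow> 'v \<Rightarrow> real) \<Rightarrow> bool" where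
  "lorentz_double_extension m2 br ip m0 br0 ip0 \<longleftrightarrow>
     metric_lie_algebra m2 br ip \<and> metric_lie_algebra m0 br0 ip0 \<and> positive_definite_on m0 ip0 \<and>
     (\<exists>e f m1 p q.
        e \<notin> m0 \<and> m1 = {a *\<^sub>R e + x |a x. x \<in> m0} \<and>
        f \<notin> m1 \<and> m2 = {b *\<^sub>R f + y |b y. y \<in> m1} \<and>
        lie_extension (span {e}) (\<lambda>_ _. 0) m1 br m0 br0 p \<and> (\<forall>x\<in>m0. p x = x) \<and>
        (\<forall>x\<in>m1. br e x = 0) \<and>
        lie_extension m1 br m2 br (span {f}) (\<lambda>_ _. 0) q \<and> q f = f \<and>
        lie_derivation m1 br (br f) \<and> (\<exists>x\<in>m1. br f x \<noteq> 0) \<and>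
        (\<forall>x\<in>m0. \<forall>y\<in>m0. ip x y = ip0 x y) \<and>
        (\<forall>x\<in>m0. ip e x = 0 \<and> ip f x = 0) \<and>
        ip e e = 0 \<and> ip f f = 0 \<and> ip e f = 1)"

text \<open>
  A nilpotent metric Lie algebra corresponds to a Riemannian geodesic orbit nilmanifold if it is the
  Lie algebra of a simply connected Lie group with a left-invariant Riemannian metric that is
  geodesic orbit and induces the given inner product at the identity. As a simply connected nilpotent
  Lie group is diffeomorphic to its Lie algebra, its elements can be taken from the type \<open>'v\<close>.
\<close>

definition riemannian_go_nilmanifold_algebra ::
  "'v::euclidean_space set \<Rightarrow> ('v \<Rightarrow> 'v \<Rightarrow> 'v) \<Rightarrow> ('v \<Rightarrow> 'v \<Rightarrow> real) \<Rightarrow> bool" where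
  "riemannian_go_nilmanifold_algebra m0 br0 ip0 \<longleftrightarrow>
     metric_lie_algebra m0 br0 ip0 \<and> nilpotent_lie m0 br0 \<and> positive_definite_on m0 ip0 \<and>
     (\<exists>(N0 :: 'v monoid) (M0 :: ('v, 'v) manifold) g0 c0.
        lie_group N0 M0 \<and> simply_connected_space (mtop M0) \<and> model M0 = m0 \<and>
        c0 \<in> atlas M0 \<and> \<one>\<^bsub>N0\<^esub> \<in> fst c0 \<and>
        (\<forall>x\<in>m0. \<forall>y\<in>m0. lie_bracket N0 M0 c0 x y = br0 x y) \<and>
        riemannian_metric M0 g0 \<and> left_translations N0 \<subseteq> carrier (isometry_group M0 g0) \<and>
        (\<forall>x\<in>m0. \<forall>y\<in>m0. g0 c0 (snd c0 \<one>\<^bsub>N0\<^esub>) x y = ip0 x y) \<and>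
        riemannian_geodesic_orbit M0 g0)"

end

theory Submission
  imports Defs
begin

text \<open>
  Writing \<open>x' = Lam x v\<close> for a curve in a chart, the geodesic equation becomes the Euler equation
  \<open>\<langle>v', w\<rangle> = \<langle>v, [v, w]\<rangle>\<close> for the left-trivialized velocity. Since \<open>G\<close> normalizes the left translations, a
  one-parameter subgroup acts as \<open>\<phi>\<^sub>t (y) = n(t) h\<^sub>t(y)\<close> with isometric automorphisms \<open>h\<^sub>t\<close>; comparing its orbit
  with a geodesic yields, for every \<open>T\<close>, a skew derivation \<open>A\<close> and \<open>k\<close> with \<open>\<langle>[T, w] + A w, T\<rangle> = k \<langle>T, w\<rangle>\<close>.

  Let \<open>e\<close> span the radical of \<open>[\<nn>, \<nn>]\<close>; it is null and \<open>e\<^sup>\<bottom>\<close> is an ideal. For \<open>T\<close> in \<open>e\<^sup>\<bottom>\<close> and \<open>w = e\<close> the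
  condition says that \<open>ad e\<close> is skew on the semidefinite space \<open>e\<^sup>\<bottom>\<close>; being nilpotent it vanishes there. So \<open>e\<close> is
  central in \<open>e\<^sup>\<bottom>\<close>, and \<open>m0 = e\<^sup>\<bottom> / \<real>e\<close> inherits a positive definite form and, as \<open>k = 0\<close> for \<open>T\<close> in \<open>e\<^sup>\<bottom>\<close>, the
  geodesic orbit condition. If \<open>ad f\<close> happens to vanish on \<open>e\<^sup>\<bottom>\<close>, another complement \<open>f\<close> is chosen.

  By Gordon's argument \<open>m0\<close> is at most two-step nilpotent. Its group is \<open>m0\<close> with the product \<open>x + y + [x, y] / 2\<close>,
  on which one-parameter groups of isometries are flows of affine vector fields, and the Euler equation has unique
  solutions because the components of \<open>v\<close> along \<open>[m0, m0]\<close> are constant.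
\<close>

subsection \<open>Symmetric forms and nilpotent Lie algebras\<close>

text \<open>\<open>G\<close> enters only as a set of maps with smooth one-parameter subgroups and
  gets no Lie group structure of its own, so the isotropy algebra is never formed: the derivation
  belonging to \<open>T\<close> is a multiple of the derivative at time 0 of the linear parts of one
  subgroup. Hence on the Lorentz side a geodesic with initial velocity \<open>T\<close> on a short
  interval is enough. On the Riemannian side the geodesic is given and has to agree with an orbit on
  its whole interval, which is why uniqueness is needed there. The Jacobi identity and the
  nilpotency of the bracket are not hypotheses either; both come from differentiating conjugation in
  the group. On the algebraic side, \<open>e\<close> is a good test vector because a skew derivation
  \<open>A\<close> preserves the derived algebra; this makes \<open>A e\<close> a null vector
  orthogonal to \<open>e\<close>, hence a multiple of \<open>e\<close>, which is invisible to
  \<open>T\<close> in the orthogonal complement of \<open>e\<close>. The factor \<open>k\<close>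
  disappears on \<open>m0\<close> since the test vector \<open>T\<close> itself gives
  \<open>k * ip T T = 0\<close>.\<close>

lemma symmetric_form_UNIV_bilinear:
  fixes B :: "'v::euclidean_space \<Rightarrow> 'v \<Rightarrow> real"
  assumes "symmetric_form UNIV B"
  shows "bounded_bilinear B"
proof -
  have 1: "B (x + y) z = B x z + B y z" "B (a *\<^sub>R x) y = a * B x y" "B x y = B y x" for a x y z
    using assms by (auto simp: symmetric_form_def)
  have "B z (x + y) = B z x + B z y" "B x (a *\<^sub>R y) = a * B x y" for a x y z
    by (metis 1)+
  then have "bilinear B" unfolding bilinear_def using 1
    by (auto intro!: linearI)
  then show ?thesis by (simp add: bilinear_conv_bounded_bilinear)
qed

lemma lie_algebra_UNIV_bilinear:
  fixes br :: "'v::euclidean_space \<Rightarrow> 'v \<Rightarrow> 'v"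
  assumes "lie_algebra UNIV br"
  shows "bounded_bilinear br"
proof -
  have "bilinear br" unfolding bilinear_def using assms
    by (auto intro!: linearI simp: lie_algebra_def)
  then show ?thesis by (simp add: bilinear_conv_bounded_bilinear)
qed

text \<open>Gram-Schmidt by induction on the dimension, splitting off one unit vector at a time.
  Symmetry and positivity are asked on \<open>V\<close> only, since the form may be indefinite on
  the whole type.\<close>

lemma orthonormal_basis_form:
  fixes B :: "'v::euclidean_space \<Rightarrow> 'v \<Rightarrow> real"
  assumes "bounded_bilinear B" and sym: "\<And>x y. x \<in> V \<Longrightarrow> y \<in> V \<Longrightarrow> B x y = B y x" and "subspace V"
    and pos: "\<And>x. x \<in> V \<Longrightarrow> x \<noteq> 0 \<Longrightarrow> B x x > 0"
  shows "\<exists>P. finite P \<and> independent P \<and> span P = V \<and> (\<forall>x\<in>P. \<forall>y\<in>P. B x y = (if x = y then 1 else 0))"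
proof -
  interpret B: bounded_bilinear B by fact
  have "\<exists>P. finite P \<and> independent P \<and> span P = V \<and> (\<forall>x\<in>P. \<forall>y\<in>P. B x y = (if x = y then 1 else 0))"
    if "dim V = n" "subspace V" "\<And>x y. x \<in> V \<Longrightarrow> y \<in> V \<Longrightarrow> B x y = B y x"
      "\<And>x. x \<in> V \<Longrightarrow> x \<noteq> 0 \<Longrightarrow> B x x > 0" for n V
    using that
  proof (induction n arbitrary: V rule: less_induct)
    case (less n V)
    show ?case
    proof (cases "V \<subseteq> {0}")
      case True
      then have "V = {0}" using subspace_0[OF less.prems(2)] by auto
      then show ?thesis by (intro exI[of _ "{}"]) (auto simp: independent_empty)
    next
      case False
      then obtain x0 where x0: "x0 \<in> V" "x0 \<noteq> 0" by auto
      define x where "x = (1 / sqrt (B x0 x0)) *\<^sub>R x0"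
      have pos0: "B x0 x0 > 0" using less.prems(4) x0 by auto
      have xV: "x \<in> V" using x0 less.prems(2) by (auto simp: x_def subspace_scale)
      have xx: "B x x = 1" using pos0 by (simp add: x_def B.scaleR_left B.scaleR_right)
      define W where "W = {y\<in>V. B x y = 0}"
      have sW: "subspace W" using less.prems(2)
        by (auto simp: W_def subspace_def B.add_right B.scaleR_right B.zero_right)
      have "x \<notin> W" using xx by (auto simp: W_def)
      then have "W \<subset> V" using xV by (auto simp: W_def)
      then have "dim W < dim V"
        using dim_psubset[of W V] sW less.prems(2) span_eq_iff by metis
      then obtain P where P: "finite P" "independent P" "span P = W" "\<forall>x\<in>P. \<forall>y\<in>P. B x y = (if x = y then 1 else 0)"
        using less.IH[of "dim W" W] less.prems sW by (auto simp: W_def)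
      have PW: "P \<subseteq> W" using P(3) span_superset by blast
      have "x \<notin> span P" using P(3) \<open>x \<notin> W\<close> by simp
      then have ind: "independent (insert x P)" using P(2) by (simp add: independent_insert)
      have "span (insert x P) = V"
      proof
        show "span (insert x P) \<subseteq> V"
          by (rule span_minimal) (use PW xV less.prems(2) in \<open>auto simp: W_def\<close>)
        show "V \<subseteq> span (insert x P)"
        proof
          fix y assume y: "y \<in> V"
          have "y - B x y *\<^sub>R x \<in> W" using y xV xx less.prems(2)
            by (auto simp: W_def B.diff_right B.scaleR_right subspace_diff subspace_scale)
          then have "y - B x y *\<^sub>R x \<in> span P" using P(3) by simp
          then show "y \<in> span (insert x P)" unfolding span_insert by blast
        qed
      qed
      moreover have "\<forall>a\<in>insert x P. \<forall>b\<in>insert x P. B a b = (if a = b then 1 else 0)"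
      proof (intro ballI)
        fix a b assume ab: "a \<in> insert x P" "b \<in> insert x P"
        have *: "B x p = 0" "B p x = 0" "p \<noteq> x" if "p \<in> P" for p
          using that PW \<open>x \<notin> W\<close> less.prems(3) xV by (auto simp: W_def)
        show "B a b = (if a = b then 1 else 0)"
          using ab * xx P(4) by (metis insert_iff)
      qed
      ultimately show ?thesis using ind P(1) by (intro exI[of _ "insert x P"]) auto
    qed
  qed
  then show ?thesis using assms by blast
qed

lemma orthonormal_coeff:
  fixes B :: "'v::euclidean_space \<Rightarrow> 'v \<Rightarrow> real"
  assumes "bounded_bilinear B" "finite P" "\<forall>x\<in>P. \<forall>y\<in>P. B x y = (if x = y then 1 else 0)" "p \<in> P"
  shows "B (\<Sum>x\<in>P. c x *\<^sub>R x) p = c p"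
proof -
  interpret B: bounded_bilinear B by fact
  have "B (\<Sum>x\<in>P. c x *\<^sub>R x) p = (\<Sum>x\<in>P. if x = p then c x else 0)"
    unfolding B.sum_left B.scaleR_left by (rule sum.cong) (use assms in auto)
  then show ?thesis using assms by simp
qed

text \<open>Skewness moves one \<open>S\<close> across: the square of \<open>S^(k+1) x\<close> is
  minus the product of \<open>S^k x\<close> with \<open>S^(k+2) x\<close>. If
  \<open>S^(k+2) x\<close> is null, it lies in the radical, so \<open>S^(k+1) x\<close> is null as
  well; descend from \<open>n\<close> to 1. On a definite space this yields \<open>S x = 0\<close>,
  on a semidefinite one only that \<open>S x\<close> is in the radical.\<close>

lemma skew_nilpotent_semidefinite:
  fixes B :: "'v::euclidean_space \<Rightarrow> 'v \<Rightarrow> real"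
  assumes S: "\<And>x. x \<in> W \<Longrightarrow> S x \<in> W" and skew: "\<And>x y. x \<in> W \<Longrightarrow> y \<in> W \<Longrightarrow> B (S x) y = - B x (S y)"
    and null: "\<And>x y. x \<in> W \<Longrightarrow> y \<in> W \<Longrightarrow> B x x = 0 \<Longrightarrow> B y x = 0"
    and x: "x \<in> W" and n: "B ((S ^^ n) x) ((S ^^ n) x) = 0"
  shows "B (S x) (S x) = 0"
proof -
  have W: "(S ^^ k) x \<in> W" for k using x S by (induction k) auto
  have step: "B ((S ^^ Suc k) x) ((S ^^ Suc k) x) = 0"
    if "B ((S ^^ Suc (Suc k)) x) ((S ^^ Suc (Suc k)) x) = 0" for k
    using null[OF W W that, of k] skew[OF W[of k] W[of "Suc k"]] by simp
  have "B ((S ^^ Suc 0) x) ((S ^^ Suc 0) x) = 0"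
  proof (cases n)
    case 0
    then have "B x x = 0" using n by simp
    then have "B (S (S x)) x = 0" using null[OF x] S x by blast
    then show ?thesis using skew[of "S x" x] S x by auto
  next
    case (Suc m)
    have "B ((S ^^ Suc 0) x) ((S ^^ Suc 0) x) = 0" if "B ((S ^^ Suc m) x) ((S ^^ Suc m) x) = 0" for m
      using that by (induction m) (use step in blast)+
    then show ?thesis using n Suc by blast
  qed
  then show ?thesis by simp
qed

lemma lower_central_subspace: "subspace V \<Longrightarrow> subspace (lower_central V br k)"
  by (cases k) auto

lemma lower_central_br: "x \<in> V \<Longrightarrow> y \<in> lower_central V br k \<Longrightarrow> br x y \<in> lower_central V br (Suc k)"
  by (auto intro!: span_base)

lemma ad_power_lower_central:
  "x \<in> V \<Longrightarrow> y \<in> V \<Longrightarrow> (br x ^^ k) y \<in> lower_central V br k"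
proof (induction k)
  case (Suc k)
  then show ?case using lower_central_br[of x V _ br k] by (metis comp_apply funpow.simps(2))
qed simp

lemma lower_central_Suc_mono:
  "lower_central V br j \<subseteq> lower_central V br k \<Longrightarrow> lower_central V br (Suc j) \<subseteq> lower_central V br (Suc k)"
  by simp (rule span_mono, blast)

lemma lower_central_1: "lower_central V br 1 = span {br x y |x y. x \<in> V \<and> y \<in> V}"
  by simp

declare lower_central.simps(2) [simp del] One_nat_def [simp del]

text \<open>The quotient by \<open>e\<close> is modelled on a complement \<open>m0\<close>. The
  bracket is extended to the whole type through the projection \<open>pr\<close>, so that
  bilinearity, Jacobi and Leibniz carry no membership conditions. The inner product is not projected
  and is controlled on \<open>m0\<close> alone.\<close>

locale riem_go_algebra =
  fixes m0 :: "'v::euclidean_space set" and pr :: "'v \<Rightarrow> 'v" and br0 :: "'v \<Rightarrow> 'v \<Rightarrow> 'v" and ip :: "'v \<Rightarrow> 'v \<Rightarrow> real"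
  assumes sub: "subspace m0"
    and br0_bilinear: "bounded_bilinear br0" and br0_in: "br0 x y \<in> m0"
    and br0_self: "br0 x x = 0"
    and jacobi0: "br0 x (br0 y z) + br0 y (br0 z x) + br0 z (br0 x y) = 0"
    and nilp: "nilpotent_lie m0 br0"
    and ip_bilinear: "bounded_bilinear ip" and ip_sym: "ip x y = ip y x"
    and ip_pos: "x \<in> m0 \<Longrightarrow> x \<noteq> 0 \<Longrightarrow> ip x x > 0"
    and go: "x \<in> m0 \<Longrightarrow> \<exists>D. linear D \<and> range D \<subseteq> m0 \<and> (\<forall>y z. D (br0 y z) = br0 (D y) z + br0 y (D z)) \<and>
        (\<forall>y\<in>m0. \<forall>z\<in>m0. ip (D y) z = - ip y (D z)) \<and> (\<forall>y\<in>m0. ip (br0 x y + D y) x = 0)"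
    and pr_in: "pr x \<in> m0" and pr_id: "x \<in> m0 \<Longrightarrow> pr x = x" and br0_pr: "br0 (pr x) (pr y) = br0 x y"
begin

interpretation br0: bounded_bilinear br0 by (rule br0_bilinear)
interpretation ip: bounded_bilinear ip by (rule ip_bilinear)

lemma br0_swap: "br0 x y = - br0 y x"
  using br0_self[of "x + y"] br0_self[of x] br0_self[of y]
  by (simp add: br0.add_left br0.add_right eq_neg_iff_add_eq_0 add.commute)

lemma lie_algebra_m0: "lie_algebra m0 br0"
  using sub br0_in br0_self jacobi0
  by (auto simp: lie_algebra_def br0.add_left br0.add_right br0.scaleR_left br0.scaleR_right)

lemma metric_lie_algebra_m0: "metric_lie_algebra m0 br0 ip"
proof -
  have "\<not> degenerate_on m0 ip"
    unfolding degenerate_on_def using ip_pos by fastforce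
  then show ?thesis using lie_algebra_m0 ip_sym
    unfolding metric_lie_algebra_def symmetric_form_def
    using ip.add_left ip.scaleR_left by auto
qed

lemma positive_definite_m0: "positive_definite_on m0 ip"
  using ip_pos by (auto simp: positive_definite_on_def)

text \<open>Gordon's argument: on the derived algebra, \<open>ad\<close> of a vector orthogonal to it is both skew and
  nilpotent.\<close>

lemma lower_central_2: "lower_central m0 br0 2 = {0}"
proof -
  let ?L = "lower_central m0 br0"
  let ?d = "?L 1"
  have sL: "subspace (?L k)" for k by (rule lower_central_subspace[OF sub])
  have Lm: "?L k \<subseteq> m0" for k
  proof (induction k)
    case (Suc k)
    have "{br0 x y |x y. x \<in> m0 \<and> y \<in> ?L k} \<subseteq> m0" using br0_in by auto
    then show ?case unfolding lower_central.simps by (rule span_minimal) (rule sub)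
  qed simp
  have brL: "br0 x y \<in> ?L (Suc k)" if "x \<in> m0" "y \<in> ?L k" for x y k
    using lower_central_br that by blast
  have dec: "?L (Suc k) \<subseteq> ?L k" for k
  proof (induction k)
    case 0 then show ?case using Lm[of "Suc 0"] by simp
  next
    case (Suc k) then show ?case by (rule lower_central_Suc_mono)
  qed
  have brL0: "br0 x y \<in> ?d" if "x \<in> m0" "y \<in> m0" for x y
    using brL[of x y 0] that by (simp add: One_nat_def)
  have orth: "br0 Y X = 0" if Y: "Y \<in> m0" "\<And>z. z \<in> ?d \<Longrightarrow> ip Y z = 0" and X: "X \<in> ?d" for X Y
  proof -
    have skew1: "ip (br0 Y X) X = 0" if X: "X \<in> ?d" for X
    proof -
      have Xm: "X \<in> m0" using X Lm by blast
      obtain D where D: "linear D" "range D \<subseteq> m0" "\<And>y z. D (br0 y z) = br0 (D y) z + br0 y (D z)"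
        "\<And>y z. y\<in>m0 \<Longrightarrow> z\<in>m0 \<Longrightarrow> ip (D y) z = - ip y (D z)" "\<And>y. y\<in>m0 \<Longrightarrow> ip (br0 X y + D y) X = 0"
        using go[OF Xm] by blast
      \<comment> \<open>A derivation preserves the derived algebra, so \<open>D X\<close> is
        orthogonal to \<open>Y\<close> and the \<open>D\<close> term disappears from the geodesic
        condition at \<open>X\<close> tested against \<open>Y\<close>.\<close>
      have "D ` ?d \<subseteq> ?d"
      proof -
        have "D ` {br0 x y |x y. x \<in> m0 \<and> y \<in> m0} \<subseteq> ?d"
        proof
          fix u assume "u \<in> D ` {br0 x y |x y. x \<in> m0 \<and> y \<in> m0}"
          then obtain x y where xy: "x \<in> m0" "y \<in> m0" "u = D (br0 x y)" by blast
          have "D x \<in> m0" "D y \<in> m0" using D(2) by auto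
          then have "br0 (D x) y \<in> ?d" "br0 x (D y) \<in> ?d" using brL0 xy by auto
          then show "u \<in> ?d" using xy(3) D(3) subspace_add[OF sL] by simp
        qed
        then have "span (D ` {br0 x y |x y. x \<in> m0 \<and> y \<in> m0}) \<subseteq> ?d"
          using sL[of 1] by (rule span_minimal)
        then show ?thesis unfolding lower_central_1 linear_span_image[OF D(1)] .
      qed
      then have "ip Y (D X) = 0" using Y X by blast
      then have "ip (D Y) X = 0" using D(4)[OF Y(1) Xm] by simp
      then have "ip (br0 X Y) X = 0" using D(5)[OF Y(1)] by (simp add: ip.add_left)
      then show ?thesis using br0_swap[of Y X] by (simp add: ip.minus_left)
    qed
    have Sd: "br0 Y x \<in> ?d" if "x \<in> ?d" for x using Lm[of 1] brL0[OF Y(1)] that by blast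
    have skew: "ip (br0 Y x) y = - ip x (br0 Y y)" if "x \<in> ?d" "y \<in> ?d" for x y
      using skew1[of "x + y"] skew1[of x] skew1[of y] that subspace_add[OF sL[of 1]] ip_sym[of x "br0 Y y"]
      by (simp add: br0.add_right ip.add_left ip.add_right)
    obtain k where k: "?L k = {0}" using nilp by (auto simp: nilpotent_lie_def)
    have Xm: "X \<in> m0" using X Lm by blast
    have "(br0 Y ^^ k) X = 0" using ad_power_lower_central[OF Y(1) Xm, where br = br0 and k = k] k by simp
    then have n: "ip ((br0 Y ^^ k) X) ((br0 Y ^^ k) X) = 0" by (simp add: ip.zero_left)
    have null: "ip y x = 0" if "x \<in> ?d" "ip x x = 0" for x y
    proof -
      have "x = 0" using that ip_pos[of x] Lm[of 1] by fastforce
      then show ?thesis by (simp add: ip.zero_right)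
    qed
    have "ip (br0 Y X) (br0 Y X) = 0"
      by (rule skew_nilpotent_semidefinite[where W = ?d and S = "br0 Y", OF Sd skew null X n])
    then show ?thesis using ip_pos[of "br0 Y X"] br0_in by force
  qed
  have Z_sub: "subspace {z. br0 z y \<in> ?L 3}" for y
    using sL[of 3] by (auto simp: subspace_def br0.add_left br0.scaleR_left br0.zero_left)
  \<comment> \<open>Jacobi gains one level: a bracket of two elements of the derived algebra lies
    one step deeper than a general element of \<open>?L 2\<close>.\<close>
  have dd: "br0 z y \<in> ?L 3" if z: "z \<in> ?d" and y: "y \<in> ?d" for z y
  proof -
    have "{br0 x y |x y. x \<in> m0 \<and> y \<in> m0} \<subseteq> {z. br0 z y \<in> ?L 3}"
    proof safe
      fix a b assume ab: "a \<in> m0" "b \<in> m0"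
      have "br0 b y \<in> ?L 2" "br0 a y \<in> ?L 2" using brL[OF ab(1) y] brL[OF ab(2) y] by (auto simp: numeral_2_eq_2)
      then have "br0 a (br0 b y) \<in> ?L 3" "br0 b (br0 a y) \<in> ?L 3"
        using brL[OF ab(1), of _ 2] brL[OF ab(2), of _ 2] by (auto simp: numeral_3_eq_3 numeral_2_eq_2)
      then have "br0 a (br0 b y) - br0 b (br0 a y) \<in> ?L 3" using sL subspace_diff by blast
      moreover have "br0 (br0 a b) y = br0 a (br0 b y) - br0 b (br0 a y)"
        using jacobi0[of a b y] br0_swap[of "br0 a b" y] br0_swap[of y a]
        by (simp add: br0.minus_right algebra_simps add_eq_0_iff)
      ultimately show "br0 (br0 a b) y \<in> ?L 3" by simp
    qed
    then show ?thesis using span_minimal[OF _ Z_sub] z lower_central_1 by blast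
  qed
  obtain P where P: "finite P" "span P = ?d" "\<forall>x\<in>P. \<forall>y\<in>P. ip x y = (if x = y then 1 else 0)"
    using orthonormal_basis_form[OF ip_bilinear _ sL[of 1]] ip_sym ip_pos Lm[of 1] by blast
  have "{br0 x y |x y. x \<in> m0 \<and> y \<in> ?d} \<subseteq> ?L 3"
  proof safe
    fix x y assume x: "x \<in> m0" and y: "y \<in> ?d"
    \<comment> \<open>The orthogonal projection of \<open>x\<close> to the derived algebra. By
      \<open>orth\<close> the remainder \<open>x - z\<close> commutes with \<open>y\<close>, so only
      a bracket inside the derived algebra is left.\<close>
    define z where "z = (\<Sum>p\<in>P. ip x p *\<^sub>R p)"
    have z: "z \<in> ?d" unfolding z_def P(2)[symmetric] by (intro span_sum span_scale span_base)
    have "ip (x - z) p = 0" if "p \<in> P" for p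
      using orthonormal_coeff[OF ip_bilinear P(1,3) that, of "ip x"] by (simp add: z_def ip.diff_left)
    then have "P \<subseteq> {w. ip (x - z) w = 0}" by blast
    moreover have "subspace {w. ip (x - z) w = 0}"
      by (auto simp: subspace_def ip.add_right ip.scaleR_right ip.zero_right)
    ultimately have "ip (x - z) w = 0" if "w \<in> ?d" for w
      using span_minimal that P(2) by blast
    moreover have "x - z \<in> m0" using x z Lm sub subspace_diff by blast
    ultimately have "br0 (x - z) y = 0" using orth y by blast
    then have "br0 x y = br0 z y" by (simp add: br0.diff_left)
    then show "br0 x y \<in> ?L 3" using dd z y by simp
  qed
  \<comment> \<open>The series is therefore stationary from index 2 on, and nilpotency forces the
    stationary value to be zero.\<close>
  then have "?L 2 \<subseteq> ?L 3"
    using span_minimal[OF _ sL[of 3]] by (simp add: numeral_2_eq_2 lower_central.simps One_nat_def)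
  then have step: "?L (2 + k) \<subseteq> ?L (3 + k)" for k
  proof (induction k)
    case (Suc k)
    then show ?case using lower_central_Suc_mono[of m0 br0 "2 + k" "3 + k"] by simp
  qed simp
  have incl: "?L 2 \<subseteq> ?L (2 + k)" for k
  proof (induction k)
    case (Suc k)
    moreover have "2 + Suc k = 3 + k" by simp
    ultimately show ?case using step[of k] by (metis subset_trans)
  qed simp
  obtain k where k: "?L k = {0}" using nilp by (auto simp: nilpotent_lie_def)
  have "?L (2 + k) \<subseteq> ?L k" using dec[of k] dec[of "Suc k"] by (simp del: One_nat_def)
  then show ?thesis using incl[of k] k subspace_0[OF sL[of 2]] by blast
qed

text \<open>The bracket factors through \<open>pr\<close>, so the vanishing of the second lower
  central term also reaches arguments outside \<open>m0\<close>.\<close>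

lemma br0_br0: "br0 (br0 x y) z = 0" "br0 x (br0 y z) = 0"
proof -
  have "br0 x (br0 y z) \<in> lower_central m0 br0 2" for x y z
  proof -
    have "br0 (pr y) (pr z) \<in> lower_central m0 br0 1"
      using lower_central_br[of "pr y" m0 "pr z" br0 0] pr_in by (simp add: One_nat_def)
    then have "br0 (pr x) (br0 (pr y) (pr z)) \<in> lower_central m0 br0 2"
      using lower_central_br[of "pr x" m0 _ br0 1] pr_in by (simp add: numeral_2_eq_2 One_nat_def)
    moreover have "br0 (pr x) (br0 (pr y) (pr z)) = br0 x (br0 y z)"
      using br0_pr[of x "br0 y z"] by (simp add: br0_pr pr_id[OF br0_in])
    ultimately show ?thesis by simp
  qed
  then have *: "br0 x (br0 y z) = 0" for x y z using lower_central_2 by blast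
  show "br0 x (br0 y z) = 0" by (rule *)
  show "br0 (br0 x y) z = 0" using br0_swap[of "br0 x y" z] * by simp
qed

lemma abelian_or_two_step: "abelian_lie m0 br0 \<or> two_step_nilpotent_lie m0 br0"
proof (cases "lower_central m0 br0 1 = {0}")
  case True
  then have "br0 x y = 0" if "x \<in> m0" "y \<in> m0" for x y
    using lower_central_br[of x m0 y br0 0] that by (simp add: One_nat_def)
  then show ?thesis by (auto simp: abelian_lie_def)
next
  case False
  then show ?thesis using lower_central_2 by (simp add: two_step_nilpotent_lie_def)
qed

end

text \<open>The signature is used only through a vector \<open>q\<close> with positive definite
  orthogonal complement. The vector \<open>e\<close> lies in the radical of the derived algebra, and
  \<open>GO\<close> is the conclusion of the geodesic lemma.\<close>

locale lorentz_go_algebra =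
  fixes br :: "'v::euclidean_space \<Rightarrow> 'v \<Rightarrow> 'v" and ip :: "'v \<Rightarrow> 'v \<Rightarrow> real" and q e :: 'v
  assumes lie: "lie_algebra UNIV br" and nil: "nilpotent_lie UNIV br"
    and sym_form: "symmetric_form UNIV ip"
    and spacelike: "\<And>x. ip x q = 0 \<Longrightarrow> x \<noteq> 0 \<Longrightarrow> ip x x > 0"
    and GO: "\<And>x. \<exists>A k. linear A \<and> (\<forall>y z. A (br y z) = br (A y) z + br y (A z)) \<and>
        (\<forall>y z. ip (A y) z = - ip y (A z)) \<and> (\<forall>y. ip (br x y + A y) x = k * ip x y)"
    and e: "e \<in> derived_algebra UNIV br" "e \<noteq> 0" "\<And>y. y \<in> derived_algebra UNIV br \<Longrightarrow> ip e y = 0"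
begin

interpretation br: bounded_bilinear br by (rule lie_algebra_UNIV_bilinear[OF lie])
interpretation ip: bounded_bilinear ip by (rule symmetric_form_UNIV_bilinear[OF sym_form])

lemma ip_commute: "ip x y = ip y x"
  using sym_form by (simp add: symmetric_form_def)

lemma br_self: "br x x = 0"
  using lie by (simp add: lie_algebra_def)

lemma br_swap: "br x y = - br y x"
  using br_self[of "x + y"] br_self[of x] br_self[of y]
  by (simp add: br.add_left br.add_right eq_neg_iff_add_eq_0 add.commute)

lemma jacobi: "br x (br y z) + br y (br z x) + br z (br x y) = 0"
  using lie by (simp add: lie_algebra_def)

lemma br_derived: "br x y \<in> derived_algebra UNIV br"
  unfolding derived_algebra_def by (rule span_base) blast

lemma e_br [simp]: "ip e (br x y) = 0" "ip (br x y) e = 0"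
  using e(3)[OF br_derived] ip_commute by auto

lemma e_null [simp]: "ip e e = 0"
  using e by blast

lemma ip_e_q: "ip e q \<noteq> 0"
  using spacelike[of e] e(2) by auto

text \<open>As \<open>e\<close> is not orthogonal to \<open>q\<close>, a multiple of
  \<open>e\<close> moves \<open>x\<close> into the complement of \<open>q\<close>; since
  \<open>e\<close> is null and orthogonal to \<open>x\<close>, the square of \<open>x\<close> does
  not change.\<close>

lemma e_perp_semidefinite:
  assumes "ip x e = 0"
  shows "ip x x \<ge> 0" and "ip x x = 0 \<Longrightarrow> x \<in> span {e}"
proof -
  define y where "y = x - (ip x q / ip e q) *\<^sub>R e"
  have y: "ip y q = 0" using ip_e_q by (simp add: y_def ip.diff_left ip.scaleR_left)
  have yy: "ip y y = ip x x" using assms ip_commute[of e x]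
    by (simp add: y_def ip.diff_left ip.diff_right ip.scaleR_left ip.scaleR_right)
  show "ip x x \<ge> 0" using spacelike[OF y] yy by (cases "y = 0") (auto simp: ip.zero_left)
  assume "ip x x = 0"
  then have "y = 0" using spacelike[OF y] yy by auto
  then have "x = (ip x q / ip e q) *\<^sub>R e" by (simp add: y_def)
  then show "x \<in> span {e}" by (metis span_base span_scale singletonI)
qed

lemma nondegenerate: "(\<And>y. ip x y = 0) \<Longrightarrow> x = 0"
  using spacelike[of x] by fastforce

lemma ad_nilpotent: "\<exists>k. \<forall>y. (br x ^^ k) y = 0"
proof -
  obtain k where "lower_central UNIV br k = {0}" using nil by (auto simp: nilpotent_lie_def)
  then show ?thesis using ad_power_lower_central[where V = UNIV and br = br and k = k and x = x] by auto
qed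

text \<open>Both \<open>A e\<close> and \<open>A (A e)\<close> stay in the derived algebra, to which
  \<open>e\<close> is orthogonal. By skewness the square of \<open>A e\<close> is minus the product
  of \<open>e\<close> with \<open>A (A e)\<close>, so \<open>A e\<close> is null in the complement
  of \<open>e\<close>.\<close>

lemma derivation_e:
  assumes "linear A" and der: "\<And>y z. A (br y z) = br (A y) z + br y (A z)"
    and skew: "\<And>y z. ip (A y) z = - ip y (A z)"
  shows "A e \<in> span {e}"
proof -
  let ?d = "derived_algebra UNIV br"
  have "A ` {br x y |x y. x \<in> UNIV \<and> y \<in> UNIV} \<subseteq> ?d"
    using der br_derived by (auto simp: derived_algebra_def intro!: span_add)
  then have "span (A ` {br x y |x y. x \<in> UNIV \<and> y \<in> UNIV}) \<subseteq> ?d"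
    unfolding derived_algebra_def by (rule span_minimal) simp
  then have Ad: "A ` ?d \<subseteq> ?d"
    unfolding linear_span_image[OF assms(1)] derived_algebra_def .
  then have "A e \<in> ?d" "A (A e) \<in> ?d" using e(1) by blast+
  then have "ip (A e) e = 0" "ip (A e) (A e) = 0"
    using skew[of e "A e"] e(3) ip_commute[of "A e" e] by auto
  then show ?thesis using e_perp_semidefinite(2) by blast
qed

text \<open>The geodesic condition at vectors of \<open>e\<^sup>\<bottom>\<close>, tested against \<open>e\<close>, says that \<open>ad e\<close> is
  skew-symmetric on the semidefinite space \<open>e\<^sup>\<bottom>\<close>.\<close>

lemma br_e_central:
  assumes "ip x e = 0"
  shows "br e x = 0"
proof -
  let ?W = "{x. ip x e = 0}"
  have self: "ip (br e T) T = 0" if T: "ip T e = 0" for T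
  proof -
    obtain A k where A: "linear A" "\<And>y z. A (br y z) = br (A y) z + br y (A z)"
      "\<And>y z. ip (A y) z = - ip y (A z)" "\<And>y. ip (br T y + A y) T = k * ip T y"
      using GO[of T] by blast
    obtain l where "A e = l *\<^sub>R e" using derivation_e[OF A(1-3)] by (auto simp: span_singleton)
    \<comment> \<open>For \<open>T\<close> orthogonal to \<open>e\<close> both
      \<open>k * ip T e\<close> and the contribution \<open>l * ip e T\<close> of \<open>A e\<close>
      vanish.\<close>
    then have "ip (br T e) T = 0" using A(4)[of e] T ip_commute[of e T]
      by (simp add: ip.add_left ip.scaleR_left)
    then show ?thesis using br_swap[of e T] by (simp add: ip.minus_left)
  qed
  have skew: "ip (br e x) y = - ip x (br e y)" if "x \<in> ?W" "y \<in> ?W" for x y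
    using self[of "x + y"] self[of x] self[of y] that ip_commute[of x "br e y"]
    by (simp add: br.add_right ip.add_left ip.add_right)
  have null: "ip y x = 0" if "x \<in> ?W" "y \<in> ?W" "ip x x = 0" for x y
  proof -
    have "x \<in> span {e}" using e_perp_semidefinite(2)[of x] that by simp
    then obtain l where "x = l *\<^sub>R e" by (auto simp: span_singleton)
    then show ?thesis using that by (simp add: ip.scaleR_right)
  qed
  obtain k where k: "\<And>y. (br e ^^ k) y = 0" using ad_nilpotent by blast
  have S: "br e x \<in> ?W" for x by simp
  have n: "ip ((br e ^^ k) x) ((br e ^^ k) x) = 0" by (simp add: k ip.zero_left)
  have "ip (br e x) (br e x) = 0"
    by (rule skew_nilpotent_semidefinite[where W = ?W and S = "br e", OF S skew null _ n])
       (use assms in simp_all)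
  then obtain l where l: "br e x = l *\<^sub>R e"
    using e_perp_semidefinite(2)[of "br e x"] by (auto simp: span_singleton)
  \<comment> \<open>Semidefiniteness leaves a possible multiple of \<open>e\<close>. It would make
    \<open>e\<close> an eigenvector of the nilpotent map \<open>ad (- x)\<close>, so the eigenvalue
    \<open>l\<close> is zero.\<close>
  then have "br (- x) e = l *\<^sub>R e" using br_swap[of "-x" e] by (simp add: br.minus_right)
  then have pow: "(br (- x) ^^ j) e = l ^ j *\<^sub>R e" for j
    by (induction j) (auto simp: br.scaleR_right)
  obtain j where "\<And>y. (br (- x) ^^ j) y = 0" using ad_nilpotent[of "-x"] by blast
  then have "l = 0" using pow[of j] e(2) by simp
  then show ?thesis using l by simp
qed

text \<open>A double extension needs a nonzero derivation \<open>ad f\<close> on the complement of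
  \<open>e\<close>. If a first choice of \<open>f\<close> commutes with this complement, the
  complement cannot be abelian: otherwise the whole algebra would be, and its derived algebra would
  not contain \<open>e\<close>. Adding to \<open>f\<close> a noncentral \<open>x\<close> of the
  complement then gives a nonzero derivation.\<close>

lemma ex_f: "\<exists>f x. ip f f = 0 \<and> ip e f = 1 \<and> ip x e = 0 \<and> br f x \<noteq> 0"
proof -
  define y where "y = (1 / ip e q) *\<^sub>R q"
  have ey: "ip e y = 1" "ip y e = 1" using ip_e_q ip_commute[of q e] by (simp_all add: y_def ip.scaleR_right ip.scaleR_left)
  define f where "f = y - (ip y y / 2) *\<^sub>R e"
  have f: "ip f f = 0" "ip e f = 1" "ip f e = 1"
    using ey by (simp_all add: f_def ip.diff_right ip.diff_left ip.scaleR_right ip.scaleR_left)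
  show ?thesis
  proof (cases "\<exists>x. ip x e = 0 \<and> br f x \<noteq> 0")
    case True then show ?thesis using f by blast
  next
    case False
    then have fz: "br f x = 0" if "ip x e = 0" for x using that by blast
    have "\<exists>x y. ip x e = 0 \<and> ip y e = 0 \<and> br x y \<noteq> 0"
    proof (rule ccontr)
      assume *: "\<not> ?thesis"
      have "br a b = 0" for a b
      proof -
        have "ip (a - ip a e *\<^sub>R f) e = 0" "ip (b - ip b e *\<^sub>R f) e = 0"
          using f by (simp_all add: ip.diff_left ip.scaleR_left)
        then have "br (a - ip a e *\<^sub>R f) (b - ip b e *\<^sub>R f) = 0" "br f (a - ip a e *\<^sub>R f) = 0"
          "br f (b - ip b e *\<^sub>R f) = 0" using * fz by auto
        then show ?thesis using br_swap[of f a]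
          by (simp add: br.diff_left br.diff_right br.scaleR_left br.scaleR_right br_self)
      qed
      then have "derived_algebra UNIV br = span {0}" by (simp add: derived_algebra_def)
      then show False using e(1,2) by simp
    qed
    then obtain x z where xz: "ip x e = 0" "ip z e = 0" "br x z \<noteq> 0" by blast
    \<comment> \<open>The coefficient of \<open>e\<close> is half the square of
      \<open>f + x\<close>, where \<open>f\<close> is null; subtracting it makes \<open>g\<close>
      null because \<open>ip e (f + x) = 1\<close>.\<close>
    define g where "g = f + x - (ip x x / 2 + ip f x) *\<^sub>R e"
    have "ip g g = 0" "ip e g = 1" using f xz ip_commute[of e x] ip_commute[of x f]
      by (simp_all add: g_def ip.add_left ip.add_right ip.diff_left ip.diff_right ip.scaleR_left ip.scaleR_right algebra_simps)
    moreover have "br g z = br x z"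
      using fz[OF xz(2)] br_e_central[OF xz(2)] by (simp add: g_def br.add_left br.diff_left br.scaleR_left)
    ultimately show ?thesis using xz by metis
  qed
qed

text \<open>\<open>pr\<close> is the orthogonal projection along the hyperbolic plane spanned by
  \<open>e\<close> and \<open>f\<close>. On \<open>m1\<close> it kills exactly the multiples of
  \<open>e\<close>, which are central there, so it is the quotient homomorphism onto
  \<open>m0\<close>.\<close>

theorem double_extension:
  "\<exists>m0 pr br0. lorentz_double_extension UNIV br ip m0 br0 ip \<and> riem_go_algebra m0 pr br0 ip"
proof -
  obtain f x1 where f: "ip f f = 0" "ip e f = 1" and x1: "ip x1 e = 0" "br f x1 \<noteq> 0"
    using ex_f by blast
  have fe: "ip f e = 1" using f ip_commute by metis
  have ee: "ip e e = 0" by simp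
  define m0 where "m0 = {x. ip x e = 0 \<and> ip x f = 0}"
  define m1 where "m1 = {x. ip x e = 0}"
  define pr where "pr x = x - ip x e *\<^sub>R f - ip x f *\<^sub>R e" for x
  define br0 where "br0 x y = pr (br (pr x) (pr y))" for x y
  have lin_pr: "linear pr"
    by (rule linearI) (simp_all add: pr_def ip.add_left ip.scaleR_left algebra_simps)
  note pr_simps = linear_add[OF lin_pr] linear_diff[OF lin_pr] linear_scale[OF lin_pr] linear_0[OF lin_pr] linear_neg[OF lin_pr]
  have pr_in: "pr x \<in> m0" for x
    using f fe by (simp add: m0_def pr_def ip.diff_left ip.scaleR_left)
  have pr_id: "pr x = x" if "x \<in> m0" for x
    using that by (simp add: m0_def pr_def)
  have pr_e: "pr e = 0" using f by (simp add: pr_def)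
  have pr_m1: "x = pr x + ip x f *\<^sub>R e" if "x \<in> m1" for x
    using that by (simp add: m1_def pr_def)
  have pr_0: "x \<in> span {e}" if "x \<in> m1" "pr x = 0" for x
    using pr_m1[OF that(1)] that(2) by (metis add_0 span_base span_scale singletonI)
  have m0_m1: "m0 \<subseteq> m1" by (auto simp: m0_def m1_def)
  have e_m1: "e \<in> m1" by (simp add: m1_def)
  have sub0: "subspace m0" and sub1: "subspace m1"
    by (auto simp: m0_def m1_def subspace_def ip.add_left ip.scaleR_left ip.zero_left)
  have br_m1: "br x y \<in> m1" for x y by (simp add: m1_def)
  \<comment> \<open>An element of \<open>m1\<close> and its projection differ by a multiple of
    \<open>e\<close>, which commutes with \<open>m1\<close>.\<close>
  have pr_br: "pr (br (pr x) y) = pr (br x y)" "pr (br y (pr x)) = pr (br y x)"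
    if "x \<in> m1" "y \<in> m1" for x y
  proof -
    have "br x y = br (pr x) y + ip x f *\<^sub>R br e y"
      using pr_m1[OF that(1)] by (metis br.add_left br.scaleR_left)
    then show 1: "pr (br (pr x) y) = pr (br x y)" using br_e_central[of y] that(2) by (simp add: m1_def)
    then show "pr (br y (pr x)) = pr (br y x)" using br_swap[of y] by (simp add: pr_simps)
  qed
  have br0_m1: "br0 x y = pr (br x y)" if "x \<in> m1" "y \<in> m1" for x y
    using pr_br(1)[OF that(1) that(2)] pr_br(2)[OF that(2), of "pr x"] pr_in m0_m1 by (auto simp: br0_def)
  have pr_br0: "br0 x y = pr (br x y)" if "x \<in> m0" "y \<in> m0" for x y
    using br0_m1 that m0_m1 by blast
  have jac: "br0 x (br0 y z) + br0 y (br0 z x) + br0 z (br0 x y) = 0" for x y z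
  proof -
    have *: "br0 x (br0 y z) = pr (br (pr x) (br (pr y) (pr z)))" for x y z
    proof -
      have "br0 x (br0 y z) = pr (br (pr x) (pr (br (pr y) (pr z))))"
        by (simp add: br0_def pr_id[OF pr_in])
      also have "\<dots> = pr (br (pr x) (br (pr y) (pr z)))"
        using pr_br(2)[OF br_m1] pr_in m0_m1 by blast
      finally show ?thesis .
    qed
    show ?thesis unfolding * pr_simps(1)[symmetric] jacobi by (simp add: pr_simps)
  qed
  have "bilinear br0" unfolding bilinear_def br0_def
    by (auto intro!: linearI simp: pr_simps br.add_left br.add_right br.scaleR_left br.scaleR_right)
  then have bil: "bounded_bilinear br0" by (simp add: bilinear_conv_bounded_bilinear)
  have br0_lc: "lower_central m0 br0 k \<subseteq> pr ` lower_central UNIV br k" for k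
  proof (induction k)
    case 0
    show ?case
    proof
      fix x assume "x \<in> lower_central m0 br0 0"
      then have "x = pr x" using pr_id by simp
      then show "x \<in> pr ` lower_central UNIV br 0" by simp
    qed
  next
    case (Suc k)
    have sm: "subspace (pr ` lower_central UNIV br (Suc k))"
      using linear_subspace_image[OF lin_pr lower_central_subspace] by simp
    have lm: "lower_central UNIV br k \<subseteq> lower_central UNIV br k" by simp
    have "{br0 x y |x y. x \<in> m0 \<and> y \<in> lower_central m0 br0 k} \<subseteq> pr ` lower_central UNIV br (Suc k)"
    proof safe
      fix x y assume x: "x \<in> m0" and "y \<in> lower_central m0 br0 k"
      then obtain w where w: "w \<in> lower_central UNIV br k" "y = pr w" using Suc by blast
      show "br0 x y \<in> pr ` lower_central UNIV br (Suc k)"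
      \<comment> \<open>For \<open>k = 0\<close> the preimage \<open>w\<close> is arbitrary and may
        have an \<open>f\<close> component, on which \<open>pr\<close> is not compatible with
        brackets; there \<open>y\<close> itself serves as the preimage. From \<open>k = 1\<close>
        on, \<open>w\<close> is in the derived algebra and hence in \<open>m1\<close>.\<close>
      proof (cases "k = 0")
        case True
        have "br0 x y = pr (br x y)" using pr_br0 x w pr_in by blast
        moreover have "br x y \<in> lower_central UNIV br (Suc k)"
          unfolding True by (rule lower_central_br) auto
        ultimately show ?thesis by blast
      next
        case False
        then obtain j where "k = Suc j" using not0_implies_Suc by blast
        moreover have "span {br x y |x y. x \<in> UNIV \<and> y \<in> lower_central UNIV br j} \<subseteq> m1"
          by (rule span_minimal) (use br_m1 sub1 in auto)
        ultimately have "w \<in> m1" using w(1) by (auto simp: lower_central.simps)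
        then have "br0 x y = pr (br x w)"
          using br0_m1 x w(2) pr_in m0_m1 pr_br(2) by (metis subsetD)
        moreover have "br x w \<in> lower_central UNIV br (Suc k)"
          by (rule lower_central_br) (use w in auto)
        ultimately show ?thesis by blast
      qed
    qed
    then show ?case unfolding lower_central.simps(2)[of m0] using span_minimal sm by blast
  qed
  have nilp0: "nilpotent_lie m0 br0"
  proof -
    obtain k where "lower_central UNIV br k = {0}" using nil by (auto simp: nilpotent_lie_def)
    then have "lower_central m0 br0 k \<subseteq> {0}" using br0_lc[of k] by (simp add: pr_simps)
    then have "lower_central m0 br0 k = {0}"
      using subspace_0[OF lower_central_subspace[OF sub0]] by blast
    then show ?thesis by (auto simp: nilpotent_lie_def)
  qed
  have pos0: "ip x x > 0" if "x \<in> m0" "x \<noteq> 0" for x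
  proof -
    have *: "ip x x \<noteq> 0"
    proof
      assume "ip x x = 0"
      then have "x \<in> span {e}" using e_perp_semidefinite(2)[of x] that by (simp add: m0_def)
      then obtain l where l: "x = l *\<^sub>R e" by (auto simp: span_singleton)
      then have "ip x f = l" using f by (simp add: ip.scaleR_left)
      then show False using that l by (simp add: m0_def)
    qed
    then show ?thesis using e_perp_semidefinite(1)[of x] that by (auto simp: m0_def)
  qed
  have go0: "\<exists>D. linear D \<and> range D \<subseteq> m0 \<and> (\<forall>y z. D (br0 y z) = br0 (D y) z + br0 y (D z)) \<and>
        (\<forall>y\<in>m0. \<forall>z\<in>m0. ip (D y) z = - ip y (D z)) \<and> (\<forall>y\<in>m0. ip (br0 x y + D y) x = 0)"
    if x: "x \<in> m0" for x
  proof -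
    obtain A k where A: "linear A" "\<And>y z. A (br y z) = br (A y) z + br y (A z)"
      "\<And>y z. ip (A y) z = - ip y (A z)" "\<And>y. ip (br x y + A y) x = k * ip x y"
      using GO[of x] by blast
    obtain l where l: "A e = l *\<^sub>R e" using derivation_e[OF A(1-3)] by (auto simp: span_singleton)
    have A_m1: "A y \<in> m1" if "y \<in> m1" for y
      using that A(3)[of y e] l by (simp add: m1_def ip.scaleR_right)
    have pr_A: "pr (A (pr y)) = pr (A y)" if "y \<in> m1" for y
    proof -
      have "A y = A (pr y + ip y f *\<^sub>R e)" using pr_m1[OF that] by simp
      then have "A y = A (pr y) + (ip y f * l) *\<^sub>R e"
        by (simp add: linear_add[OF A(1)] linear_scale[OF A(1)] l)
      then show ?thesis by (simp add: pr_simps pr_e)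
    qed
    define D where "D y = pr (A (pr y))" for y
    have ip_pr: "ip (pr y) z = ip y z" if "y \<in> m1" "z \<in> m0" for y z
      using pr_m1[OF that(1)] that(2) ip_commute[of e z]
      by (metis (mono_tags, lifting) add.right_neutral ip.add_left ip.scaleR_left m0_def mem_Collect_eq mult_zero_right real_scaleR_def)
    have pm: "pr y \<in> m1" for y using pr_in m0_m1 by blast
    have "D (br0 y z) = br0 (D y) z + br0 y (D z)" for y z
    proof -
      have "D (br0 y z) = pr (A (br (pr y) (pr z)))"
        using pr_A[OF br_m1] by (simp add: D_def br0_def pr_id[OF pr_in])
      also have "\<dots> = pr (br (A (pr y)) (pr z)) + pr (br (pr y) (A (pr z)))"
        by (simp add: A(2) pr_simps)
      also have "pr (br (A (pr y)) (pr z)) = br0 (D y) z"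
        using pr_br(1)[OF A_m1[OF pm] pm] by (simp add: br0_def D_def pr_id[OF pr_in])
      also have "pr (br (pr y) (A (pr z))) = br0 y (D z)"
        using pr_br(2)[OF A_m1[OF pm] pm] by (simp add: br0_def D_def pr_id[OF pr_in])
      finally show ?thesis .
    qed
    moreover have ipD: "ip (D y) z = ip (A y) z" if "y \<in> m0" "z \<in> m0" for y z
      using ip_pr[OF A_m1 that(2)] that m0_m1 pr_id by (auto simp: D_def)
    moreover have "ip (D y) z = - ip y (D z)" if "y \<in> m0" "z \<in> m0" for y z
      using ipD[OF that] ipD[OF that(2,1)] A(3)[of y z] ip_commute by metis
    moreover have "ip (br0 x y + D y) x = 0" if y: "y \<in> m0" for y
    proof (cases "x = 0")
      case True then show ?thesis by (simp add: ip.zero_right)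
    next
      case False
      \<comment> \<open>The test vector \<open>y = x\<close> kills the bracket and the derivation
        term, so \<open>k\<close> times the positive square of \<open>x\<close> is zero.\<close>
      have "ip (A x) x = 0" using A(3)[of x x] ip_commute[of x "A x"] by simp
      then have "k * ip x x = 0" using A(4)[of x] by (simp add: br_self)
      then have "k = 0" using pos0[OF x False] by simp
      then have "ip (br x y) x + ip (A y) x = 0" using A(4)[of y] by (simp add: ip.add_left)
      moreover have "ip (br0 x y) x = ip (br x y) x"
        using pr_br0[OF x y] ip_pr[OF br_m1 x] by simp
      ultimately show ?thesis using ipD[OF y x] by (simp add: ip.add_left)
    qed
    moreover have "linear D" unfolding D_def
      using linear_compose[OF linear_compose[OF lin_pr A(1)] lin_pr] by (simp add: o_def)
    moreover have "range D \<subseteq> m0" using pr_in by (auto simp: D_def)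
    ultimately show ?thesis by blast
  qed
  have b1: "br0 x y \<in> m0" and b2: "br0 x x = 0" and b3: "br0 (pr x) (pr y) = br0 x y" for x y
    using pr_in by (simp_all add: br0_def br_self pr_simps pr_id[OF pr_in])
  have riem: "riem_go_algebra m0 pr br0 ip"
    by (rule riem_go_algebra.intro)
      (fact sub0 bil b1 b2 jac nilp0 ip.bounded_bilinear_axioms ip_commute pos0 go0 pr_in pr_id b3 | assumption)+
  have m1_eq: "m1 = {a *\<^sub>R e + x |a x. x \<in> m0}"
  proof safe
    fix x assume "x \<in> m1"
    then have "x = ip x f *\<^sub>R e + pr x" using pr_m1[of x] by (metis add.commute)
    then show "\<exists>a y. x = a *\<^sub>R e + y \<and> y \<in> m0" using pr_in by blast
  next
    fix a x assume "x \<in> m0"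
    then show "a *\<^sub>R e + x \<in> m1" by (simp add: m0_def m1_def ip.add_left ip.scaleR_left)
  qed
  have UNIV_eq: "UNIV = {b *\<^sub>R f + y |b y. y \<in> m1}"
  proof safe
    fix x
    have "x - ip x e *\<^sub>R f \<in> m1" using fe by (simp add: m1_def ip.diff_left ip.scaleR_left)
    then show "\<exists>b y. x = b *\<^sub>R f + y \<and> y \<in> m1"
      by (intro exI[of _ "ip x e"] exI[of _ "x - ip x e *\<^sub>R f"]) auto
  qed auto
  have lie1: "lie_algebra m1 br"
    using lie sub1 br_m1 by (simp add: lie_algebra_def)
  have abel: "lie_algebra (span S) (\<lambda>_ _. 0)" for S :: "'v set"
    by (simp add: lie_algebra_def span_zero)
  have ext1: "lie_extension (span {e}) (\<lambda>_ _. 0) m1 br m0 br0 pr"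
  proof -
    have "span {e} \<subseteq> m1" by (rule span_minimal) (use e_m1 sub1 in auto)
    moreover have "br x y = 0" if "x \<in> span {e}" "y \<in> span {e}" for x y
      using that by (auto simp: span_singleton br.scaleR_left br.scaleR_right br_self)
    moreover have "pr ` m1 = m0" using pr_in pr_id m0_m1 by force
    moreover have "{x \<in> m1. pr x = 0} = span {e}"
      using pr_0 calculation(1) by (auto simp: span_singleton pr_simps pr_e)
    moreover have "pr (br x y) = br0 (pr x) (pr y)" if "x \<in> m1" "y \<in> m1" for x y
      using br0_m1[OF that] b3 by simp
    ultimately show ?thesis using riem_go_algebra.lie_algebra_m0[OF riem] lie1 abel
      unfolding lie_extension_def lie_hom_def by (auto simp: pr_simps)
  qed
  have ext2: "lie_extension m1 br UNIV br (span {f}) (\<lambda>_ _. 0) (\<lambda>x. ip x e *\<^sub>R f)"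
  proof -
    have "f \<noteq> 0" using fe by (auto simp: ip.zero_left)
    moreover have "range (\<lambda>x. ip x e *\<^sub>R f) = span {f}"
      using fe by (auto simp: span_singleton image_def ip.scaleR_left) (metis fe ip.scaleR_left mult.right_neutral real_scaleR_def)
    ultimately show ?thesis using lie lie1 abel[of "{f}"]
      unfolding lie_extension_def lie_hom_def
      by (auto simp: ip.add_left ip.scaleR_left scaleR_add_left m1_def span_singleton)
  qed
  have der: "lie_derivation m1 br (br f)"
  proof -
    have "br f (br x y) = br (br f x) y + br x (br f y)" for x y
      using jacobi[of f x y] br_swap[of "br f x" y] br_swap[of y f]
      by (simp add: br.minus_right algebra_simps add_eq_0_iff)
    then show ?thesis using br_m1 by (auto simp: lie_derivation_def br.add_right br.scaleR_right)
  qed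
  have metric: "metric_lie_algebra UNIV br ip"
    using lie sym_form nondegenerate by (auto simp: metric_lie_algebra_def degenerate_on_def)
  have "e \<notin> m0" "f \<notin> m1" using f fe by (auto simp: m0_def m1_def)
  moreover have "\<exists>x\<in>m1. br f x \<noteq> 0" "\<forall>x\<in>m1. br e x = 0" "\<forall>x\<in>m0. pr x = x"
      "\<forall>x\<in>m0. ip e x = 0 \<and> ip f x = 0"
    using x1 br_e_central pr_id by (auto simp: m1_def m0_def ip_commute[of _ e] ip_commute[of _ f])
  ultimately have "e \<notin> m0 \<and> m1 = {a *\<^sub>R e + x |a x. x \<in> m0} \<and>
        f \<notin> m1 \<and> UNIV = {b *\<^sub>R f + y |b y. y \<in> m1} \<and>
        lie_extension (span {e}) (\<lambda>_ _. 0) m1 br m0 br0 pr \<and> (\<forall>x\<in>m0. pr x = x) \<and>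
        (\<forall>x\<in>m1. br e x = 0) \<and>
        lie_extension m1 br UNIV br (span {f}) (\<lambda>_ _. 0) (\<lambda>x. ip x e *\<^sub>R f) \<and> ip f e *\<^sub>R f = f \<and>
        lie_derivation m1 br (br f) \<and> (\<exists>x\<in>m1. br f x \<noteq> 0) \<and>
        (\<forall>x\<in>m0. \<forall>y\<in>m0. ip x y = ip x y) \<and>
        (\<forall>x\<in>m0. ip e x = 0 \<and> ip f x = 0) \<and>
        ip e e = 0 \<and> ip f f = 0 \<and> ip e f = 1"
    by (intro conjI m1_eq UNIV_eq ext1 ext2 der f ee) (simp_all add: fe)
  then have "lorentz_double_extension UNIV br ip m0 br0 ip"
    unfolding lorentz_double_extension_def
    using riem_go_algebra.metric_lie_algebra_m0[OF riem] riem_go_algebra.positive_definite_m0[OF riem] metric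
    by blast
  then show ?thesis using riem by blast
qed

end

subsection \<open>Smooth maps on open sets\<close>

abbreviation FD :: "('a::real_normed_vector \<Rightarrow> 'b::real_normed_vector) \<Rightarrow> 'a \<Rightarrow> 'a \<Rightarrow> 'b" where
  "FD f x \<equiv> frechet_derivative f (at x)"

lemma FD_eq: "(f has_derivative f') (at x) \<Longrightarrow> FD f x = f'"
  using frechet_derivative_at by metis

lemma C_on_cong_open:
  assumes "open S" "\<And>x. x \<in> S \<Longrightarrow> f x = g x" "C_on k UNIV S f"
  shows "C_on k UNIV S g"
proof (cases k)
  case 0
  then show ?thesis using assms continuous_on_cong[of S S f g] by simp
next
  case (Suc m)
  then obtain f' where f': "\<forall>x\<in>S. (f has_derivative f' x) (at x)" "\<forall>v. C_on m UNIV S (\<lambda>x. f' x v)"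
    using assms(3) by auto
  have "\<forall>x\<in>S. (g has_derivative f' x) (at x)"
    using f'(1) has_derivative_transform_within_open[OF _ assms(1)] assms(2) by blast
  then show ?thesis using f'(2) Suc by auto
qed

lemma C_on_subset: "C_on k V S f \<Longrightarrow> T \<subseteq> S \<Longrightarrow> C_on k V T f"
proof (induction k arbitrary: f)
  case 0 then show ?case by (auto intro: continuous_on_subset)
next
  case (Suc k)
  then obtain f' where "\<forall>x\<in>S. (f has_derivative f' x) (at x within V)" "\<forall>v\<in>V. C_on k V S (\<lambda>x. f' x v)"
    by auto
  then show ?case using Suc by (auto intro!: exI[of _ f'])
qed

lemma smooth_on_subset: "smooth_on V S f \<Longrightarrow> T \<subseteq> S \<Longrightarrow> smooth_on V T f"
  by (auto simp: smooth_on_def intro: C_on_subset)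

lemma smooth_on_cong_open:
  "open S \<Longrightarrow> (\<And>x. x \<in> S \<Longrightarrow> f x = g x) \<Longrightarrow> smooth_on UNIV S f \<Longrightarrow> smooth_on UNIV S g"
  unfolding smooth_on_def using C_on_cong_open by blast

lemma smooth_on_has_derivative:
  assumes "smooth_on UNIV S f" "x \<in> S"
  shows "(f has_derivative FD f x) (at x)"
proof -
  have "C_on (Suc 0) UNIV S f" using assms by (simp only: smooth_on_def)
  then show ?thesis using assms(2) FD_eq by fastforce
qed

lemma smooth_on_continuous: "smooth_on V S f \<Longrightarrow> continuous_on S f"
  by (metis C_on.simps(1) smooth_on_def)

lemma smooth_on_FD:
  assumes "open S" "smooth_on UNIV S f"
  shows "smooth_on UNIV S (\<lambda>x. FD f x v)"
  unfolding smooth_on_def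
proof
  fix k
  have "C_on (Suc k) UNIV S f" using assms by (simp only: smooth_on_def)
  then obtain f' where f': "\<forall>x\<in>S. (f has_derivative f' x) (at x)" "C_on k UNIV S (\<lambda>x. f' x v)"
    by auto
  show "C_on k UNIV S (\<lambda>x. FD f x v)"
    by (rule C_on_cong_open[OF assms(1) _ f'(2)]) (use f'(1) FD_eq in metis)
qed

lemma smooth_on_linear: "smooth_on UNIV S f \<Longrightarrow> x \<in> S \<Longrightarrow> linear (FD f x)"
  using smooth_on_has_derivative has_derivative_linear by blast

text \<open>Both mixed second derivatives are limits of the same second difference.\<close>

lemma second_difference:
  fixes F :: "'a::euclidean_space \<Rightarrow> real"
  assumes F: "\<And>y. y \<in> ball x r \<Longrightarrow> (F has_derivative F' y) (at y)"
    and G: "\<And>y. y \<in> ball x r \<Longrightarrow> ((\<lambda>y. F' y v) has_derivative G y) (at y)"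
    and s: "s > 0" "s * (norm v + norm w) < r"
  shows "\<exists>y\<in>ball x r. F (x + s *\<^sub>R v + s *\<^sub>R w) - F (x + s *\<^sub>R v) - F (x + s *\<^sub>R w) + F x = s * s * G y w"
proof -
  have B: "x + a *\<^sub>R v + b *\<^sub>R w \<in> ball x r" if "0 \<le> a" "a \<le> s" "0 \<le> b" "b \<le> s" for a b
  proof -
    have "norm (a *\<^sub>R v + b *\<^sub>R w) \<le> a * norm v + b * norm w"
      using norm_triangle_ineq[of "a *\<^sub>R v" "b *\<^sub>R w"] that by simp
    also have "\<dots> \<le> s * norm v + s * norm w" using that by (intro add_mono mult_right_mono) auto
    finally have "dist (x + a *\<^sub>R v + b *\<^sub>R w) x < r" using s by (simp add: dist_norm algebra_simps)
    then show ?thesis by (simp add: dist_commute)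
  qed
  have B0: "x + a *\<^sub>R v \<in> ball x r" if "0 \<le> a" "a \<le> s" for a using B[OF that, of 0] s by simp
  have d1: "((\<lambda>a. F (x + a *\<^sub>R v + s *\<^sub>R w) - F (x + a *\<^sub>R v)) has_derivative
      (\<lambda>h. h * (F' (x + a *\<^sub>R v + s *\<^sub>R w) v - F' (x + a *\<^sub>R v) v))) (at a within {0..s})"
    if "0 \<le> a" "a \<le> s" for a
  proof -
    have 1: "linear (F' y)" if "y \<in> ball x r" for y using F[OF that] has_derivative_linear by blast
    have "((\<lambda>a. F (x + a *\<^sub>R v + s *\<^sub>R w)) has_derivative (\<lambda>h. F' (x + a *\<^sub>R v + s *\<^sub>R w) (h *\<^sub>R v))) (at a within {0..s})"
      by (rule has_derivative_compose[where g = F]) (auto intro!: derivative_eq_intros F B that less_imp_le s)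
    moreover have "((\<lambda>a. F (x + a *\<^sub>R v)) has_derivative (\<lambda>h. F' (x + a *\<^sub>R v) (h *\<^sub>R v))) (at a within {0..s})"
      by (rule has_derivative_compose[where g = F]) (auto intro!: derivative_eq_intros F B0 that)
    ultimately show ?thesis
      using 1[OF B[OF that, of s]] 1[OF B0[OF that]] s(1)
      by (auto simp: linear_scale algebra_simps dest: has_derivative_diff)
  qed
  obtain a where a: "0 < a" "a < s"
    "F (x + s *\<^sub>R v + s *\<^sub>R w) - F (x + s *\<^sub>R v) - (F (x + s *\<^sub>R w) - F x) =
      s * (F' (x + a *\<^sub>R v + s *\<^sub>R w) v - F' (x + a *\<^sub>R v) v)"
    using mvt_simple[OF s(1), of "\<lambda>a. F (x + a *\<^sub>R v + s *\<^sub>R w) - F (x + a *\<^sub>R v)", OF d1] by auto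
  have d2: "((\<lambda>b. F' (x + a *\<^sub>R v + b *\<^sub>R w) v) has_derivative (\<lambda>h. h * G (x + a *\<^sub>R v + b *\<^sub>R w) w)) (at b within {0..s})"
    if "0 \<le> b" "b \<le> s" for b
  proof -
    have y: "x + a *\<^sub>R v + b *\<^sub>R w \<in> ball x r" using B a that by simp
    have "((\<lambda>b. F' (x + a *\<^sub>R v + b *\<^sub>R w) v) has_derivative (\<lambda>h. G (x + a *\<^sub>R v + b *\<^sub>R w) (h *\<^sub>R w))) (at b within {0..s})"
      by (rule has_derivative_compose[where g = "\<lambda>y. F' y v"]) (auto intro!: derivative_eq_intros G y)
    moreover have "linear (G (x + a *\<^sub>R v + b *\<^sub>R w))" using G[OF y] has_derivative_linear by blast
    ultimately show ?thesis by (simp add: linear_scale)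
  qed
  obtain b where b: "0 < b" "b < s"
    "F' (x + a *\<^sub>R v + s *\<^sub>R w) v - F' (x + a *\<^sub>R v) v = s * G (x + a *\<^sub>R v + b *\<^sub>R w) w"
    using mvt_simple[OF s(1), of "\<lambda>b. F' (x + a *\<^sub>R v + b *\<^sub>R w) v", OF d2] by auto
  show ?thesis
    by (rule bexI[OF _ B[of a b]]) (use a b in auto)
qed

lemma FD_FD_symmetric_real:
  fixes f :: "'a::euclidean_space \<Rightarrow> real"
  assumes S: "open S" "smooth_on UNIV S f" "x \<in> S"
  shows "FD (\<lambda>y. FD f y v) x w = FD (\<lambda>y. FD f y w) x v"
proof (rule ccontr)
  define P where "P y = FD (\<lambda>y. FD f y v) y w" for y
  define R where "R y = FD (\<lambda>y. FD f y w) y v" for y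
  assume "\<not> ?thesis"
  then have ne: "dist (P x) (R x) > 0" by (simp add: P_def R_def)
  have sm: "smooth_on UNIV S (\<lambda>y. FD f y u)" for u using smooth_on_FD[OF S(1,2)] .
  have "continuous_on S P" "continuous_on S R"
    unfolding P_def R_def using smooth_on_FD[OF S(1) sm] smooth_on_continuous by blast+
  then have "isCont P x" "isCont R x" using S by (simp_all add: continuous_on_eq_continuous_at)
  then obtain d1 d2 where d: "d1 > 0" "\<And>y. dist y x < d1 \<Longrightarrow> dist (P y) (P x) < dist (P x) (R x) / 2"
     "d2 > 0" "\<And>y. dist y x < d2 \<Longrightarrow> dist (R y) (R x) < dist (P x) (R x) / 2"
    unfolding continuous_at_eps_delta using ne half_gt_zero by metis
  obtain d3 where d3: "d3 > 0" "ball x d3 \<subseteq> S" using S open_contains_ball by blast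
  define r where "r = min d3 (min d1 d2)"
  have r: "r > 0" "ball x r \<subseteq> S" using d d3 by (auto simp: r_def)
  \<comment> \<open>Small enough for the parallelogram with sides \<open>s v\<close> and
    \<open>s w\<close> to stay in the ball; the summand 1 covers the case
    \<open>v = w = 0\<close>.\<close>
  define s where "s = r / (2 * (norm v + norm w + 1))"
  have s: "s > 0" using r by (auto simp: s_def intro!: divide_pos_pos add_nonneg_pos)
  have pos: "2 * (norm v + norm w + 1) > 0" by (simp add: add_nonneg_pos)
  have sr: "s * (norm v + norm w) < r"
  proof -
    have "r * (norm v + norm w) < r * (2 * (norm v + norm w + 1))"
      using r(1) by (intro mult_strict_left_mono) (auto simp: add_nonneg_pos)
    then show ?thesis unfolding s_def using pos by (simp add: divide_less_eq)
  qed
  have sr': "s * (norm w + norm v) < r" using sr by (simp add: add.commute)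
  have F: "(f has_derivative FD f y) (at y)" if "y \<in> ball x r" for y
    using smooth_on_has_derivative[OF S(2)] that r by blast
  have G: "((\<lambda>y. FD f y u) has_derivative FD (\<lambda>y. FD f y u) y) (at y)" if "y \<in> ball x r" for y u
    using smooth_on_has_derivative[OF sm] that r by blast
  obtain y where y: "y \<in> ball x r"
    "f (x + s *\<^sub>R v + s *\<^sub>R w) - f (x + s *\<^sub>R v) - f (x + s *\<^sub>R w) + f x = s * s * P y"
    unfolding P_def using second_difference[OF F G s sr] by blast
  obtain z where z: "z \<in> ball x r"
    "f (x + s *\<^sub>R w + s *\<^sub>R v) - f (x + s *\<^sub>R w) - f (x + s *\<^sub>R v) + f x = s * s * R z"
    unfolding R_def using second_difference[where v = w and w = v, OF F G s sr'] by blast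
  have comm: "x + s *\<^sub>R w + s *\<^sub>R v = x + s *\<^sub>R v + s *\<^sub>R w" by simp
  have "s * s * R z = s * s * P y" using y(2) z(2) unfolding comm by linarith
  then have "P y = R z" using s by simp
  moreover have "dist (P y) (P x) < dist (P x) (R x) / 2" "dist (R z) (R x) < dist (P x) (R x) / 2"
    using d(2)[of y] d(4)[of z] y(1) z(1) by (simp_all add: r_def dist_commute)
  ultimately show False using dist_triangle2[of "P x" "R x" "R z"] by (simp add: dist_commute)
qed

lemma smooth_on_inner:
  assumes "open S" "smooth_on UNIV S f"
  shows "smooth_on UNIV S (\<lambda>x. f x \<bullet> b)"
proof -
  have "C_on k UNIV S (\<lambda>x. f x \<bullet> b)" if "smooth_on UNIV S f" for k
    using that
  proof (induction k arbitrary: f)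
    case 0
    then show ?case using smooth_on_continuous by (auto intro!: continuous_intros)
  next
    case (Suc k)
    have "\<forall>x\<in>S. ((\<lambda>x. f x \<bullet> b) has_derivative (\<lambda>v. FD f x v \<bullet> b)) (at x)"
      using smooth_on_has_derivative[OF Suc.prems] by (auto intro!: derivative_eq_intros)
    then show ?case using Suc.IH[OF smooth_on_FD[OF assms(1) Suc.prems]]
      by (auto intro!: exI[of _ "\<lambda>x v. FD f x v \<bullet> b"])
  qed
  then show ?thesis using assms by (simp add: smooth_on_def)
qed

lemma FD_FD_symmetric:
  fixes f :: "'a::euclidean_space \<Rightarrow> 'b::euclidean_space"
  assumes S: "open S" "smooth_on UNIV S f" "x \<in> S"
  shows "FD (\<lambda>y. FD f y v) x w = FD (\<lambda>y. FD f y w) x v"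
proof (rule euclidean_eqI)
  fix b :: 'b
  have 1: "FD (\<lambda>x. f x \<bullet> b) y u = FD f y u \<bullet> b" if "smooth_on UNIV S f" "y \<in> S" for f :: "'a \<Rightarrow> 'b" and y u
    using FD_eq[OF has_derivative_inner_left[OF smooth_on_has_derivative[OF that]], of b] by simp
  have 2: "FD (\<lambda>y. FD (\<lambda>x. f x \<bullet> b) y v) x w = FD (\<lambda>y. FD f y v) x w \<bullet> b" for v w
  proof -
    have "((\<lambda>y. FD f y v \<bullet> b) has_derivative (\<lambda>w. FD (\<lambda>y. FD f y v) x w \<bullet> b)) (at x)"
      by (rule has_derivative_inner_left[OF smooth_on_has_derivative[OF smooth_on_FD[OF S(1,2)] S(3)]])
    then have "((\<lambda>y. FD (\<lambda>x. f x \<bullet> b) y v) has_derivative (\<lambda>w. FD (\<lambda>y. FD f y v) x w \<bullet> b)) (at x)"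
      by (rule has_derivative_transform_within_open[OF _ S(1,3)]) (simp add: 1 S)
    then show ?thesis using FD_eq by metis
  qed
  show "FD (\<lambda>y. FD f y v) x w \<bullet> b = FD (\<lambda>y. FD f y w) x v \<bullet> b"
    using FD_FD_symmetric_real[OF S(1) smooth_on_inner[OF S(1,2)] S(3), of b v w] unfolding 2 .
qed

text \<open>A product rule that asks only for differentiability of each \<open>\<Gamma> z v\<close>
  with \<open>v\<close> fixed: expanding \<open>a z\<close> in the standard basis turns
  \<open>\<Gamma> z (a z)\<close> into a finite sum of products.\<close>

lemma has_derivative_linear_family:
  fixes \<Gamma> :: "'e::euclidean_space \<Rightarrow> 'v::euclidean_space \<Rightarrow> 'c::euclidean_space"
  assumes lin: "\<forall>\<^sub>F z in nhds x. linear (\<Gamma> z)"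
    and diff: "\<And>v. (\<lambda>z. \<Gamma> z v) differentiable at x"
    and a: "(a has_derivative a') (at x)"
  shows "((\<lambda>z. \<Gamma> z (a z)) has_derivative (\<lambda>h. FD (\<lambda>z. \<Gamma> z (a x)) x h + \<Gamma> x (a' h))) (at x)"
proof -
  obtain U where U: "open U" "x \<in> U" "\<And>z. z \<in> U \<Longrightarrow> linear (\<Gamma> z)"
    using lin unfolding eventually_nhds by blast
  have expand: "\<Gamma> z v = (\<Sum>i\<in>Basis. (v \<bullet> i) *\<^sub>R \<Gamma> z i)" if "z \<in> U" for z v
  proof -
    have "\<Gamma> z v = \<Gamma> z (\<Sum>i\<in>Basis. (v \<bullet> i) *\<^sub>R i)" by (simp add: euclidean_representation)
    then show ?thesis using U(3)[OF that] by (simp add: linear_sum linear_scale)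
  qed
  have der: "((\<lambda>z. \<Gamma> z v) has_derivative FD (\<lambda>z. \<Gamma> z v) x) (at x)" for v
    using diff frechet_derivative_works by blast
  have "((\<lambda>z. \<Sum>i\<in>Basis. (a z \<bullet> i) *\<^sub>R \<Gamma> z i) has_derivative
      (\<lambda>h. \<Sum>i\<in>Basis. (a x \<bullet> i) *\<^sub>R FD (\<lambda>z. \<Gamma> z i) x h + (a' h \<bullet> i) *\<^sub>R \<Gamma> x i)) (at x)"
    by (auto intro!: derivative_eq_intros der a)
  then have 1: "((\<lambda>z. \<Gamma> z (a z)) has_derivative
      (\<lambda>h. \<Sum>i\<in>Basis. (a x \<bullet> i) *\<^sub>R FD (\<lambda>z. \<Gamma> z i) x h + (a' h \<bullet> i) *\<^sub>R \<Gamma> x i)) (at x)"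
    by (rule has_derivative_transform_within_open[OF _ U(1,2)]) (simp add: expand[symmetric])
  have "((\<lambda>z. \<Sum>i\<in>Basis. (a x \<bullet> i) *\<^sub>R \<Gamma> z i) has_derivative
      (\<lambda>h. \<Sum>i\<in>Basis. (a x \<bullet> i) *\<^sub>R FD (\<lambda>z. \<Gamma> z i) x h)) (at x)"
    by (auto intro!: derivative_eq_intros der)
  then have "((\<lambda>z. \<Gamma> z (a x)) has_derivative (\<lambda>h. \<Sum>i\<in>Basis. (a x \<bullet> i) *\<^sub>R FD (\<lambda>z. \<Gamma> z i) x h)) (at x)"
    by (rule has_derivative_transform_within_open[OF _ U(1,2)]) (simp add: expand[symmetric])
  then have "FD (\<lambda>z. \<Gamma> z (a x)) x = (\<lambda>h. \<Sum>i\<in>Basis. (a x \<bullet> i) *\<^sub>R FD (\<lambda>z. \<Gamma> z i) x h)"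
    by (rule FD_eq)
  then have "(\<lambda>h. \<Sum>i\<in>Basis. (a x \<bullet> i) *\<^sub>R FD (\<lambda>z. \<Gamma> z i) x h + (a' h \<bullet> i) *\<^sub>R \<Gamma> x i) =
     (\<lambda>h. FD (\<lambda>z. \<Gamma> z (a x)) x h + \<Gamma> x (a' h))"
    by (simp add: sum.distrib expand[OF U(2), symmetric])
  then show ?thesis using 1 by simp
qed

text \<open>The rule for linear families, applied once in each slot of the form.\<close>

lemma has_derivative_form:
  fixes g :: "'a::euclidean_space \<Rightarrow> 'v::euclidean_space \<Rightarrow> 'v \<Rightarrow> real" and \<psi> :: "'e::euclidean_space \<Rightarrow> 'a"
  assumes O: "open U" "\<psi> x \<in> U" and bil: "\<And>y. y \<in> U \<Longrightarrow> bounded_bilinear (g y)"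
    and diff: "\<And>v w. (\<lambda>y. g y v w) differentiable at (\<psi> x)"
    and \<psi>: "(\<psi> has_derivative \<psi>') (at x)"
    and a: "(a has_derivative a') (at x)" and b: "(b has_derivative b') (at x)"
  shows "((\<lambda>z. g (\<psi> z) (a z) (b z)) has_derivative
    (\<lambda>h. FD (\<lambda>y. g y (a x) (b x)) (\<psi> x) (\<psi>' h) + g (\<psi> x) (a' h) (b x) + g (\<psi> x) (a x) (b' h))) (at x)"
proof -
  have "isCont \<psi> x" using \<psi> has_derivative_continuous by blast
  then have "(\<psi> \<longlongrightarrow> \<psi> x) (nhds x)" by (simp add: continuous_at tendsto_nhds_iff)
  then have ev: "\<forall>\<^sub>F z in nhds x. \<psi> z \<in> U" using O topological_tendstoD by blast
  have lin1: "\<forall>\<^sub>F z in nhds x. linear (g (\<psi> z) v)" for v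
    using ev by eventually_elim (use bil bounded_bilinear.bounded_linear_right bounded_linear.linear in blast)
  have lin2: "\<forall>\<^sub>F z in nhds x. linear (\<lambda>v. g (\<psi> z) v (b z))"
    using ev by eventually_elim (use bil bounded_bilinear.bounded_linear_left bounded_linear.linear in blast)
  have chain: "((\<lambda>z. g (\<psi> z) v w) has_derivative (\<lambda>h. FD (\<lambda>y. g y v w) (\<psi> x) (\<psi>' h))) (at x)" for v w
    by (rule has_derivative_compose[OF \<psi>, of "\<lambda>y. g y v w"])
       (use diff frechet_derivative_works has_derivative_at_withinI in blast)
  have 1: "((\<lambda>z. g (\<psi> z) v (b z)) has_derivative
      (\<lambda>h. FD (\<lambda>y. g y v (b x)) (\<psi> x) (\<psi>' h) + g (\<psi> x) v (b' h))) (at x)" for v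
    using has_derivative_linear_family[OF lin1 _ b, of v] chain unfolding FD_eq[OF chain] differentiable_def
    by blast
  show ?thesis
    using has_derivative_linear_family[OF lin2 _ a] 1 unfolding FD_eq[OF 1] differentiable_def
    by (simp add: algebra_simps) blast
qed


subsection \<open>The geodesic equation under a change of coordinates\<close>

text \<open>The left-hand side of the geodesic equation with velocity and acceleration as free
  vectors, so that its covariance becomes an identity at one point and mentions no curve.\<close>

definition geodesic_form ::
  "('v::euclidean_space \<Rightarrow> 'v \<Rightarrow> 'v \<Rightarrow> real) \<Rightarrow> 'v \<Rightarrow> 'v \<Rightarrow> 'v \<Rightarrow> 'v \<Rightarrow> real" where
  "geodesic_form g x x' x'' w =
     g x x'' w + FD (\<lambda>u. g u x' w) x x' - 1/2 * FD (\<lambda>u. g u x' x') x w"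

text \<open>Differentiating the pulled-back metric produces second derivatives of
  \<open>\<psi>\<close>. The one in directions \<open>x', x'\<close> is matched by the transformed
  acceleration; the two mixed ones in directions \<open>x', w\<close> cancel by symmetry of second
  derivatives.\<close>

lemma geodesic_form_covariant:
  fixes \<psi> :: "'v::euclidean_space \<Rightarrow> 'v"
  assumes U: "open U" "x \<in> U" "smooth_on UNIV U \<psi>" and W: "open W" "\<psi> x \<in> W"
    and bil: "\<And>y. y \<in> W \<Longrightarrow> bounded_bilinear (gd y)"
    and sym: "\<And>v w. gd (\<psi> x) v w = gd (\<psi> x) w v"
    and diff: "\<And>v w. (\<lambda>y. gd y v w) differentiable at (\<psi> x)"
    and eq: "\<And>u v w. u \<in> U \<Longrightarrow> gd (\<psi> u) (FD \<psi> u v) (FD \<psi> u w) = gc u v w"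
  shows "geodesic_form gd (\<psi> x) (FD \<psi> x x') (FD (\<lambda>u. FD \<psi> u x') x x' + FD \<psi> x x'') (FD \<psi> x w)
    = geodesic_form gc x x' x'' w"
proof -
  interpret g: bounded_bilinear "gd (\<psi> x)" using bil W by blast
  note d\<psi> = smooth_on_has_derivative[OF U(3,2)]
  note dd\<psi> = smooth_on_has_derivative[OF smooth_on_FD[OF U(1,3)] U(2)]
  have gc: "FD (\<lambda>u. gc u v w) x h = FD (\<lambda>y. gd y (FD \<psi> x v) (FD \<psi> x w)) (\<psi> x) (FD \<psi> x h)
     + gd (\<psi> x) (FD (\<lambda>u. FD \<psi> u v) x h) (FD \<psi> x w) + gd (\<psi> x) (FD \<psi> x v) (FD (\<lambda>u. FD \<psi> u w) x h)" for v w h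
  proof -
    note has_derivative_form[where g = gd and \<psi> = \<psi> and a = "\<lambda>u. FD \<psi> u v" and b = "\<lambda>u. FD \<psi> u w",
        OF W bil diff d\<psi> dd\<psi> dd\<psi>]
    then have "((\<lambda>u. gc u v w) has_derivative (\<lambda>h. FD (\<lambda>y. gd y (FD \<psi> x v) (FD \<psi> x w)) (\<psi> x) (FD \<psi> x h)
     + gd (\<psi> x) (FD (\<lambda>u. FD \<psi> u v) x h) (FD \<psi> x w) + gd (\<psi> x) (FD \<psi> x v) (FD (\<lambda>u. FD \<psi> u w) x h))) (at x)"
      by (rule has_derivative_transform_within_open[OF _ U(1,2)]) (assumption | rule eq)+
    from FD_eq[OF this] show ?thesis by simp
  qed
  have S: "FD (\<lambda>u. FD \<psi> u x') x w = FD (\<lambda>u. FD \<psi> u w) x x'"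
    by (rule FD_FD_symmetric[OF U(1,3,2)])
  show ?thesis
    unfolding geodesic_form_def gc eq[OF U(2), symmetric] S
    using sym[of "FD \<psi> x x'" "FD (\<lambda>u. FD \<psi> u w) x x'"] by (simp add: g.add_left field_simps)
qed

subsection \<open>Local existence for ordinary differential equations\<close>

lemma local_lipschitz_ball:
  fixes F :: "'a::euclidean_space \<Rightarrow> 'b::euclidean_space"
  assumes "open U" "y0 \<in> U" and F: "\<And>y. y \<in> U \<Longrightarrow> (F has_derivative F' y) (at y)"
    and cont: "\<And>v. continuous_on U (\<lambda>y. F' y v)"
  shows "\<exists>r L B. r > 0 \<and> L \<ge> 0 \<and> B \<ge> 0 \<and> cball y0 r \<subseteq> U \<and> (\<forall>y\<in>cball y0 r. norm (F y) \<le> B) \<and>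
    (\<forall>y\<in>cball y0 r. \<forall>z\<in>cball y0 r. norm (F y - F z) \<le> L * norm (y - z))"
proof -
  obtain r where r: "r > 0" "cball y0 r \<subseteq> U" using assms open_contains_cball by blast
  have "continuous_on (cball y0 r) (\<lambda>y. \<Sum>i\<in>Basis. norm (F' y i))"
    by (intro continuous_intros continuous_on_subset[OF cont] r)
  then have "bounded ((\<lambda>y. \<Sum>i\<in>Basis. norm (F' y i)) ` cball y0 r)"
    by (intro compact_imp_bounded compact_continuous_image compact_cball)
  then obtain L where L: "\<And>y. y \<in> cball y0 r \<Longrightarrow> norm (\<Sum>i\<in>Basis. norm (F' y i)) \<le> L"
    unfolding bounded_iff by blast
  then have L: "(\<Sum>i\<in>Basis. norm (F' y i)) \<le> L" if "y \<in> cball y0 r" for y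
    using that by fastforce
  have "L \<ge> 0" using L[of y0] r sum_nonneg[of Basis "\<lambda>i. norm (F' y0 i)"] by auto
  have lip: "norm (F y - F z) \<le> L * norm (y - z)" if "y \<in> cball y0 r" "z \<in> cball y0 r" for y z
  proof (rule differentiable_bound[OF convex_cball _ _ that])
    fix x assume x: "x \<in> cball y0 r"
    then have d: "(F has_derivative F' x) (at x)" using F r by blast
    then show "(F has_derivative F' x) (at x within cball y0 r)" by (rule has_derivative_at_withinI)
    have "onorm (F' x) \<le> (\<Sum>i\<in>Basis. norm (F' x i))"
      by (rule onorm_componentwise[OF has_derivative_bounded_linear[OF d]])
    then show "onorm (F' x) \<le> L" using L[OF x] by linarith
  qed
  have "continuous_on (cball y0 r) F"
    using F r has_derivative_continuous by (intro continuous_at_imp_continuous_on) blast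
  then have "bounded (F ` cball y0 r)" using compact_continuous_image compact_cball compact_imp_bounded by blast
  then obtain B where "B > 0" "\<And>y. y \<in> cball y0 r \<Longrightarrow> norm (F y) \<le> B" unfolding bounded_pos by auto
  then show ?thesis using r lip \<open>L \<ge> 0\<close> by (meson less_imp_le)
qed

lemma norm_le_vector_derivative:
  fixes f :: "real \<Rightarrow> 'a::euclidean_space"
  assumes f: "\<And>t. t \<in> {-\<epsilon>..\<epsilon>} \<Longrightarrow> (f has_vector_derivative f' t) (at t within {-\<epsilon>..\<epsilon>})"
    and B: "\<And>t. t \<in> {-\<epsilon>..\<epsilon>} \<Longrightarrow> norm (f' t) \<le> B" and t: "t \<in> {-\<epsilon>..\<epsilon>}" and e: "\<epsilon> > 0"
  shows "norm (f t - f 0) \<le> B * \<epsilon>"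
proof -
  have "norm (f t - f 0) \<le> B * norm (t - 0)"
  proof (rule differentiable_bound[where S = "{-\<epsilon>..\<epsilon>}" and f' = "\<lambda>t h. h *\<^sub>R f' t"])
    show "(f has_derivative (\<lambda>h. h *\<^sub>R f' t)) (at t within {-\<epsilon>..\<epsilon>})" if "t \<in> {-\<epsilon>..\<epsilon>}" for t
      using f[OF that] by (simp add: has_vector_derivative_def)
    show "onorm (\<lambda>h. h *\<^sub>R f' t) \<le> B" if "t \<in> {-\<epsilon>..\<epsilon>}" for t
      by (rule onorm_le) (use B[OF that] in \<open>auto intro!: mult_left_mono simp: mult.commute[of B]\<close>)
  qed (use t e in auto)
  also have "\<dots> \<le> B * \<epsilon>"
  proof -
    have "B \<ge> 0" using B[OF t] norm_ge_zero order_trans by blast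
    then show ?thesis using t by (intro mult_left_mono) auto
  qed
  finally show ?thesis .
qed

lemma picard_local_existence:
  fixes F :: "'a::euclidean_space \<Rightarrow> 'a"
  assumes "open U" "y0 \<in> U" and F: "\<And>y. y \<in> U \<Longrightarrow> (F has_derivative F' y) (at y)"
    and cont: "\<And>v. continuous_on U (\<lambda>y. F' y v)"
  shows "\<exists>\<epsilon>>0. \<exists>y. y 0 = y0 \<and> (\<forall>t. \<bar>t\<bar> < \<epsilon> \<longrightarrow> y t \<in> U \<and> (y has_vector_derivative F (y t)) (at t))"
proof -
  obtain r L B where r: "r > 0" "cball y0 r \<subseteq> U" and L: "L \<ge> 0"
      "\<And>y z. y\<in>cball y0 r \<Longrightarrow> z\<in>cball y0 r \<Longrightarrow> norm (F y - F z) \<le> L * norm (y - z)"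
    and B: "B \<ge> 0" "\<And>y. y\<in>cball y0 r \<Longrightarrow> norm (F y) \<le> B"
    using local_lipschitz_ball[OF assms] by metis
  \<comment> \<open>The first bound keeps the Picard iterates in the ball of radius
    \<open>r\<close>, the second gives contraction factor 1/2; adding 1 avoids division by zero when
    \<open>B\<close> or \<open>L\<close> vanishes.\<close>
  define \<epsilon> where "\<epsilon> = min (r / (B + 1)) (1 / (2 * (L + 1)))"
  have e: "\<epsilon> > 0" using r L B by (simp add: \<epsilon>_def)
  have eB: "B * \<epsilon> \<le> r"
  proof -
    have "B * \<epsilon> \<le> B * (r / (B + 1))" by (rule mult_left_mono) (use B in \<open>auto simp: \<epsilon>_def\<close>)
    also have "\<dots> \<le> r" using B r by (simp add: divide_le_eq algebra_simps)
    finally show ?thesis .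
  qed
  have eL: "L * \<epsilon> \<le> 1/2"
  proof -
    have "L * \<epsilon> \<le> L * (1 / (2 * (L + 1)))" by (rule mult_left_mono) (use L in \<open>auto simp: \<epsilon>_def\<close>)
    also have "\<dots> \<le> 1/2" using L by (simp add: divide_le_eq)
    finally show ?thesis .
  qed
  let ?I = "{-\<epsilon>..\<epsilon>}"
  \<comment> \<open>Clamping time to \<open>?I\<close> extends curves on the compact interval to the
    whole line, so that the iteration runs in the complete space of bounded continuous functions on
    the reals.\<close>
  define cl where "cl t = max (-\<epsilon>) (min \<epsilon> t)" for t :: real
  have cl: "cl t \<in> ?I" for t using e by (auto simp: cl_def)
  have cl_id: "cl t = t" if "t \<in> ?I" for t using that by (auto simp: cl_def)
  have cl_cont: "continuous_on UNIV cl" unfolding cl_def by (intro continuous_intros)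
  define S :: "(real \<Rightarrow>\<^sub>C 'a) set" where "S = {f. \<forall>t. apply_bcontfun f t \<in> cball y0 r}"
  define J where "J f t = integral {-\<epsilon>..t} (\<lambda>s. F (apply_bcontfun f s))" for f t
  \<comment> \<open>The Picard operator. Integrating from the left end and subtracting the value at
    0 treats positive and negative times alike.\<close>
  define G where "G f t = y0 + J f t - J f 0" for f t
  have Fc: "continuous_on ?I (\<lambda>s. F (apply_bcontfun f s))" if "f \<in> S" for f
  proof -
    have "continuous_on (cball y0 r) F"
      using F r has_derivative_continuous by (intro continuous_at_imp_continuous_on) blast
    then show ?thesis
      by (rule continuous_on_compose2[of _ F]) (use that in \<open>auto simp: S_def intro: continuous_on_apply_bcontfun\<close>)
  qed
  have G: "(G f has_vector_derivative F (apply_bcontfun f t)) (at t within ?I)" if "f \<in> S" "t \<in> ?I" for f t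
    using integral_has_vector_derivative[OF Fc[OF that(1)] that(2)]
    unfolding G_def J_def by (auto intro!: derivative_eq_intros)
  have G0: "G f 0 = y0" for f by (simp add: G_def)
  have Gr: "G f t \<in> cball y0 r" if "f \<in> S" "t \<in> ?I" for f t
  proof -
    have "norm (G f t - G f 0) \<le> B * \<epsilon>"
      by (rule norm_le_vector_derivative[OF G[OF that(1)] _ that(2) e]) (use B that(1) in \<open>auto simp: S_def\<close>)
    then show ?thesis using eB by (simp add: G0 dist_norm norm_minus_commute)
  qed
  define T where "T f = Bcontfun (\<lambda>t. G f (cl t))" for f
  have T: "apply_bcontfun (T f) t = G f (cl t)" if "f \<in> S" for f t
  proof -
    have "continuous_on ?I (G f)"
      using G[OF that] has_vector_derivative_continuous continuous_on_eq_continuous_within by blast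
    then have "continuous_on UNIV (\<lambda>t. G f (cl t))"
      by (rule continuous_on_compose2[OF _ cl_cont]) (use cl in auto)
    moreover have "bounded (range (\<lambda>t. G f (cl t)))"
      by (rule bounded_subset[OF bounded_cball[of y0 r]]) (use Gr[OF that cl] in auto)
    ultimately have "(\<lambda>t. G f (cl t)) \<in> bcontfun" by (simp add: bcontfun_def)
    then show ?thesis by (simp add: T_def Bcontfun_inverse)
  qed
  have "\<exists>!f\<in>S. T f = f"
  proof (rule Banach_fix[where c = "1/2"])
    have "S = (\<Inter>t. (\<lambda>f :: real \<Rightarrow>\<^sub>C 'a. apply_bcontfun f t) -` cball y0 r)" by (auto simp: S_def)
    moreover have "closed ((\<lambda>f :: real \<Rightarrow>\<^sub>C 'a. apply_bcontfun f t) -` cball y0 r)" for t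
    proof -
      have "continuous_on UNIV (\<lambda>f :: real \<Rightarrow>\<^sub>C 'a. apply_bcontfun f t)"
      proof (rule continuous_onI)
        fix f :: "real \<Rightarrow>\<^sub>C 'a" and \<delta> :: real assume "\<delta> > 0"
        then show "\<exists>d>0. \<forall>g\<in>UNIV. dist g f < d \<longrightarrow> dist (apply_bcontfun g t) (apply_bcontfun f t) \<le> \<delta>"
          using dist_bounded order_trans less_imp_le by blast
      qed
      then show ?thesis by (simp add: closed_vimage)
    qed
    ultimately show "complete S" by (metis complete_eq_closed closed_INT)
    have "const_bcontfun y0 \<in> S" using r by (simp add: S_def)
    then show "S \<noteq> {}" by blast
    show "T ` S \<subseteq> S" using T Gr cl by (auto simp: S_def)
    show "dist (T f) (T g) \<le> 1/2 * dist f g" if fg: "f \<in> S" "g \<in> S" for f g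
    proof (rule dist_bound)
      fix t
      have "((\<lambda>t. G f t - G g t) has_vector_derivative (F (apply_bcontfun f t) - F (apply_bcontfun g t))) (at t within ?I)"
        if "t \<in> ?I" for t using G fg that by (auto intro!: derivative_eq_intros)
      moreover have "norm (F (apply_bcontfun f t) - F (apply_bcontfun g t)) \<le> L * dist f g" for t
      proof -
        have "norm (F (apply_bcontfun f t) - F (apply_bcontfun g t)) \<le> L * norm (apply_bcontfun f t - apply_bcontfun g t)"
          using L(2) fg by (simp add: S_def)
        also have "\<dots> \<le> L * dist f g"
          using L(1) dist_bounded[of f t g] by (intro mult_left_mono) (auto simp: dist_norm)
        finally show ?thesis .
      qed
      ultimately have "norm ((G f (cl t) - G g (cl t)) - (G f 0 - G g 0)) \<le> L * dist f g * \<epsilon>"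
        by (rule norm_le_vector_derivative[OF _ _ cl e])
      also have "\<dots> = (L * \<epsilon>) * dist f g" by simp
      also have "\<dots> \<le> 1/2 * dist f g" using eL by (rule mult_right_mono) simp
      finally show "dist (apply_bcontfun (T f) t) (apply_bcontfun (T g) t) \<le> 1/2 * dist f g"
        by (simp add: T fg G0 dist_norm)
    qed
  qed auto
  then obtain f where f: "f \<in> S" "T f = f" by blast
  let ?y = "\<lambda>t. apply_bcontfun f t"
  have y: "?y t = G f t" if "t \<in> ?I" for t using T[OF f(1), of t] f(2) cl_id[OF that] by simp
  have "?y 0 = y0" using y[of 0] e G0 by simp
  moreover have "?y t \<in> U \<and> (?y has_vector_derivative F (?y t)) (at t)" if t: "\<bar>t\<bar> < \<epsilon>" for t
  proof
    show "?y t \<in> U" using f(1) r(2) by (auto simp: S_def)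
    have tI: "t \<in> ?I" and t': "t \<in> {-\<epsilon><..<\<epsilon>}" using t by auto
    have "(G f has_vector_derivative F (?y t)) (at t within {-\<epsilon><..<\<epsilon>})"
      by (rule has_vector_derivative_within_subset[OF G[OF f(1) tI]]) auto
    then have "(G f has_vector_derivative F (?y t)) (at t)"
      using at_within_open[OF t' open_greaterThanLessThan] by simp
    then show "(?y has_vector_derivative F (?y t)) (at t)"
      by (rule has_vector_derivative_transform_within_open[OF _ open_greaterThanLessThan t']) (use y in auto)
  qed
  ultimately show ?thesis using e by blast
qed

subsection \<open>Smooth maps within a subspace\<close>

text \<open>Within a subspace \<open>frechet_derivative\<close> is one of possibly many derivatives,
  all of which agree in directions of \<open>V\<close>: restrict to the line through
  \<open>x\<close> in direction \<open>v\<close>, where the derivative is unique.\<close>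

lemma D_in_eq:
  fixes f :: "'a::euclidean_space \<Rightarrow> 'b::euclidean_space"
  assumes f: "(f has_derivative f') (at x within V)" and V: "subspace V" "x \<in> V" "v \<in> V"
  shows "D_in V f x v = f' v"
proof -
  have line: "((\<lambda>t::real. f (x + t *\<^sub>R v)) has_derivative (\<lambda>h. g' (h *\<^sub>R v))) (at 0)"
    if "(f has_derivative g') (at x within V)" for g'
  proof -
    have "((\<lambda>t::real. x + t *\<^sub>R v) has_derivative (\<lambda>h. h *\<^sub>R v)) (at 0)"
      by (auto intro!: derivative_eq_intros)
    moreover have "(f has_derivative g') (at (x + 0 *\<^sub>R v) within (\<lambda>t. x + t *\<^sub>R v) ` UNIV)"
      by (rule has_derivative_subset[of _ _ _ V])
         (use that V in \<open>auto intro: subspace_add subspace_scale\<close>)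
    ultimately show ?thesis by (rule has_derivative_in_compose)
  qed
  have "(f has_derivative D_in V f x) (at x within V)"
    using f frechet_derivative_works differentiable_def by blast
  then have "(\<lambda>h::real. D_in V f x (h *\<^sub>R v)) = (\<lambda>h. f' (h *\<^sub>R v))"
    using has_derivative_unique line f by blast
  then show ?thesis by (metis scaleR_one)
qed

lemma C_on_cong_within:
  assumes "S \<subseteq> V" "\<And>x. x \<in> V \<Longrightarrow> f x = g x" "C_on k V S f"
  shows "C_on k V S g"
proof (cases k)
  case 0
  then show ?thesis using assms by (auto elim!: continuous_on_eq)
next
  case (Suc m)
  then obtain f' where f': "\<forall>x\<in>S. (f has_derivative f' x) (at x within V)" "\<forall>v\<in>V. C_on m V S (\<lambda>x. f' x v)"
    using assms(3) by auto
  have "\<forall>x\<in>S. (g has_derivative f' x) (at x within V)"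
    using f'(1) has_derivative_transform assms(1,2) by (metis subsetD)
  then show ?thesis using f'(2) Suc by auto
qed

lemma smooth_on_cong_within:
  "S \<subseteq> V \<Longrightarrow> (\<And>x. x \<in> V \<Longrightarrow> f x = g x) \<Longrightarrow> smooth_on V S f \<Longrightarrow> smooth_on V S g"
  unfolding smooth_on_def using C_on_cong_within by blast

lemma C_on_Suc: "S \<subseteq> V \<Longrightarrow> C_on (Suc k) V S f \<Longrightarrow> C_on k V S f"
proof (induction k arbitrary: f)
  case 0
  then obtain f' where "\<forall>x\<in>S. (f has_derivative f' x) (at x within V)" by auto
  then have "\<forall>x\<in>S. continuous (at x within V) f" using has_derivative_continuous by blast
  then have "\<forall>x\<in>S. continuous (at x within S) f" using continuous_within_subset 0 by blast
  then show ?case by (simp add: continuous_on_eq_continuous_within)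
next
  case (Suc k)
  then obtain f' where "\<forall>x\<in>S. (f has_derivative f' x) (at x within V)" "\<forall>v\<in>V. C_on (Suc k) V S (\<lambda>x. f' x v)"
    by auto
  then show ?case using Suc by (auto intro!: exI[of _ f'])
qed

lemma C_on_const: "C_on k V S (\<lambda>x. a)"
  by (induction k arbitrary: a) (auto intro!: exI[of _ "\<lambda>x v. 0"] derivative_eq_intros)

lemma C_on_bounded_linear: "bounded_linear f \<Longrightarrow> C_on k V S f"
proof (cases k)
  case (Suc m)
  assume "bounded_linear f"
  then show ?thesis unfolding Suc
    using bounded_linear_imp_has_derivative C_on_const[of m V S] by (auto intro!: exI[of _ "\<lambda>x. f"])
qed (simp add: linear_continuous_on)

lemma C_on_add: "C_on k V S f \<Longrightarrow> C_on k V S g \<Longrightarrow> C_on k V S (\<lambda>x. f x + g x)"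
proof (induction k arbitrary: f g)
  case 0 then show ?case by (auto intro: continuous_intros)
next
  case (Suc k)
  obtain f' where f': "\<forall>x\<in>S. (f has_derivative f' x) (at x within V)" "\<forall>v\<in>V. C_on k V S (\<lambda>x. f' x v)"
    using Suc.prems by auto
  obtain g' where g': "\<forall>x\<in>S. (g has_derivative g' x) (at x within V)" "\<forall>v\<in>V. C_on k V S (\<lambda>x. g' x v)"
    using Suc.prems by auto
  show ?case using Suc.IH f' g'
    by (auto intro!: exI[of _ "\<lambda>x v. f' x v + g' x v"] has_derivative_add)
qed

lemma C_on_bilinear:
  assumes B: "bounded_bilinear B" and S: "S \<subseteq> V"
  shows "C_on k V S f \<Longrightarrow> C_on k V S g \<Longrightarrow> C_on k V S (\<lambda>x. B (f x) (g x))"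
proof (induction k arbitrary: f g)
  case 0 then show ?case using bounded_bilinear.continuous_on[OF B] by simp
next
  case (Suc k)
  obtain f' where f': "\<forall>x\<in>S. (f has_derivative f' x) (at x within V)" "\<forall>v\<in>V. C_on k V S (\<lambda>x. f' x v)"
    using Suc.prems by auto
  obtain g' where g': "\<forall>x\<in>S. (g has_derivative g' x) (at x within V)" "\<forall>v\<in>V. C_on k V S (\<lambda>x. g' x v)"
    using Suc.prems by auto
  have "C_on k V S f" "C_on k V S g" using C_on_Suc S Suc.prems by blast+
  then have "\<forall>v\<in>V. C_on k V S (\<lambda>x. B (f x) (g' x v) + B (f' x v) (g x))"
    using Suc.IH f' g' by (intro ballI C_on_add) auto
  moreover have "\<forall>x\<in>S. ((\<lambda>x. B (f x) (g x)) has_derivative (\<lambda>v. B (f x) (g' x v) + B (f' x v) (g x))) (at x within V)"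
    using bounded_bilinear.FDERIV[OF B] f' g' by blast
  ultimately show ?case by auto
qed

lemma smooth_on_const: "smooth_on V S (\<lambda>x. a)"
  by (simp add: smooth_on_def C_on_const)

lemma smooth_on_bounded_linear: "bounded_linear f \<Longrightarrow> smooth_on V S f"
  by (simp add: smooth_on_def C_on_bounded_linear)

lemma smooth_on_add: "smooth_on V S f \<Longrightarrow> smooth_on V S g \<Longrightarrow> smooth_on V S (\<lambda>x. f x + g x)"
  by (simp add: smooth_on_def C_on_add)

lemma smooth_on_bilinear:
  "bounded_bilinear B \<Longrightarrow> S \<subseteq> V \<Longrightarrow> smooth_on V S f \<Longrightarrow> smooth_on V S g \<Longrightarrow> smooth_on V S (\<lambda>x. B (f x) (g x))"
  by (simp add: smooth_on_def C_on_bilinear)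

lemma smooth_on_linear_compose:
  fixes T :: "'b::euclidean_space \<Rightarrow> 'c::euclidean_space"
  assumes "bounded_linear T" "S \<subseteq> V" "smooth_on V S f"
  shows "smooth_on V S (\<lambda>x. T (f x))"
proof -
  interpret T: bounded_linear T by fact
  have "bilinear (\<lambda>(r::real) x. r *\<^sub>R T x)"
    unfolding bilinear_def by (auto intro!: linearI simp: T.add T.scaleR scaleR_add_left scaleR_add_right)
  then have "bounded_bilinear (\<lambda>(r::real) x. r *\<^sub>R T x)" by (simp add: bilinear_conv_bounded_bilinear)
  from smooth_on_bilinear[OF this assms(2) smooth_on_const[of V S 1] assms(3)] show ?thesis by simp
qed

text \<open>The inner product of the curve with any vector of the orthogonal complement vanishes
  near \<open>t\<close>, hence so does that of its derivative.\<close>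

lemma vector_derivative_in_subspace:
  fixes f :: "real \<Rightarrow> 'v::euclidean_space"
  assumes V: "subspace V" and I: "open I" "t \<in> I" "\<And>s. s \<in> I \<Longrightarrow> f s \<in> V"
    and f: "(f has_vector_derivative f') (at t)"
  shows "f' \<in> V"
proof -
  have "f' \<bullet> w = 0" if w: "w \<in> V\<^sup>\<bottom>" for w
  proof -
    have "((\<lambda>s. f s \<bullet> w) has_vector_derivative f' \<bullet> w) (at t)"
      using bounded_linear.has_vector_derivative[OF bounded_linear_inner_left f] .
    then have "((\<lambda>s. 0::real) has_vector_derivative f' \<bullet> w) (at t)"
      by (rule has_vector_derivative_transform_within_open[OF _ I(1,2)])
         (use w I(3) in \<open>auto simp: orthogonal_comp_def orthogonal_def inner_commute\<close>)
    then show ?thesis using vector_derivative_unique_at has_vector_derivative_const by blast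
  qed
  then have "f' \<in> V\<^sup>\<bottom>\<^sup>\<bottom>" by (auto simp: orthogonal_comp_def orthogonal_def inner_commute)
  then show ?thesis using orthogonal_comp_self[OF V] by simp
qed

subsection \<open>Linear subspaces as manifolds\<close>

definition flat_manifold :: "'v::euclidean_space set \<Rightarrow> ('v, 'v) manifold" where
  "flat_manifold V = \<lparr>mtop = top_of_set V, model = V, atlas = {(V, \<lambda>x. x)}\<rparr>"

lemma flat_manifold_simps [simp]:
  "mtop (flat_manifold V) = top_of_set V" "model (flat_manifold V) = V"
  "atlas (flat_manifold V) = {(V, \<lambda>x. x)}"
  by (simp_all add: flat_manifold_def)

lemma real_line_flat: "real_line = flat_manifold UNIV"
  by (simp add: real_line_def flat_manifold_def)

lemma prod_flat: "prod_manifold (flat_manifold V) (flat_manifold W) = flat_manifold (V \<times> W)"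
proof -
  have "map_prod (\<lambda>x. x) (\<lambda>x. x) = (\<lambda>x :: 'a \<times> 'b. x)" by (simp add: fun_eq_iff)
  moreover have "prod_topology (top_of_set V) (top_of_set W) = top_of_set (V \<times> W)"
    by (simp add: subtopology_Times euclidean_product_topology)
  ultimately show ?thesis by (simp add: prod_manifold_def flat_manifold_def)
qed

lemma chart_inv_flat: "p \<in> V \<Longrightarrow> chart_inv (V, \<lambda>x. x) p = p"
  by (metis f_inv_into_f fst_conv image_ident snd_conv)

lemma in_charts_flat: "p \<in> V \<Longrightarrow> in_charts (V, \<lambda>x. x) (W, \<lambda>x. x) f p = f p"
  using chart_inv_flat by (fastforce simp: in_charts_def)

lemma smooth_map_flat:
  assumes "f ` V \<subseteq> W" "smooth_on V V f"
  shows "smooth_map (flat_manifold V) (flat_manifold W) f"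
proof -
  have "continuous_on V f" using assms(2) by (metis C_on.simps(1) smooth_on_def)
  moreover have "{p \<in> V. f p \<in> W} = V" using assms(1) by auto
  moreover have "smooth_on V V (in_charts (V, \<lambda>x. x) (W, \<lambda>x. x) f)"
    by (rule smooth_on_cong_within[OF _ _ assms(2)]) (simp_all add: in_charts_flat)
  ultimately show ?thesis using assms(1) by (auto simp: smooth_map_def)
qed

lemma D_in_in_charts_flat:
  assumes "(f has_derivative f') (at x within V)" "subspace V" "x \<in> V" "v \<in> V"
  shows "D_in V (in_charts (V, \<lambda>x. x) (V, \<lambda>x. x) f) x v = f' v"
proof (rule D_in_eq[OF _ assms(2-4)])
  show "(in_charts (V, \<lambda>x. x) (V, \<lambda>x. x) f has_derivative f') (at x within V)"
    by (rule has_derivative_transform[OF assms(3) _ assms(1)]) (simp add: in_charts_flat)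
qed

lemma smooth_manifold_flat:
  assumes "subspace V"
  shows "smooth_manifold (flat_manifold V)"
proof -
  have "smooth_on V V (in_charts (V, \<lambda>x. x) (V, \<lambda>x. x) (\<lambda>p. p))"
    by (rule smooth_on_cong_within[OF _ _ smooth_on_bounded_linear[OF bounded_linear_ident]]) (simp_all add: in_charts_flat)
  moreover have "Hausdorff_space (top_of_set V)"
    by (simp add: Hausdorff_space_subtopology)
  moreover have "second_countable (top_of_set V)"
  proof -
    obtain B :: "'a set set" where B: "countable B" "topological_basis B" using ex_countable_basis by blast
    then have "second_countable (euclidean :: 'a topology)"
      unfolding second_countable_def open_openin[symmetric]
      by (metis open_openin topological_basisE topological_basis_open)
    then show ?thesis by (rule second_countable_subtopology)
  qed
  moreover have "homeomorphic_map (top_of_set V) (top_of_set V) (\<lambda>x. x)"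
    using homeomorphic_map_id[of "top_of_set V" "top_of_set V", unfolded id_def] by simp
  ultimately show ?thesis using assms
    by (auto simp: smooth_manifold_def subtopology_subtopology)
qed

lemma simply_connected_flat:
  assumes "subspace V"
  shows "simply_connected_space (mtop (flat_manifold V))"
proof -
  have 1: "path_connected_space (top_of_set V)"
    unfolding path_connected_space_def
  proof (intro ballI)
    fix x y assume "x \<in> topspace (top_of_set V)" "y \<in> topspace (top_of_set V)"
    then have xy: "x \<in> V" "y \<in> V" by auto
    show "\<exists>g. pathin (top_of_set V) g \<and> g 0 = x \<and> g 1 = y"
      by (rule exI[of _ "\<lambda>t. (1 - t) *\<^sub>R x + t *\<^sub>R y"])
         (use xy assms in \<open>auto simp: pathin_def intro!: continuous_intros subspace_add subspace_scale\<close>)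
  qed
  have 2: "\<exists>a\<in>V. homotopic_with (\<lambda>q. q 0 = q 1) (top_of_set {0..1::real}) (top_of_set V) p (\<lambda>_. a)"
    if p: "continuous_map (top_of_set {0..1::real}) (top_of_set V) p" "p 0 = p 1" for p
  proof -
    have pc: "continuous_on {0..1} p" "p ` {0..1} \<subseteq> V" using p by auto
    have "homotopic_with (\<lambda>q. q 0 = q 1) (top_of_set {0..1::real}) (top_of_set V) p (\<lambda>_. 0)"
      unfolding homotopic_with_def
    proof (intro exI conjI ballI allI)
      let ?h = "\<lambda>(t::real, s::real). (1 - t) *\<^sub>R p s"
      have "continuous_on ({0..1} \<times> {0..1}) ?h" unfolding case_prod_beta
        by (intro continuous_intros continuous_on_compose2[OF pc(1)]) auto
      moreover have "?h ` ({0..1} \<times> {0..1}) \<subseteq> V" using pc(2) assms by (auto intro!: subspace_scale)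
      moreover have "prod_topology (top_of_set {0..1::real}) (top_of_set {0..1::real}) = top_of_set ({0..1} \<times> {0..1})"
        by (simp add: subtopology_Times euclidean_product_topology)
      ultimately show "continuous_map (prod_topology (top_of_set {0..1}) (top_of_set {0..1})) (top_of_set V) ?h"
        by (simp add: image_subset_iff_funcset)
    qed (use p in auto)
    then show ?thesis using assms subspace_0 by blast
  qed
  show ?thesis using 1 2 by (simp add: simply_connected_space_def)
qed

subsection \<open>Exponentials of linear operators\<close>

text \<open>A copy of the operators with composition as multiplication: a Banach algebra, hence \<open>exp\<close> is available.\<close>

typedef (overloaded) 'a endo = "UNIV :: ('a::euclidean_space \<Rightarrow>\<^sub>L 'a) set"
  morphisms endo_blinfun Endo ..

setup_lifting type_definition_endo

instantiation endo :: (euclidean_space) real_normed_algebra_1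
begin

lift_definition zero_endo :: "'a endo" is 0 .
lift_definition one_endo :: "'a endo" is id_blinfun .
lift_definition plus_endo :: "'a endo \<Rightarrow> 'a endo \<Rightarrow> 'a endo" is "(+)" .
lift_definition minus_endo :: "'a endo \<Rightarrow> 'a endo \<Rightarrow> 'a endo" is "(-)" .
lift_definition uminus_endo :: "'a endo \<Rightarrow> 'a endo" is uminus .
lift_definition times_endo :: "'a endo \<Rightarrow> 'a endo \<Rightarrow> 'a endo" is blinfun_compose .
lift_definition scaleR_endo :: "real \<Rightarrow> 'a endo \<Rightarrow> 'a endo" is scaleR .
lift_definition norm_endo :: "'a endo \<Rightarrow> real" is norm .
definition sgn_endo :: "'a endo \<Rightarrow> 'a endo" where "sgn_endo x = inverse (norm x) *\<^sub>R x"
definition dist_endo :: "'a endo \<Rightarrow> 'a endo \<Rightarrow> real" where "dist_endo x y = norm (x - y)"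
definition uniformity_endo :: "('a endo \<times> 'a endo) filter" where
  "uniformity_endo = (INF e\<in>{0 <..}. principal {(x, y). dist x y < e})"
definition open_endo :: "'a endo set \<Rightarrow> bool" where
  "open_endo S \<longleftrightarrow> (\<forall>x\<in>S. \<forall>\<^sub>F (x', y) in uniformity. x' = x \<longrightarrow> y \<in> S)"

instance
proof
  fix x y z :: "'a endo" and a b :: real
  show "x + y + z = x + (y + z)" "x + y = y + x" "0 + x = x" "- x + x = 0" "x - y = x + - y"
    by (transfer; simp)+
  show "scaleR a (x + y) = scaleR a x + scaleR a y" "scaleR (a + b) x = scaleR a x + scaleR b x"
    "scaleR a (scaleR b x) = scaleR (a * b) x" "scaleR 1 x = x"
    by (transfer; simp add: algebra_simps)+
  show "(norm x = 0) = (x = 0)" "norm (x + y) \<le> norm x + norm y" "norm (scaleR a x) = \<bar>a\<bar> * norm x"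
    by (transfer; simp add: norm_triangle_ineq)+
  show "x * y * z = x * (y * z)" "1 * x = x" "x * 1 = x"
    by (transfer; rule blinfun_eqI; simp)+
  show "(x + y) * z = x * z + y * z" "x * (y + z) = x * y + x * z"
    "scaleR a x * y = scaleR a (x * y)" "x * scaleR a y = scaleR a (x * y)"
    by (transfer; rule blinfun_eqI; simp add: blinfun.bilinear_simps)+
  show "norm (x * y) \<le> norm x * norm y" by transfer (rule norm_blinfun_compose)
  show "norm (1 :: 'a endo) = 1" by transfer simp
  show "(0 :: 'a endo) \<noteq> 1"
  proof
    assume "(0 :: 'a endo) = 1"
    then have "norm (id_blinfun :: 'a \<Rightarrow>\<^sub>L 'a) = 0" by transfer simp
    then show False by simp
  qed
qed (rule dist_endo_def open_endo_def sgn_endo_def uniformity_endo_def)+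

end

instance endo :: (euclidean_space) banach
proof
  fix X :: "nat \<Rightarrow> 'a endo"
  have d: "dist (endo_blinfun x) (endo_blinfun y) = dist x y" for x y :: "'a endo"
    unfolding dist_norm by transfer simp
  assume "Cauchy X"
  then have "Cauchy (\<lambda>n. endo_blinfun (X n))" by (simp add: Cauchy_def d)
  then have "convergent (\<lambda>n. endo_blinfun (X n))" by (rule Cauchy_convergent)
  then obtain L where "(\<lambda>n. endo_blinfun (X n)) \<longlonglongrightarrow> L" unfolding convergent_def ..
  then have "(\<lambda>n. dist (endo_blinfun (X n)) L) \<longlonglongrightarrow> 0"
    unfolding tendsto_dist_iff[of _ L] .
  moreover have "dist (endo_blinfun (X n)) L = dist (X n) (Endo L)" for n
    using d[of "X n" "Endo L"] Endo_inverse[of L] by simp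
  ultimately have "(\<lambda>n. dist (X n) (Endo L)) \<longlonglongrightarrow> 0" by simp
  then have "X \<longlonglongrightarrow> Endo L" unfolding tendsto_dist_iff[of X] .
  then show "convergent X" by (rule convergentI)
qed

definition endo_app :: "'a::euclidean_space endo \<Rightarrow> 'a \<Rightarrow> 'a" where
  "endo_app A x = blinfun_apply (endo_blinfun A) x"

lemma endo_app_bilinear: "bounded_bilinear endo_app"
proof
  fix a a' :: "'a endo" and b b' :: 'a and r :: real
  show "endo_app (a + a') b = endo_app a b + endo_app a' b" "endo_app a (b + b') = endo_app a b + endo_app a b'"
    "endo_app (r *\<^sub>R a) b = r *\<^sub>R endo_app a b" "endo_app a (r *\<^sub>R b) = r *\<^sub>R endo_app a b"
    unfolding endo_app_def by (transfer; simp add: blinfun.bilinear_simps)+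
  show "\<exists>K. \<forall>(a::'a endo) b. norm (endo_app a b) \<le> norm a * norm b * K"
    unfolding endo_app_def by (intro exI[of _ 1] allI, transfer) (simp add: norm_blinfun)
qed

lemma endo_app_simps: "endo_app 1 x = x" "endo_app (A * B) x = endo_app A (endo_app B x)"
  unfolding endo_app_def by (transfer; simp)+

definition flow :: "('a::euclidean_space \<Rightarrow> 'a) \<Rightarrow> real \<Rightarrow> 'a \<Rightarrow> 'a" where
  "flow L t = endo_app (exp (t *\<^sub>R Endo (Blinfun L)))"

context
  fixes L :: "'a::euclidean_space \<Rightarrow> 'a"
  assumes L: "bounded_linear L"
begin

lemma flow_linear: "bounded_linear (flow L t)"
  unfolding flow_def using bounded_bilinear.bounded_linear_right[OF endo_app_bilinear] .

lemma flow_0: "flow L 0 x = x"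
  by (simp add: flow_def endo_app_simps)

lemma flow_add: "flow L (s + t) x = flow L s (flow L t x)"
  unfolding flow_def endo_app_simps(2)[symmetric] scaleR_add_left
  by (subst exp_add_commuting) auto

lemma flow_derivative: "((\<lambda>t. flow L t x) has_vector_derivative L (flow L t x)) (at t)"
proof -
  have L1: "endo_app (Endo (Blinfun L)) y = L y" for y
    using L by (simp add: endo_app_def Endo_inverse bounded_linear_Blinfun_apply)
  show ?thesis unfolding flow_def
    using bounded_linear.has_vector_derivative[OF bounded_bilinear.bounded_linear_left[OF endo_app_bilinear]
      exp_scaleR_has_vector_derivative_left[of "Endo (Blinfun L)" t], of x]
    by (simp add: endo_app_simps L1)
qed

lemma flow_commute: "L (flow L t x) = flow L t (L x)"
proof -
  have L1: "endo_app (Endo (Blinfun L)) y = L y" for y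
    using L by (simp add: endo_app_def Endo_inverse bounded_linear_Blinfun_apply)
  define A where "A = Endo (Blinfun L)"
  have "L (flow L t x) = endo_app (A * exp (t *\<^sub>R A)) x"
    using L1[of "flow L t x"] by (simp add: flow_def A_def endo_app_simps)
  also have "\<dots> = endo_app (exp (t *\<^sub>R A)) (endo_app A x)"
    by (simp only: exp_times_scaleR_commute[symmetric] endo_app_simps)
  also have "\<dots> = flow L t (L x)"
    using L1[of x] by (simp add: flow_def A_def)
  finally show ?thesis .
qed

lemma flow_has_derivative:
  fixes T :: "'b::euclidean_space \<Rightarrow> 'a"
  assumes T: "bounded_linear T"
  shows "((\<lambda>z. flow L (fst z) (T (snd z) + w)) has_derivative
    (\<lambda>h. flow L (fst z) (fst h *\<^sub>R L (T (snd z) + w) + T (snd h)))) (at z within V)"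
proof -
  define E where "E t = exp (t *\<^sub>R Endo (Blinfun L))" for t
  have E: "endo_app (E t) x = flow L t x" for t x by (simp add: E_def flow_def)
  have dE: "(E has_derivative (\<lambda>h. h *\<^sub>R (Endo (Blinfun L) * E t))) (at t)" for t
    using exp_scaleR_has_vector_derivative_left[of "Endo (Blinfun L)" t]
    by (simp add: E_def[abs_def] has_vector_derivative_def)
  have 1: "((\<lambda>z :: real \<times> 'b. E (fst z)) has_derivative (\<lambda>h. fst h *\<^sub>R (Endo (Blinfun L) * E (fst z)))) (at z within V)"
    by (rule has_derivative_compose[OF _ dE, where f = fst and f' = fst]) (rule bounded_linear_imp_has_derivative[OF bounded_linear_fst])
  have 2: "((\<lambda>z :: real \<times> 'b. T (snd z) + w) has_derivative (\<lambda>h. T (snd h))) (at z within V)"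
    by (auto intro!: derivative_eq_intros bounded_linear.has_derivative[OF T] bounded_linear_imp_has_derivative[OF bounded_linear_snd])
  have L1: "endo_app (Endo (Blinfun L)) y = L y" for y
    using L by (simp add: endo_app_def Endo_inverse bounded_linear_Blinfun_apply)
  interpret app: bounded_bilinear endo_app by (rule endo_app_bilinear)
  interpret F: bounded_linear "flow L (fst z)" by (rule flow_linear)
  have "endo_app (E (fst z)) (T (snd h)) + endo_app (fst h *\<^sub>R (Endo (Blinfun L) * E (fst z))) (T (snd z) + w)
    = flow L (fst z) (fst h *\<^sub>R L (T (snd z) + w) + T (snd h))" for h
    by (simp only: app.scaleR_left endo_app_simps E L1 flow_commute F.add[symmetric] F.scaleR[symmetric]) (simp add: add.commute)
  then show ?thesis using app.FDERIV[OF 1 2] by (simp add: E)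
qed

text \<open>A directional derivative of \<open>flow L t (T p + w)\<close> has the same shape with
  another linear map and another constant. Induction on the order, over all \<open>T\<close> and
  \<open>w\<close>, therefore closes.\<close>

lemma flow_smooth:
  fixes T :: "'b::euclidean_space \<Rightarrow> 'a"
  assumes T: "bounded_linear T" and S: "S \<subseteq> V"
  shows "smooth_on V S (\<lambda>(t, p). flow L t (T p + w))"
proof -
  have "C_on k V S (\<lambda>z. flow L (fst z) (T (snd z) + w))" if "bounded_linear T" for k and T :: "'b \<Rightarrow> 'a" and w
    using that
  proof (induction k arbitrary: T w)
    case 0
    then show ?case
      using flow_has_derivative[OF 0, of w] has_derivative_continuous S
      by (simp add: continuous_on_eq_continuous_within) blast
  next
    case (Suc k)
    interpret L: bounded_linear L by (rule L)
    have "C_on k V S (\<lambda>z. flow L (fst z) (fst v *\<^sub>R L (T (snd z) + w) + T (snd v)))" for v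
    proof -
      have "bounded_linear (\<lambda>p. fst v *\<^sub>R L (T p))"
        by (intro bounded_linear_compose[OF bounded_linear_scaleR_right] bounded_linear_compose[OF L Suc.prems])
      from Suc.IH[OF this, of "fst v *\<^sub>R L w + T (snd v)"] show ?thesis
        by (simp add: L.add scaleR_add_right add.assoc)
    qed
    then show ?case
      unfolding C_on.simps
      using flow_has_derivative[OF Suc.prems]
      by (intro exI[of _ "\<lambda>z h. flow L (fst z) (fst h *\<^sub>R L (T (snd z) + w) + T (snd h))"]) auto
  qed
  then show ?thesis using T unfolding smooth_on_def case_prod_beta by blast
qed

end

subsection \<open>Two-step nilpotent groups with a left-invariant metric\<close>

lemma zero_derivative_constant:
  fixes f :: "real \<Rightarrow> 'a::real_normed_vector"
  assumes "is_interval I" "\<And>t. t \<in> I \<Longrightarrow> (f has_vector_derivative 0) (at t)" "s \<in> I" "t \<in> I"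
  shows "f s = f t"
proof -
  have "\<exists>c. \<forall>x\<in>I. f x = c"
  proof (rule has_derivative_zero_constant)
    show "convex I" using assms(1) is_interval_convex by blast
    show "(f has_derivative (\<lambda>h. 0)) (at x within I)" if "x \<in> I" for x
      using assms(2)[OF that] has_derivative_at_withinI by (auto simp: has_vector_derivative_def)
  qed
  then show ?thesis using assms(3,4) by auto
qed

lemma has_vector_derivative_shift:
  fixes f :: "real \<Rightarrow> 'a::real_normed_vector"
  assumes "(f has_vector_derivative f') (at (t - t0))"
  shows "((\<lambda>t. f (t - t0)) has_vector_derivative f') (at t)"
proof -
  have "((\<lambda>t. t - t0) has_vector_derivative 1) (at t)" by (auto intro!: derivative_eq_intros)
  from vector_diff_chain_at[OF this assms] show ?thesis by (simp add: o_def)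
qed

lemma vector_derivative_diff_in_subspace:
  fixes f :: "real \<Rightarrow> 'v::euclidean_space"
  assumes V: "subspace V" and f: "\<And>t. (f has_vector_derivative f' t) (at t)" "\<And>t. f' t \<in> V"
  shows "f t - f 0 \<in> V"
proof -
  have "(f t - f 0) \<bullet> w = 0" if w: "w \<in> V\<^sup>\<bottom>" for w
  proof -
    have "((\<lambda>s. f s \<bullet> w) has_vector_derivative 0) (at s)" for s
      using bounded_linear.has_vector_derivative[OF bounded_linear_inner_left f(1), of w s] w f(2)[of s]
      by (auto simp: orthogonal_comp_def orthogonal_def inner_commute)
    then have "f t \<bullet> w = f 0 \<bullet> w" by (intro zero_derivative_constant[of UNIV]) auto
    then show ?thesis by (simp add: inner_diff_left)
  qed
  then have "f t - f 0 \<in> V\<^sup>\<bottom>\<^sup>\<bottom>" by (auto simp: orthogonal_comp_def orthogonal_def inner_commute)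
  then show ?thesis using orthogonal_comp_self[OF V] by simp
qed

context riem_go_algebra
begin

interpretation br0: bounded_bilinear br0 by (rule br0_bilinear)
interpretation ip: bounded_bilinear ip by (rule ip_bilinear)

definition gmul :: "'v \<Rightarrow> 'v \<Rightarrow> 'v" where
  "gmul x y = x + y + (1/2) *\<^sub>R br0 x y"

text \<open>The inverse of the differential at 0 of left translation by \<open>u\<close>: that
  differential is \<open>v + [u, v] / 2\<close>, and double brackets vanish. It carries a tangent
  vector at \<open>u\<close> back to the identity.\<close>

definition trivialize :: "'v \<Rightarrow> 'v \<Rightarrow> 'v" where
  "trivialize u v = v - (1/2) *\<^sub>R br0 u v"

definition nil_group :: "'v monoid" where
  "nil_group = \<lparr>carrier = m0, monoid.mult = gmul, one = 0\<rparr>"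

definition nil_metric :: "('v, 'v) metric_tensor" where
  "nil_metric c u v w = ip (trivialize u v) (trivialize u w)"

abbreviation M0 :: "('v, 'v) manifold" where
  "M0 \<equiv> flat_manifold m0"

abbreviation c0 :: "('v, 'v) chart" where
  "c0 \<equiv> (m0, \<lambda>x. x)"

lemma gmul_in: "x \<in> m0 \<Longrightarrow> y \<in> m0 \<Longrightarrow> gmul x y \<in> m0"
  using sub br0_in by (simp add: gmul_def subspace_add subspace_scale)

lemma trivialize_in: "v \<in> m0 \<Longrightarrow> trivialize u v \<in> m0"
  using sub br0_in by (simp add: trivialize_def subspace_diff subspace_scale)

lemma br0_half: "br0 ((1/2) *\<^sub>R br0 x y) z = 0" "br0 z ((1/2) *\<^sub>R br0 x y) = 0"
  by (simp_all add: br0.scaleR_left br0.scaleR_right br0_br0)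

lemma group_nil: "group nil_group"
proof (rule groupI)
  fix x y z assume "x \<in> carrier nil_group" "y \<in> carrier nil_group" "z \<in> carrier nil_group"
  show "x \<otimes>\<^bsub>nil_group\<^esub> y \<otimes>\<^bsub>nil_group\<^esub> z = x \<otimes>\<^bsub>nil_group\<^esub> (y \<otimes>\<^bsub>nil_group\<^esub> z)"
    by (simp add: nil_group_def gmul_def br0.add_left br0.add_right br0_half scaleR_add_right)
next
  fix x assume x: "x \<in> carrier nil_group"
  show "\<exists>y\<in>carrier nil_group. y \<otimes>\<^bsub>nil_group\<^esub> x = \<one>\<^bsub>nil_group\<^esub>"
    by (rule bexI[of _ "- x"])
       (use x sub in \<open>auto simp: nil_group_def gmul_def br0.minus_left br0_self subspace_neg\<close>)
qed (use sub gmul_in in \<open>auto simp: nil_group_def gmul_def br0.zero_left subspace_0\<close>)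

lemma inv_nil: "x \<in> m0 \<Longrightarrow> inv\<^bsub>nil_group\<^esub> x = - x"
  by (rule group.inv_equality[OF group_nil])
     (use sub in \<open>auto simp: nil_group_def gmul_def br0.minus_left br0_self subspace_neg\<close>)

lemma lie_group_nil: "lie_group nil_group M0"
proof -
  have "smooth_on (m0 \<times> m0) (m0 \<times> m0) (\<lambda>z. fst z + snd z + (1/2) *\<^sub>R br0 (fst z) (snd z))"
    by (intro smooth_on_add smooth_on_linear_compose[OF bounded_linear_scaleR_right subset_refl]
        smooth_on_bilinear[OF br0_bilinear subset_refl] smooth_on_bounded_linear
        bounded_linear_fst bounded_linear_snd)
  then have "smooth_on (m0 \<times> m0) (m0 \<times> m0) (\<lambda>z. gmul (fst z) (snd z))" by (simp add: gmul_def)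
  then have "smooth_map (prod_manifold M0 M0) M0 (\<lambda>(x, y). x \<otimes>\<^bsub>nil_group\<^esub> y)"
    unfolding prod_flat using gmul_in
    by (intro smooth_map_flat) (auto simp: nil_group_def split_def)
  moreover have "smooth_map M0 M0 (\<lambda>x. inv\<^bsub>nil_group\<^esub> x)"
  proof (rule smooth_map_flat)
    show "smooth_on m0 m0 (\<lambda>x. inv\<^bsub>nil_group\<^esub> x)"
      by (rule smooth_on_cong_within[OF subset_refl _ smooth_on_bounded_linear[OF bounded_linear_minus[OF bounded_linear_ident]]])
         (simp add: inv_nil)
    show "(\<lambda>x. inv\<^bsub>nil_group\<^esub> x) ` m0 \<subseteq> m0" using sub by (auto simp: inv_nil subspace_neg)
  qed
  ultimately show ?thesis
    using group_nil smooth_manifold_flat[OF sub] by (simp add: lie_group_def nil_group_def)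
qed

lemma bounded_linear_right_translation: "bounded_linear (\<lambda>v. v + (1/2) *\<^sub>R br0 u v)"
  by (intro bounded_linear_add bounded_linear_ident
      bounded_linear_compose[OF bounded_linear_scaleR_right br0.bounded_linear_right])

lemma lie_bracket_nil:
  assumes "x \<in> m0" "y \<in> m0"
  shows "lie_bracket nil_group M0 c0 x y = br0 x y"
proof -
  have 0: "0 \<in> m0" using sub subspace_0 by blast
  have field: "left_invariant_field nil_group M0 c0 a u = a + (1/2) *\<^sub>R br0 u a" if "u \<in> m0" "a \<in> m0" for a u
  proof -
    have "((\<lambda>y. gmul u y) has_derivative (\<lambda>a. a + (1/2) *\<^sub>R br0 u a)) (at 0 within m0)"
      using has_derivative_add[OF has_derivative_const[of u] bounded_linear_imp_has_derivative[OF bounded_linear_right_translation[of u]]]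
      by (simp add: gmul_def add.assoc)
    from D_in_in_charts_flat[OF this sub 0 that(2)] show ?thesis
      using that by (simp add: left_invariant_field_def chart_inv_flat nil_group_def)
  qed
  have "D_in m0 (left_invariant_field nil_group M0 c0 b) 0 a = (1/2) *\<^sub>R br0 a b" if "a \<in> m0" "b \<in> m0" for a b
  proof (rule D_in_eq[OF _ sub 0 that(1)])
    have "((\<lambda>u. b + (1/2) *\<^sub>R br0 u b) has_derivative (\<lambda>a. (1/2) *\<^sub>R br0 a b)) (at 0 within m0)"
      using has_derivative_add[OF has_derivative_const[of b] bounded_linear_imp_has_derivative[OF
          bounded_linear_compose[OF bounded_linear_scaleR_right br0.bounded_linear_left]]] by simp
    then show "(left_invariant_field nil_group M0 c0 b has_derivative (\<lambda>a. (1/2) *\<^sub>R br0 a b)) (at 0 within m0)"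
      by (rule has_derivative_transform[OF 0, rotated]) (simp add: field that)
  qed
  then have "lie_bracket nil_group M0 c0 x y = (1/2) *\<^sub>R br0 x y - (1/2) *\<^sub>R br0 y x"
    using assms by (simp add: lie_bracket_def nil_group_def)
  then show ?thesis using br0_swap[of y x] by (simp add: scaleR_left_distrib[symmetric])
qed


section \<open>Affine isometries of the two-step nilpotent group\<close>

lemma gmul_cancel: "gmul (- p) (gmul p y) = y" "gmul p (gmul (- p) y) = y"
  by (simp_all add: gmul_def br0.minus_left br0.minus_right br0.add_right br0.diff_right br0_half br0_self)

text \<open>Left translations and the flows used below are both affine maps in the linear
  coordinates of \<open>m0\<close>, and such maps compose. Hence membership in
  \<open>isometry_group\<close>, with its demands on extensionality and smooth inverses, is settled
  only once. The map \<open>h\<close> is affine on the whole type and isometric on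
  \<open>m0\<close>.\<close>

definition affine_isometry :: "('v \<Rightarrow> 'v) \<Rightarrow> ('v \<Rightarrow> 'v) \<Rightarrow> bool" where
  "affine_isometry h L \<longleftrightarrow> bounded_linear L \<and> (\<forall>x y. h (x + y) = h x + L y) \<and> h ` m0 \<subseteq> m0 \<and>
     (\<forall>y\<in>m0. \<forall>v\<in>m0. \<forall>w\<in>m0.
        ip (trivialize (h y) (L v)) (trivialize (h y) (L w)) = ip (trivialize y v) (trivialize y w))"

lemma affine_isometryD:
  assumes "affine_isometry h L"
  shows "bounded_linear L" and "h (x + y) = h x + L y" and "y \<in> m0 \<Longrightarrow> h y \<in> m0"
    and "y \<in> m0 \<Longrightarrow> v \<in> m0 \<Longrightarrow> w \<in> m0 \<Longrightarrow>
      ip (trivialize (h y) (L v)) (trivialize (h y) (L w)) = ip (trivialize y v) (trivialize y w)"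
proof -
  note a = assms[unfolded affine_isometry_def]
  show "bounded_linear L" using a by (rule conjunct1)
  show "h (x + y) = h x + L y" using a[THEN conjunct2, THEN conjunct1] by (elim allE)
  show "h y \<in> m0" if "y \<in> m0" using a[THEN conjunct2, THEN conjunct2, THEN conjunct1] that by (rule subsetD[OF _ imageI])
  show "ip (trivialize (h y) (L v)) (trivialize (h y) (L w)) = ip (trivialize y v) (trivialize y w)"
    if "y \<in> m0" "v \<in> m0" "w \<in> m0"
    using a[THEN conjunct2, THEN conjunct2, THEN conjunct2, rule_format, OF that] .
qed

lemma affine_isometry_eq: "affine_isometry h L \<Longrightarrow> h y = h 0 + L y"
  using affine_isometryD(2)[of h L 0 y] by simp

lemma affine_isometry_linear_in:
  assumes "affine_isometry h L" "v \<in> m0"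
  shows "L v \<in> m0"
proof -
  have "h v = h 0 + L v" using affine_isometry_eq[OF assms(1)] .
  moreover have "h v \<in> m0" "h 0 \<in> m0" using affine_isometryD(3)[OF assms(1)] assms(2) sub subspace_0 by auto
  ultimately show ?thesis using sub subspace_diff[of m0 "h v" "h 0"] by simp
qed

lemma affine_isometry_compose:
  assumes "affine_isometry h L" "affine_isometry k K"
  shows "affine_isometry (\<lambda>y. h (k y)) (\<lambda>v. L (K v))"
proof -
  note h = affine_isometryD[OF assms(1)] and k = affine_isometryD[OF assms(2)]
  show ?thesis unfolding affine_isometry_def
    using bounded_linear_compose[OF h(1) k(1)] affine_isometry_linear_in[OF assms(2)]
    by (intro conjI allI ballI) (simp_all add: h(2-4) k(2-4) image_subset_iff)
qed

lemma affine_isometry_translation: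
  assumes "n \<in> m0"
  shows "affine_isometry (gmul n) (\<lambda>v. v + (1/2) *\<^sub>R br0 n v)"
proof -
  have "trivialize (gmul n y) (v + (1/2) *\<^sub>R br0 n v) = trivialize y v" for y v
    by (simp add: trivialize_def gmul_def br0.add_left br0.add_right br0_half scaleR_add_right)
  then show ?thesis using bounded_linear_right_translation gmul_in assms
    by (auto simp: affine_isometry_def gmul_def br0.add_right scaleR_add_right)
qed

lemma affine_isometry_has_derivative:
  assumes "affine_isometry h L"
  shows "(h has_derivative L) (at y within V)"
proof -
  have "(\<lambda>y. h 0 + L y) = h" by (rule ext) (rule affine_isometry_eq[OF assms, symmetric])
  then show ?thesis
    using has_derivative_add[OF has_derivative_const[of "h 0"]
        bounded_linear_imp_has_derivative[OF affine_isometryD(1)[OF assms]]] by simp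
qed

lemma affine_isometry_smooth:
  assumes "affine_isometry h L"
  shows "smooth_map M0 M0 (\<lambda>y\<in>m0. h y)"
proof -
  note h = affine_isometry_eq[OF assms]
  have "smooth_on m0 m0 (\<lambda>y. h 0 + L y)"
    by (intro smooth_on_add smooth_on_const smooth_on_bounded_linear affine_isometryD(1)[OF assms])
  then have "smooth_on m0 m0 (\<lambda>y\<in>m0. h y)"
    by (rule smooth_on_cong_within[OF subset_refl, rotated]) (simp add: h[symmetric])
  then show ?thesis using affine_isometryD(3)[OF assms] by (intro smooth_map_flat) auto
qed

lemma affine_isometry_group:
  assumes h: "affine_isometry h L" and k: "affine_isometry k K"
    and inv: "\<And>y. y \<in> m0 \<Longrightarrow> k (h y) = y" "\<And>y. y \<in> m0 \<Longrightarrow> h (k y) = y"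
  shows "(\<lambda>y\<in>m0. h y) \<in> carrier (isometry_group M0 nil_metric)"
proof -
  have hm: "h y \<in> m0" "k y \<in> m0" if "y \<in> m0" for y using affine_isometryD(3)[OF h] affine_isometryD(3)[OF k] that by auto
  have bij: "bij_betw (\<lambda>y\<in>m0. h y) m0 m0"
    by (rule bij_betw_byWitness[where f' = k]) (use hm inv in auto)
  have "smooth_map M0 M0 (inv_into m0 (\<lambda>y\<in>m0. h y))"
  proof -
    have eq: "inv_into m0 (\<lambda>y\<in>m0. h y) y = (\<lambda>y\<in>m0. k y) y" if "y \<in> m0" for y
      using inv_into_f_eq[of "\<lambda>y\<in>m0. h y" m0 "k y" y] bij that hm inv by (auto simp: bij_betw_def)
    note h = affine_isometry_eq[OF k]
    have "smooth_on m0 m0 (\<lambda>y. k 0 + K y)"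
      by (intro smooth_on_add smooth_on_const smooth_on_bounded_linear affine_isometryD(1)[OF k])
    then have "smooth_on m0 m0 (inv_into m0 (\<lambda>y\<in>m0. h y))"
      by (rule smooth_on_cong_within[OF subset_refl, rotated]) (simp add: eq h[symmetric])
    then show ?thesis by (intro smooth_map_flat) (use eq hm in auto)
  qed
  moreover have "preserves_metric M0 nil_metric (\<lambda>y\<in>m0. h y)"
  proof -
    have "D_in m0 (in_charts c0 c0 (\<lambda>y\<in>m0. h y)) p v = L v" if "p \<in> m0" "v \<in> m0" for p v
    proof (rule D_in_in_charts_flat[OF _ sub that])
      show "((\<lambda>y\<in>m0. h y) has_derivative L) (at p within m0)"
        by (rule has_derivative_transform[OF that(1) _ affine_isometry_has_derivative[OF h]]) simp
    qed
    then show ?thesis using affine_isometryD(4)[OF h] by (auto simp: preserves_metric_def nil_metric_def)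
  qed
  ultimately show ?thesis
    using bij affine_isometry_smooth[OF h] by (simp add: isometry_group_def Bij_def)
qed

lemma left_translations_isometries: "left_translations nil_group \<subseteq> carrier (isometry_group M0 nil_metric)"
proof -
  have "(\<lambda>y\<in>m0. gmul n y) \<in> carrier (isometry_group M0 nil_metric)" if n: "n \<in> m0" for n
  proof (rule affine_isometry_group[OF affine_isometry_translation affine_isometry_translation])
    show "n \<in> m0" "- n \<in> m0" using n sub subspace_neg by auto
    show "gmul (- n) (gmul n y) = y" "gmul n (gmul (- n) y) = y" for y
      by (simp_all add: gmul_def br0.minus_left br0.minus_right br0.add_right br0.diff_right br0_half br0_self)
  qed
  then show ?thesis by (auto simp: left_translations_def nil_group_def)
qed

lemma riemannian_metric_nil: "riemannian_metric M0 nil_metric"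
proof -
  have bl: "bounded_linear (trivialize u)" for u unfolding trivialize_def
    by (intro bounded_linear_sub bounded_linear_ident
      bounded_linear_compose[OF bounded_linear_scaleR_right br0.bounded_linear_right])
  have bil: "bounded_bilinear (\<lambda>v w. ip (trivialize u v) (trivialize u w))" for u
    using bounded_bilinear.comp[OF ip_bilinear bl bl] .
  have pos: "ip (trivialize u v) (trivialize u v) > 0" if "u \<in> m0" "v \<in> m0" "v \<noteq> 0" for u v
  proof (rule ip_pos)
    show "trivialize u v \<in> m0" using that trivialize_in by blast
    show "trivialize u v \<noteq> 0"
    proof
      assume "trivialize u v = 0"
      \<comment> \<open>Inserting this equation into its own bracket gives a double bracket, so
        \<open>br0 u v = 0\<close> and then \<open>v = 0\<close>.\<close>
      then have "v = (1/2) *\<^sub>R br0 u v" by (simp add: trivialize_def)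
      then have "br0 u v = 0" using br0_half by metis
      then show False using \<open>v = (1/2) *\<^sub>R br0 u v\<close> that by simp
    qed
  qed
  have sig: "has_signature m0 (nil_metric c u) (dim m0) 0" if "u \<in> m0" for c u
  proof -
    obtain P where P: "finite P" "independent P" "span P = m0"
      "\<forall>x\<in>P. \<forall>y\<in>P. ip (trivialize u x) (trivialize u y) = (if x = y then 1 else 0)"
      using orthonormal_basis_form[OF bil[of u] ip_sym sub pos[OF \<open>u \<in> m0\<close>]] by blast
    have "card P = dim m0" using dim_span_eq_card_independent[OF P(2)] P(3) by simp
    then show ?thesis unfolding has_signature_def
      by (intro exI[of _ P] exI[of _ "{}"]) (use P in \<open>auto simp: nil_metric_def\<close>)
  qed
  have symf: "symmetric_form m0 (nil_metric c u)" for c u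
  proof -
    interpret B: bounded_bilinear "\<lambda>v w. ip (trivialize u v) (trivialize u w)" by (rule bil)
    show ?thesis unfolding symmetric_form_def nil_metric_def
      by (intro conjI ballI allI) (simp_all add: B.add_left B.scaleR_left, rule ip_sym)
  qed
  have smooth: "smooth_on m0 m0 (\<lambda>u. nil_metric c u v w)" for c v w
  proof -
    have "smooth_on m0 m0 (\<lambda>u. v + (- 1/2) *\<^sub>R br0 u v)" for v
      by (intro smooth_on_add smooth_on_const smooth_on_linear_compose[OF bounded_linear_scaleR_right subset_refl]
          smooth_on_bounded_linear br0.bounded_linear_left)
    then have "smooth_on m0 m0 (\<lambda>u. trivialize u v)" for v by (simp add: trivialize_def)
    then show ?thesis unfolding nil_metric_def by (intro smooth_on_bilinear[OF ip_bilinear subset_refl])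
  qed
  have "preserves_metric M0 nil_metric (\<lambda>x. x)"
    using D_in_in_charts_flat[OF has_derivative_ident sub]
    by (auto simp: preserves_metric_def nil_metric_def)
  then show ?thesis using sig symf smooth
    by (auto simp: riemannian_metric_def pseudo_riemannian_metric_def)
qed


section \<open>One-parameter groups of isometries generated by \<open>X + D\<close>\<close>

definition go_derivation :: "'v \<Rightarrow> ('v \<Rightarrow> 'v) \<Rightarrow> bool" where
  "go_derivation X D \<longleftrightarrow> X \<in> m0 \<and> linear D \<and> (\<forall>y. D y \<in> m0) \<and>
     (\<forall>y z. D (br0 y z) = br0 (D y) z + br0 y (D z)) \<and>
     (\<forall>y\<in>m0. \<forall>z\<in>m0. ip (D y) z = - ip y (D z)) \<and> (\<forall>y\<in>m0. ip (br0 X y + D y) X = 0)"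

context
  fixes X :: 'v and D :: "'v \<Rightarrow> 'v"
  assumes go_derivation: "go_derivation X D"
begin

lemma X: "X \<in> m0" and D_lin: "linear D" and D_in: "D y \<in> m0"
  and D_der: "D (br0 y z) = br0 (D y) z + br0 y (D z)"
  and D_skew: "y \<in> m0 \<Longrightarrow> z \<in> m0 \<Longrightarrow> ip (D y) z = - ip y (D z)"
  and D_go: "y \<in> m0 \<Longrightarrow> ip (br0 X y + D y) X = 0"
  using go_derivation unfolding go_derivation_def by blast+

text \<open>The flow of the affine vector field \<open>y \<mapsto> X + (D + ad X / 2) y\<close>, which generates the
  one-parameter group \<open>exp t(X + D)\<close>, written as a linear flow on \<open>'v \<times> \<real>\<close>.\<close>

definition gen :: "'v \<times> real \<Rightarrow> 'v \<times> real" where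
  "gen z = (snd z *\<^sub>R X + D (fst z) + (1/2) *\<^sub>R br0 X (fst z), 0)"

text \<open>The second coordinate is constant along the linear flow: the slice at height 1 carries
  the affine flow, the slice at height 0 its linear part \<open>lflow\<close>.\<close>

definition aflow :: "real \<Rightarrow> 'v \<Rightarrow> 'v" where
  "aflow t y = fst (flow gen t (y, 1))"

definition lflow :: "real \<Rightarrow> 'v \<Rightarrow> 'v" where
  "lflow t v = fst (flow gen t (v, 0))"

lemma gen_bounded: "bounded_linear gen"
proof -
  have "linear gen" unfolding gen_def
    by (rule linearI) (simp_all add: linear_add[OF D_lin] linear_scale[OF D_lin] br0.add_right br0.scaleR_right
        algebra_simps)
  then show ?thesis using linear_conv_bounded_linear by blast
qed

lemma flow_gen_snd: "snd (flow gen t z) = snd z"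
proof -
  have "((\<lambda>t. snd (flow gen t z)) has_vector_derivative 0) (at t)" for t
    using bounded_linear.has_vector_derivative[OF bounded_linear_snd flow_derivative[OF gen_bounded, of z t]]
    by (simp add: gen_def)
  then have "snd (flow gen t z) = snd (flow gen 0 z)"
    by (intro zero_derivative_constant[of UNIV]) auto
  then show ?thesis by (simp add: flow_0[OF gen_bounded])
qed

lemma flow_gen_pair: "flow gen t (y, 1) = (aflow t y, 1)" "flow gen t (y, 0) = (lflow t y, 0)"
  using flow_gen_snd[of t "(y, 1)"] flow_gen_snd[of t "(y, 0)"]
  by (simp_all add: aflow_def lflow_def prod_eq_iff)

lemma aflow_0: "aflow 0 y = y" and lflow_0: "lflow 0 y = y"
  by (simp_all add: aflow_def lflow_def flow_0[OF gen_bounded])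

lemma aflow_add_time: "aflow (s + t) y = aflow s (aflow t y)"
proof -
  have "flow gen (s + t) (y, 1) = flow gen s (aflow t y, 1)"
    using flow_add[OF gen_bounded, of s t "(y, 1)"] by (simp only: flow_gen_pair(1)[of t])
  then show ?thesis by (simp only: flow_gen_pair prod.inject)
qed

lemma lflow_bounded: "bounded_linear (lflow t)"
proof -
  have "bounded_linear (\<lambda>v :: 'v. (v, 0 :: real))"
    by (intro bounded_linear_Pair bounded_linear_ident bounded_linear_zero)
  then show ?thesis unfolding lflow_def
    by (intro bounded_linear_compose[OF bounded_linear_fst] bounded_linear_compose[OF flow_linear[OF gen_bounded]])
qed

lemma aflow_add: "aflow t (x + y) = aflow t x + lflow t y"
proof -
  have "flow gen t ((x, 1) + (y, 0)) = flow gen t (x, 1) + flow gen t (y, 0)"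
    using flow_linear[OF gen_bounded] bounded_linear.linear linear_add by blast
  then show ?thesis by (simp add: aflow_def lflow_def)
qed

lemma aflow_derivative:
  "((\<lambda>t. aflow t y) has_vector_derivative (X + D (aflow t y) + (1/2) *\<^sub>R br0 X (aflow t y))) (at t)"
  using bounded_linear.has_vector_derivative[OF bounded_linear_fst flow_derivative[OF gen_bounded, of "(y, 1)" t]]
  by (simp add: gen_def flow_gen_pair)

lemma lflow_derivative:
  "((\<lambda>t. lflow t y) has_vector_derivative (D (lflow t y) + (1/2) *\<^sub>R br0 X (lflow t y))) (at t)"
  using bounded_linear.has_vector_derivative[OF bounded_linear_fst flow_derivative[OF gen_bounded, of "(y, 0)" t]]
  by (simp add: gen_def flow_gen_pair)

lemma aflow_in: "y \<in> m0 \<Longrightarrow> aflow t y \<in> m0"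
proof -
  assume y: "y \<in> m0"
  have "aflow t y - aflow 0 y \<in> m0"
    by (rule vector_derivative_diff_in_subspace[OF sub aflow_derivative])
       (use X D_in br0_in sub in \<open>auto intro!: subspace_add subspace_scale\<close>)
  then show ?thesis using y subspace_add[OF sub, of "aflow t y - y" y] by (simp add: aflow_0)
qed

lemma lflow_in: "y \<in> m0 \<Longrightarrow> lflow t y \<in> m0"
proof -
  assume y: "y \<in> m0"
  have "lflow t y - lflow 0 y \<in> m0"
    by (rule vector_derivative_diff_in_subspace[OF sub lflow_derivative])
       (use D_in br0_in sub in \<open>auto intro!: subspace_add subspace_scale\<close>)
  then show ?thesis using y subspace_add[OF sub, of "lflow t y - y" y] by (simp add: lflow_0)
qed

text \<open>The two terms \<open>[X, v] / 2\<close> cancel, double brackets vanish, and Leibniz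
  collects the rest into \<open>D\<close>. Trivialized vectors thus evolve by the skew map
  \<open>D\<close> alone. This applies to vectors carried along by the flow as well as to the
  velocity of an orbit.\<close>

lemma trivialize_flow_derivative:
  assumes y: "(y has_vector_derivative (X + D (y t) + (1/2) *\<^sub>R br0 X (y t))) (at t)"
    and v: "(v has_vector_derivative (D (v t) + (1/2) *\<^sub>R br0 X (v t))) (at t)"
  shows "((\<lambda>t. trivialize (y t) (v t)) has_vector_derivative D (trivialize (y t) (v t))) (at t)"
proof -
  have "((\<lambda>t. trivialize (y t) (v t)) has_vector_derivative (D (v t) + (1/2) *\<^sub>R br0 X (v t)) -
     (1/2) *\<^sub>R (br0 (y t) (D (v t) + (1/2) *\<^sub>R br0 X (v t)) + br0 (X + D (y t) + (1/2) *\<^sub>R br0 X (y t)) (v t))) (at t)"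
    unfolding trivialize_def
    by (intro has_vector_derivative_diff v
        bounded_linear.has_vector_derivative[OF bounded_linear_scaleR_right br0.has_vector_derivative[OF y v]])
  moreover have "(D (v t) + (1/2) *\<^sub>R br0 X (v t)) -
     (1/2) *\<^sub>R (br0 (y t) (D (v t) + (1/2) *\<^sub>R br0 X (v t)) + br0 (X + D (y t) + (1/2) *\<^sub>R br0 X (y t)) (v t))
     = D (trivialize (y t) (v t))"
    by (simp add: trivialize_def linear_diff[OF D_lin] linear_scale[OF D_lin] D_der br0.add_left br0.add_right br0_half
        scaleR_add_right)
  ultimately show ?thesis by simp
qed

lemma affine_isometry_flow: "affine_isometry (aflow t) (lflow t)"
proof -
  have "ip (trivialize (aflow t y) (lflow t v)) (trivialize (aflow t y) (lflow t w)) = ip (trivialize y v) (trivialize y w)"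
    if "y \<in> m0" "v \<in> m0" "w \<in> m0" for y v w
  proof -
    let ?th = "\<lambda>v t. trivialize (aflow t y) (lflow t v)"
    have m: "?th v t \<in> m0" if "v \<in> m0" for v t using that lflow_in trivialize_in by blast
    have d: "((\<lambda>t. ?th v t) has_vector_derivative D (?th v t)) (at t)" for v t
      by (rule trivialize_flow_derivative[OF aflow_derivative lflow_derivative])
    have "((\<lambda>t. ip (?th v t) (?th w t)) has_vector_derivative 0) (at t)" for t
      using ip.has_vector_derivative[OF d[of v t] d[of w t]] D_skew[OF m m, of v w t t] that by simp
    then have "ip (?th v t) (?th w t) = ip (?th v 0) (?th w 0)"
      by (intro zero_derivative_constant[of UNIV]) auto
    then show ?thesis by (simp add: aflow_0 lflow_0)
  qed
  then show ?thesis unfolding affine_isometry_def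
    using aflow_in lflow_bounded by (auto simp: aflow_add)
qed

text \<open>The left-trivialized velocity \<open>V\<close> of the orbit of \<open>0\<close> satisfies \<open>V' = D V\<close>; the defect
  \<open>F = D V - Q V\<close> of the Euler equation satisfies \<open>F' = D F\<close>, hence has constant norm.\<close>

definition orbit_velocity :: "real \<Rightarrow> 'v" where
  "orbit_velocity t = trivialize (aflow t 0) (X + D (aflow t 0) + (1/2) *\<^sub>R br0 X (aflow t 0))"

lemma orbit_velocity_derivative:
  "(orbit_velocity has_vector_derivative D (orbit_velocity t)) (at t)"
proof -
  let ?n = "\<lambda>t. aflow t 0" and ?v = "\<lambda>t. X + D (aflow t 0) + (1/2) *\<^sub>R br0 X (aflow t 0)"
  have bl: "bounded_linear (\<lambda>y. D y + (1/2) *\<^sub>R br0 X y)"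
    using D_lin linear_conv_bounded_linear
    by (auto intro!: bounded_linear_add bounded_linear_compose[OF bounded_linear_scaleR_right br0.bounded_linear_right])
  have "(?v has_vector_derivative 0 + (D (?v t) + (1/2) *\<^sub>R br0 X (?v t))) (at t)"
    using has_vector_derivative_add[OF has_vector_derivative_const[of X]
        bounded_linear.has_vector_derivative[OF bl aflow_derivative[of 0 t]]] by (simp add: add.assoc)
  then show ?thesis unfolding orbit_velocity_def
    using trivialize_flow_derivative[where y = ?n and v = ?v and t = t, OF aflow_derivative] by simp
qed

lemma orbit_velocity_in: "orbit_velocity t \<in> m0"
  unfolding orbit_velocity_def
  by (rule trivialize_in) (use X D_in br0_in sub in \<open>auto intro!: subspace_add subspace_scale\<close>)

lemma orbit_velocity_0: "orbit_velocity 0 = X"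
  by (simp add: orbit_velocity_def aflow_0 trivialize_def br0.zero_left br0.zero_right linear_0[OF D_lin])

lemma orbit_euler:
  assumes b: "b \<in> m0"
  shows "ip (D (orbit_velocity t)) b = ip (orbit_velocity t) (br0 (orbit_velocity t) b)"
proof -
  obtain P where P: "finite P" "span P = m0" "\<forall>x\<in>P. \<forall>y\<in>P. ip x y = (if x = y then 1 else 0)"
    using orthonormal_basis_form[OF ip_bilinear ip_sym sub ip_pos] by blast
  have PM: "P \<subseteq> m0" using P(2) span_superset by blast
  \<comment> \<open>Functionals are represented by vectors of \<open>m0\<close> so that the Euler
    equation, known only as an equation of inner products, can be differentiated as a vector
    equation.\<close>
  have riesz: "ip (\<Sum>p\<in>P. \<phi> p *\<^sub>R p) b = \<phi> b" if "linear \<phi>" "b \<in> m0" for \<phi> b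
  proof -
    have "linear (\<lambda>b. ip (\<Sum>p\<in>P. \<phi> p *\<^sub>R p) b)" using ip.bounded_linear_right bounded_linear.linear by blast
    then show ?thesis
      using linear_eq_on[OF _ that(1), of _ b P] orthonormal_coeff[OF ip_bilinear P(1,3)] that(2) P(2) by blast
  qed
  let ?V = orbit_velocity
  define Q where "Q v = (\<Sum>p\<in>P. ip v (br0 v p) *\<^sub>R p)" for v
  have lin: "linear (\<lambda>b. ip u (br0 v b))" for u v
    by (rule linearI) (simp_all add: br0.add_right br0.scaleR_right ip.add_right ip.scaleR_right)
  have Q: "ip (Q v) b = ip v (br0 v b)" if "b \<in> m0" for v b
    unfolding Q_def by (rule riesz[OF lin that])
  define R where "R t = (\<Sum>p\<in>P. (ip (?V t) (br0 (D (?V t)) p) + ip (D (?V t)) (br0 (?V t) p)) *\<^sub>R p)" for t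
  have Rip: "ip (R t) b = ip (?V t) (br0 (D (?V t)) b) + ip (D (?V t)) (br0 (?V t) b)" if "b \<in> m0" for t b
    unfolding R_def by (rule riesz[OF linear_compose_add[OF lin lin] that])
  have summ: "(\<Sum>p\<in>P. f p *\<^sub>R p) \<in> m0" for f
    using PM sub by (auto intro!: subspace_sum subspace_scale)
  define F where "F t = D (?V t) - Q (?V t)" for t
  have Fm: "F t \<in> m0" for t using D_in summ sub by (auto simp: F_def Q_def intro: subspace_diff)
  have dF: "(F has_vector_derivative (D (D (?V t)) - R t)) (at t)" for t
  proof -
    have "bounded_linear D" using D_lin linear_conv_bounded_linear by blast
    then have 1: "((\<lambda>t. D (?V t)) has_vector_derivative D (D (?V t))) (at t)"
      using bounded_linear.has_vector_derivative orbit_velocity_derivative by blast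
    have "((\<lambda>t. ip (?V t) (br0 (?V t) p) *\<^sub>R p) has_vector_derivative
      (ip (?V t) (br0 (D (?V t)) p) + ip (D (?V t)) (br0 (?V t) p)) *\<^sub>R p) (at t)" for p
      by (rule bounded_linear.has_vector_derivative[OF bounded_linear_scaleR_left]
          ip.has_vector_derivative bounded_linear.has_vector_derivative[OF br0.bounded_linear_left]
          orbit_velocity_derivative)+
    then have "((\<lambda>t. Q (?V t)) has_vector_derivative R t) (at t)"
      unfolding Q_def R_def by (intro has_vector_derivative_sum) blast
    then show ?thesis unfolding F_def by (rule has_vector_derivative_diff[OF 1])
  qed
  \<comment> \<open>\<open>F' = D F\<close> is established only against vectors of
    \<open>m0\<close>. This is enough, since it is paired with \<open>F t\<close> itself, which lies
    in \<open>m0\<close>.\<close>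
  have F': "ip (D (D (?V t)) - R t) b = ip (D (F t)) b" if b: "b \<in> m0" for b t
  proof -
    note V = orbit_velocity_in[of t]
    have "ip (?V t) (br0 (D (?V t)) b) = ip (?V t) (D (br0 (?V t) b)) - ip (?V t) (br0 (?V t) (D b))"
      by (simp add: D_der ip.add_right)
    also have "ip (?V t) (D (br0 (?V t) b)) = - ip (D (?V t)) (br0 (?V t) b)"
      using D_skew[OF V br0_in] by simp
    finally have "ip (R t) b = - ip (?V t) (br0 (?V t) (D b))" using Rip[OF b] by simp
    also have "\<dots> = - ip (Q (?V t)) (D b)" using Q D_in by simp
    also have "\<dots> = ip (D (Q (?V t))) b" using D_skew[of "Q (?V t)" b] summ b by (simp add: Q_def)
    finally show ?thesis by (simp add: F_def linear_diff[OF D_lin] ip.diff_left)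
  qed
  have "((\<lambda>t. ip (F t) (F t)) has_vector_derivative 0) (at t)" for t
  proof -
    have "ip (D (F t)) (F t) = 0" using D_skew[OF Fm Fm, of t t] ip_sym[of "F t" "D (F t)"] by linarith
    then have "ip (D (D (?V t)) - R t) (F t) = 0" using F'[OF Fm, of t t] by linarith
    then have "ip (F t) (D (D (?V t)) - R t) + ip (D (D (?V t)) - R t) (F t) = 0"
      using ip_sym[of "F t" "D (D (?V t)) - R t"] by linarith
    then show ?thesis using ip.has_vector_derivative[OF dF[of t] dF[of t]] by (simp only:)
  qed
  then have "ip (F t) (F t) = ip (F 0) (F 0)"
    by (intro zero_derivative_constant[of UNIV]) auto
  moreover have "F 0 = 0"
  proof -
    \<comment> \<open>At time 0 the velocity is \<open>X\<close>, and vanishing of the defect is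
      exactly the geodesic condition for \<open>X\<close> and \<open>D\<close>.\<close>
    have "ip (F 0) b = 0" if b: "b \<in> m0" for b
    proof -
      have "ip (F 0) b = ip (D X) b - ip (Q X) b" by (simp only: F_def orbit_velocity_0 ip.diff_left)
      moreover have "ip (br0 X b) X + ip (D b) X = 0" using D_go[OF b] by (simp only: ip.add_left)
      ultimately show ?thesis
        using D_skew[OF X b] Q[OF b, of X] ip_sym[of X "br0 X b"] ip_sym[of X "D b"] by linarith
    qed
    then have "ip (F 0) (F 0) = 0" using Fm by blast
    then show ?thesis using ip_pos[OF Fm[of 0]] by (metis less_irrefl)
  qed
  ultimately have "ip (F t) (F t) = 0" by (simp only: ip.zero_left)
  then have "F t = 0" using ip_pos[OF Fm[of t]] by (metis less_irrefl)
  then show ?thesis using Q[OF b, of "?V t"] by (simp add: F_def)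
qed


text \<open>The flow conjugated by left translation by \<open>p\<close>, so that its orbit through
  \<open>p\<close> is the left translate of the orbit of 0.\<close>

definition orbit_group :: "'v \<Rightarrow> real \<Rightarrow> 'v \<Rightarrow> 'v" where
  "orbit_group p t = (\<lambda>y\<in>m0. gmul p (aflow t (gmul (- p) y)))"

lemma orbit_group_subgroup:
  assumes p: "p \<in> m0"
  shows "one_parameter_subgroup M0 (carrier (isometry_group M0 nil_metric)) (orbit_group p)"
proof -
  have p': "- p \<in> m0" using p sub subspace_neg by blast
  have flow_inv: "aflow t (aflow (- t) y) = y" "aflow (- t) (aflow t y) = y" for t y
    using aflow_add_time[of t "- t" y] aflow_add_time[of "- t" t y] aflow_0 by simp_all
  have iso: "orbit_group p t \<in> carrier (isometry_group M0 nil_metric)" for t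
  proof -
    note 1 = affine_isometry_compose[OF affine_isometry_translation[OF p]
        affine_isometry_compose[OF affine_isometry_flow affine_isometry_translation[OF p']]]
    show ?thesis unfolding orbit_group_def
      by (rule affine_isometry_group[OF 1[of t] 1[of "- t"]]) (simp_all add: gmul_cancel flow_inv)
  qed
  have in_m0: "gmul p (aflow t (gmul (- p) y)) \<in> m0" if "y \<in> m0" for t y
    using gmul_in p p' that aflow_in by blast
  have add: "orbit_group p (s + t) = compose m0 (orbit_group p s) (orbit_group p t)" for s t
    using in_m0 by (auto simp: orbit_group_def compose_def fun_eq_iff restrict_def gmul_cancel aflow_add_time)
  have smooth: "smooth_on (UNIV \<times> m0) (UNIV \<times> m0) (\<lambda>(t, y). orbit_group p t y)"
  proof -
    let ?T = "\<lambda>y :: 'v. (y + (1/2) *\<^sub>R br0 (- p) y, 0 :: real)"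
    have T: "bounded_linear ?T"
      by (intro bounded_linear_Pair bounded_linear_right_translation bounded_linear_zero)
    have "smooth_on (UNIV \<times> m0) (UNIV \<times> m0) (\<lambda>z. p + (fst (flow gen (fst z) (?T (snd z) + (- p, 1)))
        + (1/2) *\<^sub>R br0 p (fst (flow gen (fst z) (?T (snd z) + (- p, 1))))))"
      using flow_smooth[OF gen_bounded T subset_refl, of "UNIV \<times> m0" "(- p, 1)"]
      by (intro smooth_on_add[OF smooth_on_const] smooth_on_linear_compose[OF bounded_linear_right_translation subset_refl]
          smooth_on_linear_compose[OF bounded_linear_fst subset_refl]) (simp add: split_def)
    moreover have "?T y + (- p, 1) = (gmul (- p) y, 1)" for y by (simp add: gmul_def)
    ultimately have "smooth_on (UNIV \<times> m0) (UNIV \<times> m0) (\<lambda>z. p + (aflow (fst z) (gmul (- p) (snd z))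
        + (1/2) *\<^sub>R br0 p (aflow (fst z) (gmul (- p) (snd z)))))"
      by (simp only: aflow_def)
    then have "smooth_on (UNIV \<times> m0) (UNIV \<times> m0) (\<lambda>z. gmul p (aflow (fst z) (gmul (- p) (snd z))))"
      by (simp only: gmul_def[of p] add.assoc)
    then show ?thesis
      by (rule smooth_on_cong_within[OF subset_refl, rotated]) (auto simp: orbit_group_def)
  qed
  have "smooth_map (prod_manifold real_line M0) M0 (\<lambda>(t, y). orbit_group p t y)"
    unfolding real_line_flat prod_flat
    by (rule smooth_map_flat[OF _ smooth]) (use in_m0 in \<open>auto simp: orbit_group_def\<close>)
  then show ?thesis using iso add by (simp add: one_parameter_subgroup_def)
qed

text \<open>The differential of left translation by \<open>p\<close> is undone by
  \<open>trivialize\<close>, so the velocity found for the orbit of 0 reappears.\<close>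

lemma orbit_derivative:
  assumes p: "p \<in> m0"
  shows "\<exists>\<sigma>'. ((\<lambda>t. orbit_group p (t - t0) p) has_vector_derivative \<sigma>') (at t) \<and>
    trivialize (orbit_group p (t - t0) p) \<sigma>' = orbit_velocity (t - t0)"
proof -
  let ?n = "\<lambda>t. aflow t 0" and ?v = "\<lambda>t. X + D (aflow t 0) + (1/2) *\<^sub>R br0 X (aflow t 0)"
  have eq: "orbit_group p t p = p + (?n t + (1/2) *\<^sub>R br0 p (?n t))" for t
    using p gmul_cancel(1)[of p 0] by (simp add: orbit_group_def gmul_def br0.zero_right br0_self br0.minus_left)
  have "((\<lambda>t. ?n (t - t0)) has_vector_derivative ?v (t - t0)) (at t)"
    by (rule has_vector_derivative_shift[OF aflow_derivative])
  then have "((\<lambda>t. orbit_group p (t - t0) p) has_vector_derivative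
      0 + (?v (t - t0) + (1/2) *\<^sub>R br0 p (?v (t - t0)))) (at t)"
    unfolding eq by (intro has_vector_derivative_add[OF has_vector_derivative_const]
        bounded_linear.has_vector_derivative[OF bounded_linear_right_translation])
  moreover have "trivialize (orbit_group p (t - t0) p) (0 + (?v (t - t0) + (1/2) *\<^sub>R br0 p (?v (t - t0))))
      = orbit_velocity (t - t0)"
    unfolding eq orbit_velocity_def trivialize_def
    by (simp add: br0.add_left br0.add_right br0_half scaleR_add_right algebra_simps br0.scaleR_left br0.scaleR_right br0_br0)
  ultimately show ?thesis by blast
qed

end

section \<open>Geodesics of the two-step nilpotent group and their identification with
  orbits\<close>

lemma geodesic_nil:
  assumes geo: "geodesic M0 nil_metric I \<gamma>"
  shows "\<And>t. t \<in> I \<Longrightarrow> \<gamma> t \<in> m0"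
    and "\<exists>v v'. (\<forall>t\<in>I. v t \<in> m0 \<and> v' t \<in> m0 \<and> (v has_vector_derivative v' t) (at t) \<and>
        (\<gamma> has_vector_derivative (v t + (1/2) *\<^sub>R br0 (\<gamma> t) (v t))) (at t) \<and>
        (\<forall>b\<in>m0. ip (v' t) b = ip (v t) (br0 (v t) b)))"
proof -
  have I: "open I" and \<gamma>_map: "continuous_map (top_of_set I) (top_of_set m0) \<gamma>"
    using geo by (auto simp: geodesic_def)
  show \<gamma>m: "\<gamma> t \<in> m0" if "t \<in> I" for t using \<gamma>_map that by (auto simp: continuous_map_def)
  define x' where "x' s = vector_derivative \<gamma> (at s)" for s
  define x'' where "x'' s = vector_derivative x' (at s)" for s
  have raw: "\<gamma> differentiable (at t) \<and> x' differentiable (at t) \<and> (\<forall>w\<in>m0.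
      nil_metric c0 (\<gamma> t) (x'' t) w + D_in m0 (\<lambda>u. nil_metric c0 u (x' t) w) (\<gamma> t) (x' t)
      - 1/2 * D_in m0 (\<lambda>u. nil_metric c0 u (x' t) (x' t)) (\<gamma> t) w = 0)" if "t \<in> I" for t
    using geo that \<gamma>m[OF that] unfolding geodesic_def x''_def x'_def[abs_def] Let_def by simp
  have d1: "(\<gamma> has_vector_derivative x' t) (at t)" if "t \<in> I" for t
    using raw[OF that] vector_derivative_works unfolding x'_def by blast
  have d2: "(x' has_vector_derivative x'' t) (at t)" if "t \<in> I" for t
    using raw[OF that] vector_derivative_works unfolding x''_def by blast
  have x'm: "x' t \<in> m0" if "t \<in> I" for t by (rule vector_derivative_in_subspace[OF sub I that \<gamma>m d1[OF that]])
  have x''m: "x'' t \<in> m0" if "t \<in> I" for t by (rule vector_derivative_in_subspace[OF sub I that x'm d2[OF that]])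
  define v where "v t = trivialize (\<gamma> t) (x' t)" for t
  \<comment> \<open>Moving the base point contributes only \<open>br0 (x' t) (x' t) = 0\<close>, so
    the trivialized velocity has the trivialized acceleration as derivative.\<close>
  have dv: "(v has_vector_derivative trivialize (\<gamma> t) (x'' t)) (at t)" if "t \<in> I" for t
  proof -
    have "(v has_vector_derivative x'' t - (1/2) *\<^sub>R (br0 (\<gamma> t) (x'' t) + br0 (x' t) (x' t))) (at t)"
      unfolding v_def trivialize_def using d1[OF that] d2[OF that]
      by (intro has_vector_derivative_diff bounded_linear.has_vector_derivative[OF bounded_linear_scaleR_right]
          br0.has_vector_derivative)
    then show ?thesis by (simp add: trivialize_def br0_self)
  qed
  have x'_v: "x' t = v t + (1/2) *\<^sub>R br0 (\<gamma> t) (v t)" for t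
    by (simp add: v_def trivialize_def br0.diff_right br0_half)
  have dg: "D_in m0 (\<lambda>u. nil_metric c0 u a w) u h =
      ip (trivialize u a) (- ((1/2) *\<^sub>R br0 h w)) + ip (- ((1/2) *\<^sub>R br0 h a)) (trivialize u w)"
    if "u \<in> m0" "h \<in> m0" for u h a w
  proof (rule D_in_eq[OF _ sub that])
    have "((\<lambda>u. trivialize u a) has_derivative (\<lambda>h. - ((1/2) *\<^sub>R br0 h a))) (at u within m0)" for a
      using has_derivative_diff[OF has_derivative_const[of a] bounded_linear_imp_has_derivative[OF
          bounded_linear_compose[OF bounded_linear_scaleR_right[of "1/2"] br0.bounded_linear_left[of a]]]]
      by (simp add: trivialize_def)
    then show "((\<lambda>u. nil_metric c0 u a w) has_derivative
      (\<lambda>h. ip (trivialize u a) (- ((1/2) *\<^sub>R br0 h w)) + ip (- ((1/2) *\<^sub>R br0 h a)) (trivialize u w))) (at u within m0)"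
      unfolding nil_metric_def by (intro ip.FDERIV)
  qed
  have euler: "ip (trivialize (\<gamma> t) (x'' t)) b = ip (v t) (br0 (v t) b)" if t: "t \<in> I" and b: "b \<in> m0" for t b
  proof -
    \<comment> \<open>The left-invariant vector at \<open>\<gamma> t\<close> with trivialization
      \<open>b\<close>. With this test vector the derivative of the metric along the curve and the
      one along \<open>w\<close> each contribute half of the Euler term.\<close>
    define w where "w = b + (1/2) *\<^sub>R br0 (\<gamma> t) b"
    have w: "w \<in> m0" using b br0_in sub by (auto simp: w_def intro!: subspace_add subspace_scale)
    have tw: "trivialize (\<gamma> t) w = b" by (simp add: w_def trivialize_def br0.add_right br0_half)
    have bw: "br0 (x' t) w = br0 (v t) b"
      by (simp add: x'_v w_def br0.add_left br0.add_right br0_half)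
    have "nil_metric c0 (\<gamma> t) (x'' t) w + D_in m0 (\<lambda>u. nil_metric c0 u (x' t) w) (\<gamma> t) (x' t)
      - 1/2 * D_in m0 (\<lambda>u. nil_metric c0 u (x' t) (x' t)) (\<gamma> t) w = 0" using raw[OF t] w by blast
    then have "ip (trivialize (\<gamma> t) (x'' t)) b - (1/2) * ip (v t) (br0 (v t) b)
        + (1/2) * ip (v t) (br0 w (x' t)) = 0"
      unfolding dg[OF \<gamma>m[OF t] x'm[OF t]] dg[OF \<gamma>m[OF t] w]
      by (simp add: nil_metric_def tw v_def[symmetric] bw br0_self ip.minus_left ip.minus_right ip.scaleR_left
          ip.scaleR_right ip.zero_left ip_sym[of "br0 w (x' t)"])
    then show ?thesis using bw br0_swap[of w "x' t"] by (simp add: ip.minus_right)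
  qed
  show "\<exists>v v'. (\<forall>t\<in>I. v t \<in> m0 \<and> v' t \<in> m0 \<and> (v has_vector_derivative v' t) (at t) \<and>
        (\<gamma> has_vector_derivative (v t + (1/2) *\<^sub>R br0 (\<gamma> t) (v t))) (at t) \<and>
        (\<forall>b\<in>m0. ip (v' t) b = ip (v t) (br0 (v t) b)))"
  proof (intro exI ballI conjI)
    fix t assume t: "t \<in> I"
    show "v t \<in> m0" "trivialize (\<gamma> t) (x'' t) \<in> m0" using x'm[OF t] x''m[OF t] trivialize_in by (auto simp: v_def)
    show "(v has_vector_derivative trivialize (\<gamma> t) (x'' t)) (at t)" by (rule dv[OF t])
    show "(\<gamma> has_vector_derivative (v t + (1/2) *\<^sub>R br0 (\<gamma> t) (v t))) (at t)"
      using d1[OF t] unfolding x'_v .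
    show "ip (trivialize (\<gamma> t) (x'' t)) b = ip (v t) (br0 (v t) b)" if "b \<in> m0" for b by (rule euler[OF t that])
  qed
qed

text \<open>An energy argument in place of a Lipschitz estimate. Against brackets, \<open>v\<close>
  and \<open>w\<close> have constant and hence equal products, so \<open>w\<close> may be replaced
  by \<open>v\<close> there. The difference \<open>d\<close> then satisfies
  \<open>ip d' d = ip v [d, d] = 0\<close> and has constant square.\<close>

lemma euler_unique:
  assumes I: "is_interval I" "t0 \<in> I" "t \<in> I"
    and v: "\<And>t. t \<in> I \<Longrightarrow> v t \<in> m0 \<and> v' t \<in> m0 \<and> (v has_vector_derivative v' t) (at t) \<and>
        (\<forall>b\<in>m0. ip (v' t) b = ip (v t) (br0 (v t) b))"
    and w: "\<And>t. t \<in> I \<Longrightarrow> w t \<in> m0 \<and> w' t \<in> m0 \<and> (w has_vector_derivative w' t) (at t) \<and>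
        (\<forall>b\<in>m0. ip (w' t) b = ip (w t) (br0 (w t) b))"
    and init: "v t0 = w t0"
  shows "v t = w t"
proof -
  have central: "ip (v t) (br0 x y) = ip (w t) (br0 x y)" if "t \<in> I" for t x y
  proof -
    have "((\<lambda>t. ip (v t - w t) (br0 x y)) has_vector_derivative 0) (at t)" if t: "t \<in> I" for t
    proof -
      have "((\<lambda>t. ip (v t - w t) (br0 x y)) has_vector_derivative ip (v' t - w' t) (br0 x y)) (at t)"
        using v[OF t] w[OF t]
        by (intro bounded_linear.has_vector_derivative[OF ip.bounded_linear_left] has_vector_derivative_diff) auto
      moreover have "ip (v' t) (br0 x y) = 0" "ip (w' t) (br0 x y) = 0"
        using v[OF t] w[OF t] br0_in by (auto simp: br0_br0 ip.zero_right)
      ultimately show ?thesis by (simp add: ip.diff_left)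
    qed
    from zero_derivative_constant[OF I(1) this that I(2)] show ?thesis
      by (simp add: init ip.diff_left ip.zero_left)
  qed
  have "((\<lambda>t. ip (v t - w t) (v t - w t)) has_vector_derivative 0) (at t)" if t: "t \<in> I" for t
  proof -
    let ?d = "v t - w t"
    have dm: "?d \<in> m0" using v[OF t] w[OF t] sub subspace_diff by blast
    have d: "((\<lambda>t. v t - w t) has_vector_derivative v' t - w' t) (at t)"
      using v[OF t] w[OF t] by (intro has_vector_derivative_diff) auto
    have "ip (v' t) ?d = ip (v t) (br0 (v t) ?d)" "ip (w' t) ?d = ip (w t) (br0 (w t) ?d)"
      using v[OF t] w[OF t] dm by auto
    then have "ip (v' t - w' t) ?d = ip (v t) (br0 (v t) ?d) - ip (v t) (br0 (w t) ?d)"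
      by (simp add: ip.diff_left central[OF t])
    also have "\<dots> = ip (v t) (br0 ?d ?d)" by (simp add: br0.diff_left ip.diff_right)
    finally have "ip (v' t - w' t) ?d = 0" by (simp add: br0_self ip.zero_right)
    then show ?thesis using ip.has_vector_derivative[OF d d] ip_sym[of ?d] by simp
  qed
  from zero_derivative_constant[OF I(1) this I(3,2)]
  have "ip (v t - w t) (v t - w t) = 0" by (simp add: init ip.zero_left)
  then show ?thesis using ip_pos[of "v t - w t"] v[OF I(3)] w[OF I(3)] sub subspace_diff by fastforce
qed

text \<open>The difference \<open>z\<close> satisfies \<open>z' = [z, v] / 2\<close>. A further
  bracket annihilates the right side, so each \<open>[z, w]\<close> is constant and equal to its
  initial value 0; then \<open>z' = 0\<close> too.\<close>

lemma trivialized_unique: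
  assumes I: "is_interval I" "t0 \<in> I" "t \<in> I"
    and x: "\<And>t. t \<in> I \<Longrightarrow> (x has_vector_derivative (v t + (1/2) *\<^sub>R br0 (x t) (v t))) (at t)"
    and y: "\<And>t. t \<in> I \<Longrightarrow> (y has_vector_derivative (v t + (1/2) *\<^sub>R br0 (y t) (v t))) (at t)"
    and init: "x t0 = y t0"
  shows "x t = y t"
proof -
  have d: "((\<lambda>t. x t - y t) has_vector_derivative (1/2) *\<^sub>R br0 (x t - y t) (v t)) (at t)" if "t \<in> I" for t
    using has_vector_derivative_diff[OF x[OF that] y[OF that]] by (simp add: br0.diff_left scaleR_diff_right)
  have "br0 (x t - y t) w = 0" if t: "t \<in> I" for t w
  proof -
    have "((\<lambda>t. br0 (x t - y t) w) has_vector_derivative 0) (at t)" if t: "t \<in> I" for t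
      using bounded_linear.has_vector_derivative[OF br0.bounded_linear_left d[OF t], of w] by (simp add: br0_half)
    from zero_derivative_constant[OF I(1) this t I(2)] show ?thesis by (simp add: init br0.zero_left)
  qed
  then have "((\<lambda>t. x t - y t) has_vector_derivative 0) (at t)" if "t \<in> I" for t using d[OF that] that by simp
  from zero_derivative_constant[OF I(1) this I(3,2)] show ?thesis by (simp add: init)
qed

lemma riemannian_geodesic_orbit_nil: "riemannian_geodesic_orbit M0 nil_metric"
  unfolding riemannian_geodesic_orbit_def
proof (intro allI impI)
  fix I \<gamma> assume geo: "geodesic M0 nil_metric I \<gamma>"
  then have I: "is_interval I" "I \<noteq> {}" by (auto simp: geodesic_def)
  then obtain t0 where t0: "t0 \<in> I" by blast
  obtain v v' where v: "\<And>t. t \<in> I \<Longrightarrow> v t \<in> m0 \<and> v' t \<in> m0 \<and> (v has_vector_derivative v' t) (at t) \<and>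
        (\<gamma> has_vector_derivative (v t + (1/2) *\<^sub>R br0 (\<gamma> t) (v t))) (at t) \<and>
        (\<forall>b\<in>m0. ip (v' t) b = ip (v t) (br0 (v t) b))"
    using geodesic_nil(2)[OF geo] by blast
  define X where "X = v t0"
  have X: "X \<in> m0" using v[OF t0] by (simp add: X_def)
  obtain D where D: "go_derivation X D"
    using go[OF X] X unfolding go_derivation_def by (auto simp: image_subset_iff)
  define p where "p = \<gamma> t0"
  have p: "p \<in> m0" using geodesic_nil(1)[OF geo t0] by (simp add: p_def)
  let ?V = "\<lambda>t. orbit_velocity X D (t - t0)"
  have dV: "(?V has_vector_derivative D (?V t)) (at t)" for t
    by (rule has_vector_derivative_shift[OF orbit_velocity_derivative[OF D]])
  have vV: "v t = ?V t" if "t \<in> I" for t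
  proof (rule euler_unique[OF I(1) t0 that])
    show "v t0 = ?V t0" using orbit_velocity_0[OF D] X_def by simp
    show "?V t \<in> m0 \<and> D (?V t) \<in> m0 \<and> (?V has_vector_derivative D (?V t)) (at t) \<and>
        (\<forall>b\<in>m0. ip (D (?V t)) b = ip (?V t) (br0 (?V t) b))" for t
      using dV orbit_velocity_in[OF D] orbit_euler[OF D] D_in[OF D] by blast
    show "v t \<in> m0 \<and> v' t \<in> m0 \<and> (v has_vector_derivative v' t) (at t) \<and>
        (\<forall>b\<in>m0. ip (v' t) b = ip (v t) (br0 (v t) b))" if "t \<in> I" for t using v[OF that] by blast
  qed
  let ?\<phi> = "orbit_group X D p"
  have orbit: "\<gamma> t = ?\<phi> (t - t0) p" if "t \<in> I" for t
  proof (rule trivialized_unique[OF I(1) t0 that, of \<gamma> v])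
    show "(\<gamma> has_vector_derivative (v t + (1/2) *\<^sub>R br0 (\<gamma> t) (v t))) (at t)" if "t \<in> I" for t using v[OF that] by blast
    show "((\<lambda>t. ?\<phi> (t - t0) p) has_vector_derivative (v t + (1/2) *\<^sub>R br0 (?\<phi> (t - t0) p) (v t))) (at t)"
      if "t \<in> I" for t
    proof -
      obtain \<sigma>' where \<sigma>': "((\<lambda>t. ?\<phi> (t - t0) p) has_vector_derivative \<sigma>') (at t)"
        "trivialize (?\<phi> (t - t0) p) \<sigma>' = v t"
        using orbit_derivative[OF D p, of t0 t] vV[OF \<open>t \<in> I\<close>] by auto
      have "\<sigma>' = v t + (1/2) *\<^sub>R br0 (?\<phi> (t - t0) p) (v t)"
        unfolding \<sigma>'(2)[symmetric] by (simp add: trivialize_def br0.diff_right br0_half)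
      then show ?thesis using \<sigma>'(1) by simp
    qed
    show "\<gamma> t0 = ?\<phi> (t0 - t0) p"
      using p gmul_cancel(2)[of p p] by (simp add: orbit_group_def[OF D] aflow_0[OF D]) (simp add: p_def)
  qed
  note sg = orbit_group_subgroup[OF D p]
  have mem: "?\<phi> t \<in> carrier (isometry_group M0 nil_metric)" for t
    using sg by (simp add: one_parameter_subgroup_def)
  \<comment> \<open>The orbit is matched at time \<open>t0\<close>, while the definition wants it to
    start at time 0, which may lie outside \<open>I\<close>. The group law moves the base point back
    by \<open>- t0\<close>.\<close>
  have "?\<phi> (- t0) p \<in> m0"
  proof -
    have "bij_betw (?\<phi> (- t0)) m0 m0" using mem[of "- t0"] by (simp add: isometry_group_def Bij_def)
    then show ?thesis using p bij_betwE by blast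
  qed
  moreover have "?\<phi> (t - t0) p = ?\<phi> t (?\<phi> (- t0) p)" for t
  proof -
    have "?\<phi> (t + - t0) = compose m0 (?\<phi> t) (?\<phi> (- t0))"
      using sg unfolding one_parameter_subgroup_def flat_manifold_simps topspace_euclidean_subtopology by blast
    then show ?thesis using p by (simp add: compose_def)
  qed
  ultimately show "\<exists>\<phi>. \<exists>p\<in>topspace (mtop M0).
      one_parameter_subgroup M0 (carrier (isometry_group M0 nil_metric)) \<phi> \<and> (\<forall>t\<in>I. \<gamma> t = \<phi> t p)"
    using sg orbit by (intro exI[of _ ?\<phi>] bexI[of _ "?\<phi> (- t0) p"]) auto
qed

theorem riemannian_go_nilmanifold: "riemannian_go_nilmanifold_algebra m0 br0 ip"
proof -
  have "nil_metric c0 (snd c0 \<one>\<^bsub>nil_group\<^esub>) x y = ip x y" for x y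
    by (simp add: nil_metric_def nil_group_def trivialize_def br0.zero_left)
  moreover have "\<one>\<^bsub>nil_group\<^esub> \<in> m0" using sub subspace_0 by (simp add: nil_group_def)
  ultimately show ?thesis
    unfolding riemannian_go_nilmanifold_algebra_def
    using metric_lie_algebra_m0 nilp positive_definite_m0 lie_group_nil simply_connected_flat[OF sub]
      lie_bracket_nil riemannian_metric_nil left_translations_isometries riemannian_geodesic_orbit_nil
    by (intro conjI exI[of _ nil_group] exI[of _ M0] exI[of _ nil_metric] exI[of _ c0]) simp_all
qed

end

lemma C_on_sum:
  assumes "finite A" "\<And>i. i \<in> A \<Longrightarrow> C_on k V S (f i)"
  shows "C_on k V S (\<lambda>x. \<Sum>i\<in>A. f i x)"
  using assms by (induction A rule: finite_induct) (auto intro: C_on_const C_on_add)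

text \<open>The chain rule gives \<open>FD g (f x) (FD f x v)\<close>, whose direction varies with
  \<open>x\<close>. Expanding it in the basis leaves products of \<open>FD g (f x) i\<close> with
  smooth coefficients, to which the induction over all \<open>g\<close> applies.\<close>

lemma smooth_on_compose:
  fixes f :: "'a::euclidean_space \<Rightarrow> 'b::euclidean_space" and g :: "'b \<Rightarrow> 'c::euclidean_space"
  assumes S: "open S" and T: "open T" and f: "smooth_on UNIV S f" and g: "smooth_on UNIV T g" and fS: "f ` S \<subseteq> T"
  shows "smooth_on UNIV S (\<lambda>x. g (f x))"
proof -
  have "C_on k UNIV S (\<lambda>x. g (f x))" if "smooth_on UNIV T g" for k and g :: "'b \<Rightarrow> 'c"
    using that
  proof (induction k arbitrary: g)
    case 0
    then show ?case using continuous_on_compose2[OF smooth_on_continuous smooth_on_continuous[OF f] fS] by auto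
  next
    case (Suc k)
    have ch: "((\<lambda>x. g (f x)) has_derivative (\<lambda>v. FD g (f x) (FD f x v))) (at x)" if "x \<in> S" for x
      using has_derivative_compose[OF smooth_on_has_derivative[OF f that] smooth_on_has_derivative[OF Suc.prems]]
        fS that by blast
    have "C_on k UNIV S (\<lambda>x. FD g (f x) (FD f x v))" for v
    proof (rule C_on_cong_open[OF S])
      show "C_on k UNIV S (\<lambda>x. \<Sum>i\<in>Basis. (FD f x v \<bullet> i) *\<^sub>R FD g (f x) i)"
      proof (rule C_on_sum[OF finite_Basis])
        fix i :: 'b assume "i \<in> Basis"
        have 1: "C_on k UNIV S (\<lambda>x. FD f x v \<bullet> i)"
          using smooth_on_inner[OF S smooth_on_FD[OF S f]] by (simp add: smooth_on_def)
        have 2: "C_on k UNIV S (\<lambda>x. FD g (f x) i)" by (rule Suc.IH[OF smooth_on_FD[OF T Suc.prems]])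
        show "C_on k UNIV S (\<lambda>x. (FD f x v \<bullet> i) *\<^sub>R FD g (f x) i)"
          by (rule C_on_bilinear[OF bounded_bilinear_scaleR subset_UNIV 1 2])
      qed
      fix x assume x: "x \<in> S"
      then have lin: "linear (FD g (f x))" using smooth_on_linear[OF Suc.prems] fS by blast
      have "FD g (f x) (FD f x v) = FD g (f x) (\<Sum>i\<in>Basis. (FD f x v \<bullet> i) *\<^sub>R i)"
        by (simp only: euclidean_representation)
      then show "(\<Sum>i\<in>Basis. (FD f x v \<bullet> i) *\<^sub>R FD g (f x) i) = FD g (f x) (FD f x v)"
        by (simp only: linear_sum[OF lin] linear_scale[OF lin])
    qed
    then show ?case unfolding C_on.simps by (intro exI[of _ "\<lambda>x v. FD g (f x) (FD f x v)"]) (use ch in auto)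
  qed
  then show ?thesis using g by (simp add: smooth_on_def)
qed

lemma FD_apply: "(f has_derivative f') (at x) \<Longrightarrow> FD f x a = f' a"
  using FD_eq by metis

subsection \<open>Charts of manifolds with full model space\<close>

text \<open>With the whole type as model space, chart images are open and derivatives within the
  model become ordinary ones. The quotient group, modelled on the subspace \<open>m0\<close>, is
  treated by flat manifolds instead.\<close>

locale full_manifold =
  fixes M :: "('m, 'v::euclidean_space) manifold"
  assumes manifold: "smooth_manifold M" and model: "model M = UNIV"
begin

abbreviation dom :: "('m, 'v) chart \<Rightarrow> 'v set" where "dom c \<equiv> snd c ` fst c"

context
  fixes c assumes c: "c \<in> atlas M"
begin

lemma chart_open: "openin (mtop M) (fst c)" and dom_open: "open (dom c)"
  and chart_homeo: "homeomorphic_map (subtopology (mtop M) (fst c)) (top_of_set (dom c)) (snd c)"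
  using manifold c by (auto simp: smooth_manifold_def model)

lemma chart_inj: "inj_on (snd c) (fst c)"
  using homeomorphic_imp_injective_map[OF chart_homeo] openin_subset[OF chart_open]
  by (simp add: Int_absorb1)

lemma chart_inv_snd: "p \<in> fst c \<Longrightarrow> chart_inv c (snd c p) = p"
  using chart_inj by (rule inv_into_f_f)

lemma snd_chart_inv: "u \<in> dom c \<Longrightarrow> snd c (chart_inv c u) = u"
  by (rule f_inv_into_f)

lemma chart_inv_in: "u \<in> dom c \<Longrightarrow> chart_inv c u \<in> fst c"
  by (rule inv_into_into)

lemma chart_inv_topspace: "u \<in> dom c \<Longrightarrow> chart_inv c u \<in> topspace (mtop M)"
  using chart_inv_in openin_subset[OF chart_open] by blast

lemma chart_inv_continuous: "continuous_map (top_of_set (dom c)) (mtop M) (chart_inv c)"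
proof -
  obtain g where g: "homeomorphic_maps (subtopology (mtop M) (fst c)) (top_of_set (dom c)) (snd c) g"
    using chart_homeo homeomorphic_map_maps by blast
  then have gc: "continuous_map (top_of_set (dom c)) (mtop M) g"
    by (auto simp: homeomorphic_maps_def continuous_map_in_subtopology)
  have "g u = chart_inv c u" if u: "u \<in> dom c" for u
  proof -
    obtain p where p: "p \<in> fst c" "u = snd c p" using u by blast
    have "g (snd c p) = p" using g p openin_subset[OF chart_open] by (auto simp: homeomorphic_maps_def)
    then show ?thesis using chart_inv_snd p by simp
  qed
  then show ?thesis using gc by (auto intro: continuous_map_eq)
qed

end

end

lemma open_preimage_top_of_set:
  assumes "open S" "continuous_map (top_of_set S) Y f" "openin Y W"
  shows "open {u \<in> S. f u \<in> W}"
  using openin_continuous_map_preimage[OF assms(2,3)] assms(1) by (simp add: openin_open_eq)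

lemma smooth_map_in_charts:
  fixes M :: "('m, 'v::euclidean_space) manifold" and M' :: "('n, 'w::euclidean_space) manifold"
  assumes "full_manifold M" "full_manifold M'" and f: "smooth_map M M' f" and c: "c \<in> atlas M" and d: "d \<in> atlas M'"
  shows "open {u \<in> snd c ` fst c. f (chart_inv c u) \<in> fst d}"
    and "smooth_on UNIV {u \<in> snd c ` fst c. f (chart_inv c u) \<in> fst d} (in_charts c d f)"
proof -
  interpret M: full_manifold M by fact
  interpret M': full_manifold M' by fact
  have "continuous_map (mtop M) (mtop M') f" using f by (simp add: smooth_map_def)
  from continuous_map_compose[OF M.chart_inv_continuous[OF c] this]
  show "open {u \<in> snd c ` fst c. f (chart_inv c u) \<in> fst d}"
    using open_preimage_top_of_set[OF M.dom_open[OF c] _ M'.chart_open[OF d]] by (simp add: o_def)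
  have eq: "snd c ` {p \<in> fst c. f p \<in> fst d} = {u \<in> snd c ` fst c. f (chart_inv c u) \<in> fst d}"
    using M.chart_inv_snd[OF c] by auto
  have "smooth_on (model M) (snd c ` {p \<in> fst c. f p \<in> fst d}) (in_charts c d f)"
    using f c d unfolding smooth_map_def by blast
  then show "smooth_on UNIV {u \<in> snd c ` fst c. f (chart_inv c u) \<in> fst d} (in_charts c d f)"
    unfolding eq M.model .
qed

lemma smooth_map_prod_in_charts:
  fixes M1 :: "('m, 'v::euclidean_space) manifold" and M2 :: "('n, 'w::euclidean_space) manifold"
    and M' :: "('k, 'u::euclidean_space) manifold"
  assumes "full_manifold M1" "full_manifold M2" "full_manifold M'"
    and f: "smooth_map (prod_manifold M1 M2) M' (\<lambda>(x, y). f x y)"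
    and c: "c1 \<in> atlas M1" "c2 \<in> atlas M2" and d: "d \<in> atlas M'"
  defines "S \<equiv> {z. fst z \<in> snd c1 ` fst c1 \<and> snd z \<in> snd c2 ` fst c2 \<and>
      f (chart_inv c1 (fst z)) (chart_inv c2 (snd z)) \<in> fst d}"
  shows "open S"
    and "smooth_on UNIV S (\<lambda>z. snd d (f (chart_inv c1 (fst z)) (chart_inv c2 (snd z))))"
proof -
  interpret M1: full_manifold M1 by fact
  interpret M2: full_manifold M2 by fact
  interpret M': full_manifold M' by fact
  let ?X = "(snd c1 ` fst c1) \<times> (snd c2 ` fst c2)"
  let ?c = "(fst c1 \<times> fst c2, map_prod (snd c1) (snd c2))"
  have opX: "open ?X" using M1.dom_open[OF c(1)] M2.dom_open[OF c(2)] by (rule open_Times)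
  have A: "continuous_map (prod_topology (mtop M1) (mtop M2)) (mtop M') (\<lambda>(x, y). f x y)"
    using f by (simp add: smooth_map_def prod_manifold_def)
  have B: "continuous_map (top_of_set ?X) (prod_topology (mtop M1) (mtop M2))
      (\<lambda>z. (chart_inv c1 (fst z), chart_inv c2 (snd z)))"
  proof -
    have 1: "continuous_map (top_of_set ?X) (top_of_set (snd c1 ` fst c1)) fst"
      "continuous_map (top_of_set ?X) (top_of_set (snd c2 ` fst c2)) snd"
      by (auto intro: continuous_on_fst continuous_on_snd continuous_on_id)
    show ?thesis
      using continuous_map_compose[OF 1(1) M1.chart_inv_continuous[OF c(1)]]
        continuous_map_compose[OF 1(2) M2.chart_inv_continuous[OF c(2)]]
      by (intro continuous_map_pairedI) (simp_all add: o_def)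
  qed
  have "continuous_map (top_of_set ?X) (mtop M') (\<lambda>z. f (chart_inv c1 (fst z)) (chart_inv c2 (snd z)))"
    using continuous_map_compose[OF B A] by (simp add: o_def)
  from open_preimage_top_of_set[OF opX this M'.chart_open[OF d]]
  have "open {z \<in> ?X. f (chart_inv c1 (fst z)) (chart_inv c2 (snd z)) \<in> fst d}" .
  moreover have S: "S = {z \<in> ?X. f (chart_inv c1 (fst z)) (chart_inv c2 (snd z)) \<in> fst d}"
    by (auto simp: S_def)
  ultimately show oS: "open S" by simp
  have inv: "chart_inv ?c z = (chart_inv c1 (fst z), chart_inv c2 (snd z))" if "z \<in> ?X" for z
  proof -
    have "inj_on (map_prod (snd c1) (snd c2)) (fst c1 \<times> fst c2)"
      using M1.chart_inj[OF c(1)] M2.chart_inj[OF c(2)] map_prod_inj_on by blast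
    then show ?thesis
      using that M1.chart_inv_in[OF c(1)] M2.chart_inv_in[OF c(2)] M1.snd_chart_inv[OF c(1)] M2.snd_chart_inv[OF c(2)]
      by (intro inv_into_f_eq) (auto simp: prod_eq_iff)
  qed
  have cc: "?c \<in> atlas (prod_manifold M1 M2)" unfolding prod_manifold_def manifold.simps using c by blast
  have "smooth_on (model (prod_manifold M1 M2)) (snd ?c ` {p \<in> fst ?c. (case p of (x, y) \<Rightarrow> f x y) \<in> fst d})
      (in_charts ?c d (\<lambda>(x, y). f x y))"
    using f cc d unfolding smooth_map_def by blast
  moreover have "model (prod_manifold M1 M2) = UNIV" by (simp add: prod_manifold_def M1.model M2.model)
  moreover have "snd ?c ` {p \<in> fst ?c. (case p of (x, y) \<Rightarrow> f x y) \<in> fst d} = S"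
  proof (intro subset_antisym subsetI)
    fix z assume "z \<in> snd ?c ` {p \<in> fst ?c. (case p of (x, y) \<Rightarrow> f x y) \<in> fst d}"
    then obtain x y where "x \<in> fst c1" "y \<in> fst c2" "f x y \<in> fst d" "z = (snd c1 x, snd c2 y)" by auto
    then show "z \<in> S" using M1.chart_inv_snd[OF c(1)] M2.chart_inv_snd[OF c(2)] by (simp add: S_def)
  next
    fix z assume z: "z \<in> S"
    let ?p = "(chart_inv c1 (fst z), chart_inv c2 (snd z))"
    have "z = snd ?c ?p" using z M1.snd_chart_inv[OF c(1)] M2.snd_chart_inv[OF c(2)]
      by (simp add: S_def prod_eq_iff)
    moreover have "?p \<in> {p \<in> fst ?c. (case p of (x, y) \<Rightarrow> f x y) \<in> fst d}"
      using z M1.chart_inv_in[OF c(1)] M2.chart_inv_in[OF c(2)] by (simp add: S_def)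
    ultimately show "z \<in> snd ?c ` {p \<in> fst ?c. (case p of (x, y) \<Rightarrow> f x y) \<in> fst d}" by (rule image_eqI)
  qed
  ultimately have "smooth_on UNIV S (in_charts ?c d (\<lambda>(x, y). f x y))" by simp
  moreover have "in_charts ?c d (\<lambda>(x, y). f x y) z = snd d (f (chart_inv c1 (fst z)) (chart_inv c2 (snd z)))"
    if "z \<in> S" for z
  proof -
    have "z \<in> ?X" using that S by blast
    then show ?thesis unfolding in_charts_def o_def inv[OF \<open>z \<in> ?X\<close>] by simp
  qed
  ultimately show "smooth_on UNIV S (\<lambda>z. snd d (f (chart_inv c1 (fst z)) (chart_inv c2 (snd z))))"
    by (rule smooth_on_cong_open[OF oS, rotated])
qed


subsection \<open>Left-invariant fields in a chart\<close>

locale lorentz_lie_group = full_manifold M for M :: "('g, 'v::euclidean_space) manifold" +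
  fixes N :: "'g monoid" and g :: "('g, 'v) metric_tensor" and c :: "('g, 'v) chart"
  assumes lie_group: "lie_group N M" and c: "c \<in> atlas M" and one_c: "\<one>\<^bsub>N\<^esub> \<in> fst c"
    and lorentz: "lorentz_metric M g"
    and left_isometry: "left_translations N \<subseteq> carrier (isometry_group M g)"
begin

lemma group_N: "group N" and carrier_N: "carrier N = topspace (mtop M)"
  and mult_smooth: "smooth_map (prod_manifold M M) M (\<lambda>(x, y). x \<otimes>\<^bsub>N\<^esub> y)"
  and inv_smooth: "smooth_map M M (\<lambda>x. inv\<^bsub>N\<^esub> x)"
  using lie_group by (auto simp: lie_group_def)

sublocale N: group N by (rule group_N)

abbreviation X :: "'v set" where "X \<equiv> dom c"
abbreviation \<iota> :: "'v \<Rightarrow> 'g" where "\<iota> \<equiv> chart_inv c"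
abbreviation u0 :: 'v where "u0 \<equiv> snd c \<one>\<^bsub>N\<^esub>"

definition pmul :: "'v \<times> 'v \<Rightarrow> 'v" where "pmul z = snd c (\<iota> (fst z) \<otimes>\<^bsub>N\<^esub> \<iota> (snd z))"

definition S :: "('v \<times> 'v) set" where
  "S = {z. fst z \<in> X \<and> snd z \<in> X \<and> \<iota> (fst z) \<otimes>\<^bsub>N\<^esub> \<iota> (snd z) \<in> fst c}"

text \<open>\<open>Lam u a\<close> is the value at \<open>u\<close> of the left-invariant field that
  equals \<open>a\<close> at the identity, and \<open>Rho u a\<close> is its right-invariant
  counterpart; both are partial differentials of the multiplication in the chart.\<close>

definition Lam :: "'v \<Rightarrow> 'v \<Rightarrow> 'v" where "Lam u a = FD (\<lambda>v. pmul (u, v)) u0 a"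

definition Rho :: "'v \<Rightarrow> 'v \<Rightarrow> 'v" where "Rho u a = FD (\<lambda>v. pmul (v, u)) u0 a"

abbreviation ip :: "'v \<Rightarrow> 'v \<Rightarrow> real" where "ip \<equiv> g c u0"
abbreviation br :: "'v \<Rightarrow> 'v \<Rightarrow> 'v" where "br \<equiv> lie_bracket N M c"

lemmas X_open = dom_open[OF c] and \<iota>_snd [simp] = chart_inv_snd[OF c] and snd_\<iota> [simp] = snd_chart_inv[OF c]
  and \<iota>_in [simp] = chart_inv_in[OF c]

lemma \<iota>_carrier [simp]: "u \<in> X \<Longrightarrow> \<iota> u \<in> carrier N"
  using chart_inv_topspace[OF c] carrier_N by blast

lemma fst_c_carrier: "p \<in> fst c \<Longrightarrow> p \<in> carrier N"
  using openin_subset[OF chart_open[OF c]] carrier_N by blast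

lemma u0_X [simp]: "u0 \<in> X" and \<iota>_u0 [simp]: "\<iota> u0 = \<one>\<^bsub>N\<^esub>"
  using one_c by auto

lemma fm: "full_manifold M" by (rule full_manifold_axioms)

lemma S_open: "open S" and pmul_smooth: "smooth_on UNIV S pmul"
  using smooth_map_prod_in_charts[OF fm fm fm mult_smooth c c c]
  by (simp_all add: S_def pmul_def[abs_def])

lemma S_u0 [simp]: "u \<in> X \<Longrightarrow> (u, u0) \<in> S" "u \<in> X \<Longrightarrow> (u0, u) \<in> S"
  by (simp_all add: S_def)

lemma pmul_u0 [simp]: "u \<in> X \<Longrightarrow> pmul (u, u0) = u" "u \<in> X \<Longrightarrow> pmul (u0, u) = u"
  by (simp_all add: pmul_def)

lemma pmul_X: "z \<in> S \<Longrightarrow> pmul z \<in> X" and \<iota>_pmul: "z \<in> S \<Longrightarrow> \<iota> (pmul z) = \<iota> (fst z) \<otimes>\<^bsub>N\<^esub> \<iota> (snd z)"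
  by (auto simp: S_def pmul_def)

lemma pmul_has_derivative: "z \<in> S \<Longrightarrow> (pmul has_derivative FD pmul z) (at z)"
  by (rule smooth_on_has_derivative[OF pmul_smooth])

lemma pmul_left_derivative:
  assumes "(u, v) \<in> S"
  shows "((\<lambda>w. pmul (u, w)) has_derivative (\<lambda>a. FD pmul (u, v) (0, a))) (at v)"
  using has_derivative_compose[OF has_derivative_Pair[OF has_derivative_const has_derivative_ident]
      pmul_has_derivative[OF assms]] .

lemma pmul_right_derivative:
  assumes "(u, v) \<in> S"
  shows "((\<lambda>w. pmul (w, v)) has_derivative (\<lambda>a. FD pmul (u, v) (a, 0))) (at u)"
  using has_derivative_compose[OF has_derivative_Pair[OF has_derivative_ident has_derivative_const]
      pmul_has_derivative[OF assms]] .

lemma Lam_eq: "u \<in> X \<Longrightarrow> Lam u a = FD pmul (u, u0) (0, a)"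
  unfolding Lam_def by (subst FD_eq[OF pmul_left_derivative]) auto

lemma Rho_eq: "u \<in> X \<Longrightarrow> Rho u a = FD pmul (u0, u) (a, 0)"
  unfolding Rho_def by (subst FD_eq[OF pmul_right_derivative]) auto

lemma Lam_linear: "u \<in> X \<Longrightarrow> linear (Lam u)"
proof -
  assume u: "u \<in> X"
  have "Lam u = (\<lambda>a. FD pmul (u, u0) (0, a))" using Lam_eq[OF u] by (rule ext)
  then show ?thesis using has_derivative_linear[OF pmul_left_derivative[of u u0]] u by simp
qed

lemma smooth_FD_pmul_slice:
  assumes T: "\<And>u. u \<in> X \<Longrightarrow> T u \<in> S" "smooth_on UNIV X T"
  shows "smooth_on UNIV X (\<lambda>u. FD pmul (T u) h)"
  by (rule smooth_on_compose[OF X_open S_open T(2) smooth_on_FD[OF S_open pmul_smooth]]) (use T(1) in auto)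

lemma smooth_Pair_const: "smooth_on UNIV V (\<lambda>u :: 'v. (u, a :: 'v))" "smooth_on UNIV V (\<lambda>u :: 'v. (a, u :: 'v))"
proof -
  have "smooth_on UNIV V (\<lambda>u :: 'v. (u, 0 :: 'v) + (0, a))" "smooth_on UNIV V (\<lambda>u :: 'v. (a, 0) + (0 :: 'v, u))"
    by (intro smooth_on_add smooth_on_const smooth_on_bounded_linear bounded_linear_Pair
        bounded_linear_ident bounded_linear_zero)+
  then show "smooth_on UNIV V (\<lambda>u :: 'v. (u, a :: 'v))" "smooth_on UNIV V (\<lambda>u :: 'v. (a, u :: 'v))" by simp_all
qed

lemma Lam_smooth: "smooth_on UNIV X (\<lambda>u. Lam u a)"
  by (rule smooth_on_cong_open[OF X_open Lam_eq[symmetric] smooth_FD_pmul_slice[OF _ smooth_Pair_const(1)]]) auto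

lemma Rho_smooth: "smooth_on UNIV X (\<lambda>u. Rho u a)"
  by (rule smooth_on_cong_open[OF X_open Rho_eq[symmetric] smooth_FD_pmul_slice[OF _ smooth_Pair_const(2)]]) auto

lemma FD_identity:
  assumes "open U" "u \<in> U" "\<And>v. v \<in> U \<Longrightarrow> f v = v"
  shows "FD f u a = a"
proof -
  have "(f has_derivative (\<lambda>a. a)) (at u)"
    by (rule has_derivative_transform_within_open[OF has_derivative_ident assms(1,2)]) (use assms(3) in auto)
  then show ?thesis by (rule FD_apply)
qed

lemma Lam_u0 [simp]: "Lam u0 a = a" and Rho_u0 [simp]: "Rho u0 a = a"
  unfolding Lam_def Rho_def by (rule FD_identity[OF X_open]; simp)+

lemma Lam_has_derivative: "u \<in> X \<Longrightarrow> ((\<lambda>u. Lam u a) has_derivative FD (\<lambda>u. Lam u a) u) (at u)"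
  by (rule smooth_on_has_derivative[OF Lam_smooth])

lemma Lam_family_derivative:
  assumes "\<psi> x \<in> X" and \<psi>: "(\<psi> has_derivative \<psi>') (at x)" and a: "(a has_derivative a') (at x)"
  shows "((\<lambda>z. Lam (\<psi> z) (a z)) has_derivative
    (\<lambda>h. FD (\<lambda>u. Lam u (a x)) (\<psi> x) (\<psi>' h) + Lam (\<psi> x) (a' h))) (at (x :: 'e::euclidean_space))"
proof -
  have ch: "((\<lambda>z. Lam (\<psi> z) v) has_derivative (\<lambda>h. FD (\<lambda>u. Lam u v) (\<psi> x) (\<psi>' h))) (at x)" for v
    by (rule has_derivative_compose[OF \<psi> Lam_has_derivative[OF assms(1)]])
  have "isCont \<psi> x" using \<psi> has_derivative_continuous by blast
  then have "(\<psi> \<longlongrightarrow> \<psi> x) (nhds x)" by (simp add: continuous_at tendsto_nhds_iff)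
  then have "\<forall>\<^sub>F z in nhds x. \<psi> z \<in> X" using X_open assms(1) topological_tendstoD by blast
  then have "\<forall>\<^sub>F z in nhds x. linear (Lam (\<psi> z))" by eventually_elim (rule Lam_linear)
  from has_derivative_linear_family[OF this _ a] ch show ?thesis
    unfolding FD_eq[OF ch] differentiable_def by blast
qed

definition dLam :: "'v \<Rightarrow> 'v \<Rightarrow> 'v" where "dLam a b = FD (\<lambda>u. Lam u b) u0 a"

lemma left_invariant_field_eq:
  assumes "u \<in> X"
  shows "left_invariant_field N M c a u = Lam u a"
  by (simp add: left_invariant_field_def Lam_def in_charts_def o_def pmul_def model)

lemma br_eq: "br a b = dLam a b - dLam b a"
proof -
  have "FD (left_invariant_field N M c b) u0 a = dLam a b" for a b
  proof -
    have "(left_invariant_field N M c b has_derivative FD (\<lambda>u. Lam u b) u0) (at u0)"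
      by (rule has_derivative_transform_within_open[OF Lam_has_derivative[OF u0_X] X_open u0_X])
         (simp add: left_invariant_field_eq)
    then show ?thesis unfolding dLam_def by (rule FD_apply)
  qed
  then show ?thesis by (simp add: lie_bracket_def model)
qed

lemma dLam_bilinear: "bounded_bilinear dLam"
proof -
  have l1: "linear (\<lambda>a. dLam a b)" for b
    unfolding dLam_def using smooth_on_linear[OF Lam_smooth u0_X] by simp
  have "FD (\<lambda>u. Lam u (b + b')) u0 a = FD (\<lambda>u. Lam u b) u0 a + FD (\<lambda>u. Lam u b') u0 a" for a b b'
  proof -
    have "((\<lambda>u. Lam u (b + b')) has_derivative (\<lambda>a. FD (\<lambda>u. Lam u b) u0 a + FD (\<lambda>u. Lam u b') u0 a)) (at u0)"
      by (rule has_derivative_transform_within_open[OF has_derivative_add[OF Lam_has_derivative[OF u0_X] Lam_has_derivative[OF u0_X]]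
            X_open u0_X]) (simp add: linear_add[OF Lam_linear])
    then show ?thesis by (rule FD_apply)
  qed
  moreover have "FD (\<lambda>u. Lam u (r *\<^sub>R b)) u0 a = r *\<^sub>R FD (\<lambda>u. Lam u b) u0 a" for a b r
  proof -
    have "((\<lambda>u. Lam u (r *\<^sub>R b)) has_derivative (\<lambda>a. r *\<^sub>R FD (\<lambda>u. Lam u b) u0 a)) (at u0)"
      by (rule has_derivative_transform_within_open[OF has_derivative_scaleR_right[OF Lam_has_derivative[OF u0_X]]
            X_open u0_X]) (simp add: linear_scale[OF Lam_linear])
    then show ?thesis by (rule FD_apply)
  qed
  ultimately have "bilinear dLam" unfolding bilinear_def using l1 by (auto intro!: linearI simp: dLam_def)
  then show ?thesis by (simp add: bilinear_conv_bounded_bilinear)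
qed

lemma br_bilinear: "bounded_bilinear br"
proof -
  interpret P: bounded_bilinear dLam by (rule dLam_bilinear)
  have "bilinear br" unfolding bilinear_def br_eq
    by (auto intro!: linearI simp: P.add_left P.add_right P.scaleR_left P.scaleR_right algebra_simps)
  then show ?thesis by (simp add: bilinear_conv_bounded_bilinear)
qed

end

text \<open>For a basis vector \<open>e\<close> the number \<open>B e e\<close> is 1 or -1 and thus
  its own inverse, so the coefficient can be written without a quotient.\<close>

lemma signature_expansion:
  fixes B :: "'v::euclidean_space \<Rightarrow> 'v \<Rightarrow> real"
  assumes "has_signature UNIV B p q" "bounded_bilinear B"
  shows "\<exists>E. finite E \<and> (\<forall>x. x = (\<Sum>e\<in>E. (B e e * B x e) *\<^sub>R e))"
proof -
  interpret B: bounded_bilinear B by fact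
  obtain P Q where PQ: "finite P" "finite Q" "span (P \<union> Q) = UNIV"
    "\<forall>x\<in>P \<union> Q. \<forall>y\<in>P \<union> Q. x \<noteq> y \<longrightarrow> B x y = 0" "\<forall>x\<in>P. B x x = 1" "\<forall>x\<in>Q. B x x = -1"
    using assms(1) by (auto simp: has_signature_def)
  let ?E = "P \<union> Q"
  have lin: "linear (\<lambda>x. \<Sum>e\<in>?E. (B e e * B x e) *\<^sub>R e)"
    by (rule linearI) (simp_all add: B.add_left B.scaleR_left algebra_simps sum.distrib scaleR_sum_right)
  have base: "x = (\<Sum>e\<in>?E. (B e e * B x e) *\<^sub>R e)" if x: "x \<in> ?E" for x
  proof -
    have "(\<Sum>e\<in>?E. (B e e * B x e) *\<^sub>R e) = (\<Sum>e\<in>?E. if e = x then x else 0)"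
      by (rule sum.cong) (use x PQ in auto)
    then show ?thesis using x PQ(1,2) by simp
  qed
  have "x = (\<Sum>e\<in>?E. (B e e * B x e) *\<^sub>R e)" for x
    using linear_eq_on[OF linear_ident lin _ base, of x] PQ(3) by auto
  then show ?thesis using PQ(1,2) by (intro exI[of _ ?E]) blast
qed

text \<open>Take for \<open>q\<close> the single negative basis vector: what is orthogonal to it
  lies in the span of \<open>P\<close>, where the square is a sum of squares of coordinates.\<close>

lemma lorentz_signature_timelike:
  fixes B :: "'v::euclidean_space \<Rightarrow> 'v \<Rightarrow> real"
  assumes "has_signature UNIV B p 1" "bounded_bilinear B"
  shows "\<exists>q. \<forall>x. B x q = 0 \<longrightarrow> x \<noteq> 0 \<longrightarrow> B x x > 0"
proof -
  interpret B: bounded_bilinear B by fact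
  obtain P Q where PQ: "finite P" "finite Q" "span (P \<union> Q) = UNIV" "card Q = 1" "P \<inter> Q = {}"
    "\<forall>x\<in>P \<union> Q. \<forall>y\<in>P \<union> Q. x \<noteq> y \<longrightarrow> B x y = 0" "\<forall>x\<in>P. B x x = 1" "\<forall>x\<in>Q. B x x = -1"
    using assms(1) by (auto simp: has_signature_def)
  obtain q where q: "Q = {q}" using PQ(4) card_1_singletonE by blast
  have "B x x > 0" if x: "B x q = 0" "x \<noteq> 0" for x
  proof -
    have "x \<in> span (insert q P)" using PQ(3) q by simp
    then obtain a where "x - a *\<^sub>R q \<in> span P" by (auto simp: span_insert)
    then obtain r where r: "x - a *\<^sub>R q = (\<Sum>v\<in>P. r v *\<^sub>R v)" using span_finite[OF PQ(1)] by auto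
    have Pq: "B v q = 0" if "v \<in> P" for v using that PQ(5,6) q by auto
    have "B (x - a *\<^sub>R q) q = 0" unfolding r B.sum_left by (simp add: B.scaleR_left Pq)
    then have "a = 0" using x(1) PQ(8) q by (simp add: B.diff_left B.scaleR_left)
    then have xr: "x = (\<Sum>v\<in>P. r v *\<^sub>R v)" using r by simp
    have "B x v = r v" if "v \<in> P" for v unfolding xr
      by (rule orthonormal_coeff[OF assms(2) PQ(1) _ that]) (use PQ(6,7) in auto)
    then have BB: "B x x = (\<Sum>v\<in>P. r v * r v)"
      by (subst (2) xr) (simp add: B.sum_right B.scaleR_right)
    obtain v where v: "v \<in> P" "r v \<noteq> 0"
    proof (rule ccontr)
      assume "\<not> thesis"
      then have "\<forall>v\<in>P. r v = 0" using that by blast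
      then show False using xr x(2) by simp
    qed
    have "(\<Sum>v\<in>P. r v * r v) > 0"
      by (rule sum_pos2[OF PQ(1) v(1)]) (use v(2) in \<open>auto simp: zero_less_mult_iff linorder_neq_iff\<close>)
    then show ?thesis unfolding BB .
  qed
  then show ?thesis by blast
qed

lemma has_vector_derivative_transform_nhds:
  assumes "(f has_vector_derivative f') (at (x :: real))" "\<forall>\<^sub>F t in nhds x. f t = g t"
  shows "(g has_vector_derivative f') (at x)"
  using assms(1) unfolding has_vector_derivative_def
  by (rule has_derivative_transform_eventually)
     (use assms(2) eventually_nhds_x_imp_x[OF assms(2)] in \<open>auto simp: eventually_at_filter elim: eventually_mono\<close>)

context lorentz_lie_group
begin

lemma metric_form:
  assumes "d \<in> atlas M" "u \<in> dom d"
  shows "symmetric_form UNIV (g d u)" "has_signature UNIV (g d u) (DIM('v) - 1) 1"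
    and "bounded_bilinear (g d u)" "g d u v w = g d u w v"
    and "(\<lambda>u. g d u v w) differentiable (at u)"
proof -
  have 1: "(\<forall>u\<in>dom d. symmetric_form UNIV (g d u) \<and> has_signature UNIV (g d u) (DIM('v) - 1) 1) \<and>
      (\<forall>v w. smooth_on UNIV (dom d) (\<lambda>u. g d u v w))"
    using lorentz assms(1) by (simp add: lorentz_metric_def pseudo_riemannian_metric_def model)
  then show s: "symmetric_form UNIV (g d u)" "has_signature UNIV (g d u) (DIM('v) - 1) 1" using assms(2) by blast+
  show "bounded_bilinear (g d u)" by (rule symmetric_form_UNIV_bilinear[OF s(1)])
  show "g d u v w = g d u w v" using s(1) by (simp add: symmetric_form_def)
  show "(\<lambda>u. g d u v w) differentiable (at u)"
    using 1 smooth_on_has_derivative assms(2) differentiable_def by blast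
qed

lemmas ip_form = metric_form[OF c u0_X]

sublocale ip: bounded_bilinear ip by (rule ip_form(3))
sublocale br: bounded_bilinear br by (rule br_bilinear)
sublocale dLam: bounded_bilinear dLam by (rule dLam_bilinear)

lemma isometry:
  assumes f: "f \<in> carrier (isometry_group M g)"
  shows "smooth_map M M f" "p \<in> carrier N \<Longrightarrow> f p \<in> carrier N" "bij_betw f (carrier N) (carrier N)"
    and "d \<in> atlas M \<Longrightarrow> d' \<in> atlas M \<Longrightarrow> u \<in> dom d \<Longrightarrow> f (chart_inv d u) \<in> fst d' \<Longrightarrow>
      g d' (snd d' (f (chart_inv d u))) (FD (in_charts d d' f) u v) (FD (in_charts d d' f) u w) = g d u v w"
proof -
  have 1: "f \<in> Bij (topspace (mtop M))" "smooth_map M M f" "preserves_metric M g f"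
    using f by (auto simp: isometry_group_def)
  then show "smooth_map M M f" by blast
  show b: "bij_betw f (carrier N) (carrier N)" using 1(1) by (simp add: carrier_N Bij_def)
  show "f p \<in> carrier N" if "p \<in> carrier N" using b that bij_betwE by blast
  show "g d' (snd d' (f (chart_inv d u))) (FD (in_charts d d' f) u v) (FD (in_charts d d' f) u w) = g d u v w"
    if "d \<in> atlas M" "d' \<in> atlas M" "u \<in> dom d" "f (chart_inv d u) \<in> fst d'"
    using 1(3) that chart_inv_in[OF that(1,3)] snd_chart_inv[OF that(1,3)]
    unfolding preserves_metric_def model by (metis UNIV_I)
qed

definition ltrans :: "'g \<Rightarrow> 'g \<Rightarrow> 'g" where "ltrans n = (\<lambda>x\<in>carrier N. n \<otimes>\<^bsub>N\<^esub> x)"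

lemma ltrans_isometry: "n \<in> carrier N \<Longrightarrow> ltrans n \<in> carrier (isometry_group M g)"
  using left_isometry by (auto simp: left_translations_def ltrans_def)

lemma Lam_isometry:
  assumes u: "u \<in> X"
  shows "g c u (Lam u a) (Lam u b) = ip a b"
proof -
  have "FD (in_charts c c (ltrans (\<iota> u))) u0 = FD (\<lambda>v. pmul (u, v)) u0"
  proof (rule FD_eq[OF has_derivative_transform_within_open[OF _ X_open u0_X]])
    show "((\<lambda>v. pmul (u, v)) has_derivative FD (\<lambda>v. pmul (u, v)) u0) (at u0)"
      using pmul_left_derivative[of u u0] u FD_eq by fastforce
    show "pmul (u, v) = in_charts c c (ltrans (\<iota> u)) v" if "v \<in> X" for v
      using that by (simp add: in_charts_def ltrans_def pmul_def)
  qed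
  moreover have "ltrans (\<iota> u) (\<iota> u0) = \<iota> u" using u by (simp add: ltrans_def)
  ultimately show ?thesis
    using isometry(4)[OF ltrans_isometry c c u0_X, of "\<iota> u" a b] u by (simp add: Lam_def)
qed

text \<open>\<open>Linv u\<close> inverts \<open>Lam u\<close>: by left invariance the coordinates of a vector in the frame \<open>Lam u e\<close>
  are its inner products with the frame. This makes its differentiability in \<open>u\<close> evident.\<close>

definition frame :: "'v set" where
  "frame = (SOME E. finite E \<and> (\<forall>x. x = (\<Sum>e\<in>E. (ip e e * ip x e) *\<^sub>R e)))"

lemma frame: "finite frame" "x = (\<Sum>e\<in>frame. (ip e e * ip x e) *\<^sub>R e)"
  using someI_ex[OF signature_expansion[OF ip_form(2,3)]] unfolding frame_def by blast+

definition Linv :: "'v \<Rightarrow> 'v \<Rightarrow> 'v" where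
  "Linv u z = (\<Sum>e\<in>frame. (ip e e * g c u z (Lam u e)) *\<^sub>R e)"

lemma Linv_Lam: "u \<in> X \<Longrightarrow> Linv u (Lam u a) = a"
  unfolding Linv_def by (simp add: Lam_isometry frame(2)[symmetric])

lemma Lam_Linv: "u \<in> X \<Longrightarrow> Lam u (Linv u z) = z"
proof -
  assume u: "u \<in> X"
  have "inj (Lam u)" using Linv_Lam[OF u] by (metis injI)
  then have "surj (Lam u)" using linear_injective_imp_surjective Lam_linear[OF u] by blast
  then obtain a where "z = Lam u a" by blast
  then show ?thesis using Linv_Lam[OF u] by simp
qed

lemma Linv_differentiable:
  assumes "\<psi> x \<in> X" and \<psi>: "(\<psi> has_derivative \<psi>') (at x)" and a: "(a has_derivative a') (at x)"
  shows "(\<lambda>z. Linv (\<psi> z) (a z)) differentiable (at (x :: 'e::euclidean_space))"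
proof -
  have "(\<lambda>z. g c (\<psi> z) (a z) (Lam (\<psi> z) e)) differentiable (at x)" for e
    using has_derivative_form[OF X_open assms(1) metric_form(3)[OF c] metric_form(5)[OF c assms(1)] \<psi> a
        Lam_family_derivative[OF assms(1) \<psi> has_derivative_const]] unfolding differentiable_def by blast
  then show ?thesis unfolding Linv_def
    by (intro differentiable_sum frame(1) ballI differentiable_scaleR differentiable_const differentiable_mult)
qed

lemma ip_nondegenerate: "(\<And>y. ip x y = 0) \<Longrightarrow> x = 0"
  by (subst frame(2)) simp

text \<open>Differentiate \<open>f (x y) = f x h y\<close> in \<open>y\<close> at the identity. With
  \<open>h\<close> the identity this treats left translations, with \<open>h = f\<close>
  automorphisms, and in general isometries that normalize the left translations.\<close>

lemma intertwine:
  assumes f: "\<And>x y. x \<in> carrier N \<Longrightarrow> y \<in> carrier N \<Longrightarrow> f (x \<otimes>\<^bsub>N\<^esub> y) = f x \<otimes>\<^bsub>N\<^esub> h y"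
    and h1: "h \<one>\<^bsub>N\<^esub> = \<one>\<^bsub>N\<^esub>"
    and U: "open U" "U \<subseteq> X" "\<And>v. v \<in> U \<Longrightarrow> f (\<iota> v) \<in> fst c" "smooth_on UNIV U (\<lambda>u. snd c (f (\<iota> u)))"
    and W: "open W" "u0 \<in> W" "W \<subseteq> X" "\<And>v. v \<in> W \<Longrightarrow> h (\<iota> v) \<in> fst c" "smooth_on UNIV W (\<lambda>u. snd c (h (\<iota> u)))"
    and v: "v \<in> U"
  shows "FD (\<lambda>u. snd c (f (\<iota> u))) v (Lam v b) = Lam (snd c (f (\<iota> v))) (FD (\<lambda>u. snd c (h (\<iota> u))) u0 b)"
proof -
  let ?\<psi> = "\<lambda>u. snd c (f (\<iota> u))" and ?\<eta> = "\<lambda>u. snd c (h (\<iota> u))"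
  have vX: "v \<in> X" using v U by blast
  have \<psi>v: "?\<psi> v \<in> X" using U(3)[OF v] by blast
  have \<eta>0: "?\<eta> u0 = u0" by (simp add: h1)
  note dp = pmul_left_derivative[OF S_u0(1)[OF vX]]
  have "isCont (\<lambda>w. pmul (v, w)) u0" using dp has_derivative_continuous by blast
  then have "((\<lambda>w. pmul (v, w)) \<longlongrightarrow> v) (nhds u0)" using vX by (simp add: continuous_at tendsto_nhds_iff)
  then have e1: "\<forall>\<^sub>F w in nhds u0. pmul (v, w) \<in> U" using U(1) v topological_tendstoD by blast
  have "((\<lambda>w. (v, w)) \<longlongrightarrow> (v, u0)) (nhds u0)" by (intro tendsto_Pair tendsto_const filterlim_ident)
  then have e2: "\<forall>\<^sub>F w in nhds u0. (v, w) \<in> S" using S_open S_u0(1)[OF vX] topological_tendstoD by blast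
  have e3: "\<forall>\<^sub>F w in nhds u0. w \<in> W" using W(1,2) eventually_nhds_in_open by blast
  have ev: "\<forall>\<^sub>F w in nhds u0. ?\<psi> (pmul (v, w)) = pmul (?\<psi> v, ?\<eta> w)"
    using e1 e2 e3
  proof eventually_elim
    case (elim w)
    then have w: "w \<in> X" "\<iota> v \<otimes>\<^bsub>N\<^esub> \<iota> w \<in> fst c" by (auto simp: S_def)
    have "?\<psi> (pmul (v, w)) = snd c (f (\<iota> v) \<otimes>\<^bsub>N\<^esub> h (\<iota> w))"
      using \<iota>_pmul[OF elim(2)] f[of "\<iota> v" "\<iota> w"] vX w by simp
    then show ?case using U(3)[OF v] W(4)[OF elim(3)] by (simp add: pmul_def)
  qed
  have d1: "((\<lambda>w. ?\<psi> (pmul (v, w))) has_derivative (\<lambda>b. FD ?\<psi> v (FD pmul (v, u0) (0, b)))) (at u0)"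
    using has_derivative_compose[OF dp, of ?\<psi>] smooth_on_has_derivative[OF U(4) v] vX by simp
  have "((\<lambda>w. pmul (?\<psi> v, ?\<eta> w)) has_derivative (\<lambda>b. FD pmul (?\<psi> v, u0) (0, FD ?\<eta> u0 b))) (at u0)"
    using has_derivative_compose[OF smooth_on_has_derivative[OF W(5,2)], of "\<lambda>w. pmul (?\<psi> v, w)"]
      pmul_left_derivative[OF S_u0(1)[OF \<psi>v]] by (simp add: h1)
  then have d2: "((\<lambda>w. ?\<psi> (pmul (v, w))) has_derivative (\<lambda>b. FD pmul (?\<psi> v, u0) (0, FD ?\<eta> u0 b))) (at u0)"
    by (rule has_derivative_transform_eventually)
       (use ev eventually_nhds_x_imp_x[OF ev] in \<open>auto simp: eventually_at_filter elim: eventually_mono\<close>)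
  show ?thesis using fun_cong[OF has_derivative_unique[OF d1 d2], of b]
    by (simp add: Lam_eq[OF vX] Lam_eq[OF \<psi>v])
qed

text \<open>Brackets of related fields are related. Differentiating the relation \<open>rel\<close>
  along the group gives, besides the wanted terms, a second derivative of \<open>\<psi>\<close>,
  which drops out on antisymmetrizing in \<open>a\<close> and \<open>b\<close>.\<close>

lemma intertwine_br:
  assumes U: "open U" "u0 \<in> U" "U \<subseteq> X" "\<psi> ` U \<subseteq> X" "smooth_on UNIV U \<psi>"
    and rel: "\<And>v b. v \<in> U \<Longrightarrow> FD \<psi> v (Lam v b) = Lam (\<psi> v) (A b)"
  shows "FD \<psi> u0 (br a b) = FD (\<lambda>u. Lam u (A b)) (\<psi> u0) (Lam (\<psi> u0) (A a))
    - FD (\<lambda>u. Lam u (A a)) (\<psi> u0) (Lam (\<psi> u0) (A b))"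
proof -
  have \<psi>0: "\<psi> u0 \<in> X" using U by blast
  note d\<psi> = smooth_on_has_derivative[OF U(5,2)]
  have half: "FD (\<lambda>v. FD \<psi> v b) u0 a + FD \<psi> u0 (dLam a b) = FD (\<lambda>u. Lam u (A b)) (\<psi> u0) (Lam (\<psi> u0) (A a))" for a b
  proof -
    have lin: "\<forall>\<^sub>F z in nhds u0. linear (FD \<psi> z)"
      by (rule eventually_mono[OF eventually_nhds_in_open[OF U(1,2)] smooth_on_linear[OF U(5)]])
    have "(\<lambda>z. FD \<psi> z v) differentiable (at u0)" for v
      using smooth_on_has_derivative[OF smooth_on_FD[OF U(1,5)] U(2)] unfolding differentiable_def by blast
    from has_derivative_linear_family[OF lin this Lam_has_derivative[OF u0_X, of b]]
    have 1: "((\<lambda>v. FD \<psi> v (Lam v b)) has_derivative (\<lambda>a. FD (\<lambda>v. FD \<psi> v b) u0 a + FD \<psi> u0 (dLam a b))) (at u0)"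
      by (simp add: dLam_def)
    have "((\<lambda>v. Lam (\<psi> v) (A b)) has_derivative (\<lambda>a. FD (\<lambda>u. Lam u (A b)) (\<psi> u0) (FD \<psi> u0 a))) (at u0)"
      by (rule has_derivative_compose[OF d\<psi> Lam_has_derivative[OF \<psi>0]])
    then have 2: "((\<lambda>v. FD \<psi> v (Lam v b)) has_derivative (\<lambda>a. FD (\<lambda>u. Lam u (A b)) (\<psi> u0) (FD \<psi> u0 a))) (at u0)"
      by (rule has_derivative_transform_within_open[OF _ U(1,2)]) (simp add: rel)
    show ?thesis using fun_cong[OF has_derivative_unique[OF 1 2], of a] rel[OF U(2), of a] by simp
  qed
  have "FD \<psi> u0 (br a b) = FD \<psi> u0 (dLam a b) - FD \<psi> u0 (dLam b a)"
    unfolding br_eq by (rule linear_diff[OF has_derivative_linear[OF d\<psi>]])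
  then show ?thesis
    unfolding half[of a b, symmetric] half[of b a, symmetric] FD_FD_symmetric[OF U(1,5,2), of a b] by simp
qed

text \<open>The bracket is defined at the identity only. Left translation by
  \<open>\<iota> u\<close> relates every left-invariant field to itself and so transports the
  bracket to \<open>u\<close>.\<close>

lemma left_invariant_fields_br:
  assumes u: "u \<in> X"
  shows "FD (\<lambda>u. Lam u b) u (Lam u a) - FD (\<lambda>u. Lam u a) u (Lam u b) = Lam u (br a b)"
proof -
  let ?U = "{v. (u, v) \<in> S}"
  have "?U = Pair u -` S" by auto
  then have oU: "open ?U" using S_open by (simp add: open_vimage continuous_on_Pair)
  have UX: "?U \<subseteq> X" by (auto simp: S_def)
  have sm: "smooth_on UNIV ?U (\<lambda>v. pmul (u, v))"
    by (rule smooth_on_compose[OF oU S_open smooth_Pair_const(2) pmul_smooth]) auto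
  have rel: "FD (\<lambda>v. pmul (u, v)) v (Lam v b) = Lam (pmul (u, v)) b" if v: "v \<in> ?U" for v b
  proof -
    have eq: "(\<lambda>v. snd c (\<iota> u \<otimes>\<^bsub>N\<^esub> \<iota> v)) = (\<lambda>v. pmul (u, v))" by (simp add: pmul_def)
    have idd: "FD (\<lambda>v. snd c (\<iota> v)) u0 b = b" by (rule FD_identity[OF X_open u0_X]) simp
    have "smooth_on UNIV X (\<lambda>v. snd c (\<iota> v))"
      by (rule smooth_on_cong_open[OF X_open _ smooth_on_bounded_linear[OF bounded_linear_ident]]) simp
    from intertwine[of "\<lambda>x. \<iota> u \<otimes>\<^bsub>N\<^esub> x" "\<lambda>x. x" ?U X v b, unfolded eq idd, OF _ _ oU UX _ sm X_open u0_X _ _ this v]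
    show ?thesis using u by (simp add: N.m_assoc S_def pmul_def)
  qed
  have "FD (\<lambda>v. pmul (u, v)) u0 (br a b) = FD (\<lambda>u. Lam u b) (pmul (u, u0)) (Lam (pmul (u, u0)) a)
    - FD (\<lambda>u. Lam u a) (pmul (u, u0)) (Lam (pmul (u, u0)) b)"
    by (rule intertwine_br[OF oU _ UX _ sm rel]) (use u pmul_X in auto)
  then show ?thesis using u by (simp add: Lam_def)
qed

lemma automorphism_br:
  assumes h: "\<And>x y. x \<in> carrier N \<Longrightarrow> y \<in> carrier N \<Longrightarrow> h (x \<otimes>\<^bsub>N\<^esub> y) = h x \<otimes>\<^bsub>N\<^esub> h y"
    and h1: "h \<one>\<^bsub>N\<^esub> = \<one>\<^bsub>N\<^esub>"
    and U: "open U" "u0 \<in> U" "U \<subseteq> X" "\<And>v. v \<in> U \<Longrightarrow> h (\<iota> v) \<in> fst c" "smooth_on UNIV U (\<lambda>u. snd c (h (\<iota> u)))"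
  defines "A \<equiv> FD (\<lambda>u. snd c (h (\<iota> u))) u0"
  shows "A (br a b) = br (A a) (A b)"
proof -
  note rel = intertwine[of h h U U, OF h h1 U(1,3-5) U]
  have "FD (\<lambda>u. snd c (h (\<iota> u))) u0 (br a b)
    = FD (\<lambda>u. Lam u (A b)) (snd c (h (\<iota> u0))) (Lam (snd c (h (\<iota> u0))) (A a))
    - FD (\<lambda>u. Lam u (A a)) (snd c (h (\<iota> u0))) (Lam (snd c (h (\<iota> u0))) (A b))"
    unfolding A_def by (rule intertwine_br[OF U(1-3) _ U(5) rel]) (use U(4) in auto)
  then show ?thesis by (simp add: h1 br_eq dLam_def A_def)
qed


subsection \<open>The adjoint action and the lower central series\<close>

definition conj_map :: "'g \<Rightarrow> 'g \<Rightarrow> 'g" where "conj_map x y = inv\<^bsub>N\<^esub> x \<otimes>\<^bsub>N\<^esub> (y \<otimes>\<^bsub>N\<^esub> x)"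

text \<open>The adjoint action of \<open>(\<iota> u)\<^sup>-\<^sup>1\<close>. With the inverse, \<open>Lam u (Adi u b) = Rho u b\<close> expresses it by
  \<open>Linv\<close>, so that differentiating it needs no smoothness of inversion.\<close>

definition Adi :: "'v \<Rightarrow> 'v \<Rightarrow> 'v" where "Adi u b = FD (\<lambda>w. snd c (conj_map (\<iota> u) (\<iota> w))) u0 b"

lemma conj_map_chart:
  assumes u: "u \<in> X"
  shows "\<exists>U. open U \<and> u0 \<in> U \<and> U \<subseteq> X \<and> (\<forall>w\<in>U. conj_map (\<iota> u) (\<iota> w) \<in> fst c) \<and>
    smooth_on UNIV U (\<lambda>w. snd c (conj_map (\<iota> u) (\<iota> w)))"
proof -
  let ?x = "\<iota> u"
  have ix: "inv\<^bsub>N\<^esub> ?x \<in> carrier N" using u by simp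
  \<comment> \<open>The inverse of \<open>\<iota> u\<close> may lie outside the chart, so
    multiplication by it is handled as a globally smooth isometry and not by
    \<open>pmul\<close>.\<close>
  let ?V = "{v \<in> X. ltrans (inv\<^bsub>N\<^esub> ?x) (\<iota> v) \<in> fst c}"
  note L = smooth_map_in_charts[OF fm fm isometry(1)[OF ltrans_isometry[OF ix]] c c]
  have lt: "ltrans (inv\<^bsub>N\<^esub> ?x) (\<iota> v) = inv\<^bsub>N\<^esub> ?x \<otimes>\<^bsub>N\<^esub> \<iota> v" if "v \<in> X" for v
    using that by (simp add: ltrans_def)
  let ?W = "{w. (w, u) \<in> S}"
  have "?W = (\<lambda>w. (w, u)) -` S" by auto
  then have oW: "open ?W" using S_open by (simp add: open_vimage continuous_on_Pair)
  have sW: "smooth_on UNIV ?W (\<lambda>w. pmul (w, u))"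
    by (rule smooth_on_compose[OF oW S_open smooth_Pair_const(1) pmul_smooth]) auto
  let ?U = "{w \<in> ?W. pmul (w, u) \<in> ?V}"
  have "open ((\<lambda>w. pmul (w, u)) -` ?V \<inter> ?W)"
    using continuous_on_open_vimage[OF oW] smooth_on_continuous[OF sW] L(1) by blast
  moreover have "?U = (\<lambda>w. pmul (w, u)) -` ?V \<inter> ?W" by auto
  ultimately have oU: "open ?U" by simp
  have val: "conj_map ?x (\<iota> w) = ltrans (inv\<^bsub>N\<^esub> ?x) (\<iota> (pmul (w, u)))" if "w \<in> ?U" for w
    using that lt[of "pmul (w, u)"] \<iota>_pmul[of "(w, u)"] by (simp add: conj_map_def)
  have "smooth_on UNIV ?U (\<lambda>w. in_charts c c (ltrans (inv\<^bsub>N\<^esub> ?x)) (pmul (w, u)))"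
    by (rule smooth_on_compose[OF oU L(1) smooth_on_subset[OF sW] L(2)]) auto
  then have "smooth_on UNIV ?U (\<lambda>w. snd c (conj_map ?x (\<iota> w)))"
    by (rule smooth_on_cong_open[OF oU, rotated]) (simp add: val in_charts_def)
  moreover have "conj_map ?x (\<iota> w) \<in> fst c" if "w \<in> ?U" for w using val[OF that] that by simp
  moreover have "u0 \<in> ?U" using u one_c by (simp add: lt)
  moreover have "?U \<subseteq> X" by (auto simp: S_def)
  ultimately show ?thesis using oU by blast
qed

lemma Lam_Adi:
  assumes u: "u \<in> X"
  shows "Lam u (Adi u b) = Rho u b"
proof -
  let ?\<kappa> = "\<lambda>w. snd c (conj_map (\<iota> u) (\<iota> w))"
  obtain U where U: "open U" "u0 \<in> U" "U \<subseteq> X" "\<forall>w\<in>U. conj_map (\<iota> u) (\<iota> w) \<in> fst c" "smooth_on UNIV U ?\<kappa>"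
    using conj_map_chart[OF u] by blast
  have k0: "?\<kappa> u0 = u0" using u by (simp add: conj_map_def)
  have d1: "((\<lambda>w. pmul (u, ?\<kappa> w)) has_derivative (\<lambda>b. FD pmul (u, u0) (0, Adi u b))) (at u0)"
    using has_derivative_compose[OF smooth_on_has_derivative[OF U(5,2)], of "\<lambda>w. pmul (u, w)"]
      pmul_left_derivative[OF S_u0(1)[OF u]] k0 by (simp add: Adi_def)
  have "((\<lambda>w. pmul (w, u)) has_derivative (\<lambda>b. FD pmul (u0, u) (b, 0))) (at u0)"
    by (rule pmul_right_derivative[OF S_u0(2)[OF u]])
  then have d2: "((\<lambda>w. pmul (u, ?\<kappa> w)) has_derivative (\<lambda>b. FD pmul (u0, u) (b, 0))) (at u0)"
  proof (rule has_derivative_transform_within_open[OF _ U(1,2)])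
    fix w assume w: "w \<in> U"
    then have wX: "w \<in> X" using U(3) by blast
    have "\<iota> (?\<kappa> w) = conj_map (\<iota> u) (\<iota> w)" using U(4) w by simp
    then have "\<iota> u \<otimes>\<^bsub>N\<^esub> \<iota> (?\<kappa> w) = \<iota> w \<otimes>\<^bsub>N\<^esub> \<iota> u"
      using wX u by (simp add: conj_map_def N.m_assoc[symmetric])
    then show "pmul (w, u) = pmul (u, ?\<kappa> w)" by (simp add: pmul_def)
  qed
  show ?thesis using fun_cong[OF has_derivative_unique[OF d1 d2], of b] by (simp add: Lam_eq[OF u] Rho_eq[OF u])
qed

lemma Adi_Linv: "u \<in> X \<Longrightarrow> Adi u b = Linv u (Rho u b)"
  using Linv_Lam[of u "Adi u b"] Lam_Adi by simp

lemma Adi_br: "u \<in> X \<Longrightarrow> Adi u (br a b) = br (Adi u a) (Adi u b)"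
proof -
  assume u: "u \<in> X"
  obtain U where U: "open U" "u0 \<in> U" "U \<subseteq> X" "\<And>w. w\<in>U \<Longrightarrow> conj_map (\<iota> u) (\<iota> w) \<in> fst c"
    "smooth_on UNIV U (\<lambda>w. snd c (conj_map (\<iota> u) (\<iota> w)))"
    using conj_map_chart[OF u] by blast
  show ?thesis unfolding Adi_def
  proof (rule automorphism_br[OF _ _ U])
    fix x y assume xy: "x \<in> carrier N" "y \<in> carrier N"
    have "inv\<^bsub>N\<^esub> \<iota> u \<otimes>\<^bsub>N\<^esub> (x \<otimes>\<^bsub>N\<^esub> y \<otimes>\<^bsub>N\<^esub> \<iota> u)
      = inv\<^bsub>N\<^esub> \<iota> u \<otimes>\<^bsub>N\<^esub> (x \<otimes>\<^bsub>N\<^esub> (\<iota> u \<otimes>\<^bsub>N\<^esub> inv\<^bsub>N\<^esub> \<iota> u) \<otimes>\<^bsub>N\<^esub> y \<otimes>\<^bsub>N\<^esub> \<iota> u)"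
      using xy u by simp
    also have "\<dots> = inv\<^bsub>N\<^esub> \<iota> u \<otimes>\<^bsub>N\<^esub> (x \<otimes>\<^bsub>N\<^esub> \<iota> u) \<otimes>\<^bsub>N\<^esub> (inv\<^bsub>N\<^esub> \<iota> u \<otimes>\<^bsub>N\<^esub> (y \<otimes>\<^bsub>N\<^esub> \<iota> u))"
      using xy u by (simp only: N.m_assoc N.m_closed N.inv_closed \<iota>_carrier)
    finally show "conj_map (\<iota> u) (x \<otimes>\<^bsub>N\<^esub> y) = conj_map (\<iota> u) x \<otimes>\<^bsub>N\<^esub> conj_map (\<iota> u) y"
      by (simp add: conj_map_def)
  next
    show "conj_map (\<iota> u) \<one>\<^bsub>N\<^esub> = \<one>\<^bsub>N\<^esub>" using u by (simp add: conj_map_def)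
  qed
qed

lemma Adi_u0 [simp]: "Adi u0 b = b"
  by (simp add: Adi_Linv) (metis Lam_u0 Linv_Lam u0_X)

text \<open>Differentiate \<open>Lam u (Adi u b) = Rho u b\<close> at the identity:
  \<open>dLam h b\<close> plus the unknown derivative equals \<open>dLam b h\<close>. The minus sign
  reflects that \<open>Adi\<close> belongs to the inverse element.\<close>

lemma Adi_has_derivative: "((\<lambda>u. Adi u b) has_derivative (\<lambda>h. - br h b)) (at u0)"
proof -
  have dR: "((\<lambda>u. Rho u b) has_derivative FD (\<lambda>u. Rho u b) u0) (at u0)"
    by (rule smooth_on_has_derivative[OF Rho_smooth u0_X])
  have "(\<lambda>u. Linv u (Rho u b)) differentiable (at u0)"
    by (rule Linv_differentiable[OF u0_X has_derivative_ident dR])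
  then have "((\<lambda>u. Linv u (Rho u b)) has_derivative FD (\<lambda>u. Linv u (Rho u b)) u0) (at u0)"
    using frechet_derivative_works by blast
  then have dA: "((\<lambda>u. Adi u b) has_derivative FD (\<lambda>u. Linv u (Rho u b)) u0) (at u0)"
    by (rule has_derivative_transform_within_open[OF _ X_open u0_X]) (simp add: Adi_Linv)
  \<comment> \<open>Both sides are mixed second derivatives of \<open>pmul\<close> at the identity,
    taken in opposite order.\<close>
  have R: "FD (\<lambda>u. Rho u b) u0 h = dLam b h" for h
  proof -
    have S0: "(u0, u0) \<in> S" by simp
    have "((\<lambda>u. FD pmul (u0, u) (b, 0)) has_derivative (\<lambda>h. FD (\<lambda>z. FD pmul z (b, 0)) (u0, u0) (0, h))) (at u0)"
      by (rule has_derivative_compose[OF has_derivative_Pair[OF has_derivative_const has_derivative_ident]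
        smooth_on_has_derivative[OF smooth_on_FD[OF S_open pmul_smooth] S0]])
    then have "((\<lambda>u. Rho u b) has_derivative (\<lambda>h. FD (\<lambda>z. FD pmul z (b, 0)) (u0, u0) (0, h))) (at u0)"
      by (rule has_derivative_transform_within_open[OF _ X_open u0_X]) (simp add: Rho_eq)
    then have 1: "FD (\<lambda>u. Rho u b) u0 h = FD (\<lambda>z. FD pmul z (b, 0)) (u0, u0) (0, h)" by (rule FD_apply)
    have "((\<lambda>u. FD pmul (u, u0) (0, h)) has_derivative (\<lambda>a. FD (\<lambda>z. FD pmul z (0, h)) (u0, u0) (a, 0))) (at u0)"
      by (rule has_derivative_compose[OF has_derivative_Pair[OF has_derivative_ident has_derivative_const]
        smooth_on_has_derivative[OF smooth_on_FD[OF S_open pmul_smooth] S0]])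
    then have "((\<lambda>u. Lam u h) has_derivative (\<lambda>a. FD (\<lambda>z. FD pmul z (0, h)) (u0, u0) (a, 0))) (at u0)"
      by (rule has_derivative_transform_within_open[OF _ X_open u0_X]) (simp add: Lam_eq)
    then have 2: "dLam b h = FD (\<lambda>z. FD pmul z (0, h)) (u0, u0) (b, 0)" unfolding dLam_def by (rule FD_apply)
    show ?thesis unfolding 1 2 by (rule FD_FD_symmetric[OF S_open pmul_smooth S0])
  qed
  have "((\<lambda>u. Lam u (Adi u b)) has_derivative
      (\<lambda>h. dLam h b + FD (\<lambda>u. Linv u (Rho u b)) u0 h)) (at u0)"
    using Lam_family_derivative[OF u0_X has_derivative_ident dA] by (simp add: dLam_def)
  then have "((\<lambda>u. Rho u b) has_derivative (\<lambda>h. dLam h b + FD (\<lambda>u. Linv u (Rho u b)) u0 h)) (at u0)"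
    by (rule has_derivative_transform_within_open[OF _ X_open u0_X]) (simp add: Lam_Adi)
  then have "FD (\<lambda>u. Rho u b) u0 h = dLam h b + FD (\<lambda>u. Linv u (Rho u b)) u0 h" for h by (rule FD_apply)
  then have "FD (\<lambda>u. Linv u (Rho u b)) u0 h = - br h b" for h by (simp add: R br_eq algebra_simps)
  then have "FD (\<lambda>u. Linv u (Rho u b)) u0 = (\<lambda>h. - br h b)" by (rule ext)
  then show ?thesis using dA by (simp only:)
qed

text \<open>Each \<open>Adi u\<close> respects the bracket; differentiating this at the identity
  says that \<open>ad h\<close> is a derivation, which is the Jacobi identity.\<close>

lemma lie_algebra_br: "lie_algebra UNIV br"
proof -
  have self: "br a a = 0" for a by (simp add: br_eq)
  have swap: "br a b = - br b a" for a b by (simp add: br_eq)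
  have jac: "br h (br a b) = br (br h a) b + br a (br h b)" for h a b
  proof -
    have "((\<lambda>u. br (Adi u a) (Adi u b)) has_derivative (\<lambda>h. br (Adi u0 a) (- br h b) + br (- br h a) (Adi u0 b))) (at u0)"
      by (rule br.FDERIV[OF Adi_has_derivative Adi_has_derivative])
    then have "((\<lambda>u. Adi u (br a b)) has_derivative (\<lambda>h. br (Adi u0 a) (- br h b) + br (- br h a) (Adi u0 b))) (at u0)"
      by (rule has_derivative_transform_within_open[OF _ X_open u0_X]) (simp add: Adi_br)
    from arg_cong[OF fun_cong[OF has_derivative_unique[OF this Adi_has_derivative], of h], of uminus]
    show ?thesis by (simp add: br.minus_left br.minus_right)
  qed
  have "br x (br y z) + br y (br z x) + br z (br x y) = 0" for x y z
  proof -
    have a: "br y (br z x) = - br y (br x z)" unfolding swap[of z x] br.minus_right ..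
    have b: "br z (br x y) = - br (br x y) z" by (rule swap)
    show ?thesis unfolding jac[of x y z] a b by simp
  qed
  then show ?thesis using self
    by (simp add: lie_algebra_def br.add_left br.add_right br.scaleR_left br.scaleR_right)
qed


section \<open>Tangent vectors of subgroups, and nilpotency of the Lie algebra\<close>

text \<open>The value of \<open>snd c\<close> outside \<open>fst c\<close> is arbitrary, hence the condition that the curve stays in the chart.\<close>

definition identity_curve :: "(real \<Rightarrow> 'g) \<Rightarrow> 'v \<Rightarrow> bool" where
  "identity_curve \<gamma> a \<longleftrightarrow> \<gamma> 0 = \<one>\<^bsub>N\<^esub> \<and> (\<forall>\<^sub>F t in nhds 0. \<gamma> t \<in> fst c) \<and>
     ((\<lambda>t. snd c (\<gamma> t)) has_vector_derivative a) (at 0)"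

text \<open>Velocities at the identity of curves in \<open>K\<close> that need to be differentiable
  only at 0. This makes sense for abstract subgroups, as the terms of the lower central series are
  not assumed to be closed or to be submanifolds.\<close>

definition tangent :: "'g set \<Rightarrow> 'v set" where
  "tangent K = {a. \<exists>\<gamma>. (\<forall>t. \<gamma> t \<in> K) \<and> identity_curve \<gamma> a}"

lemma tangentI: "identity_curve \<gamma> a \<Longrightarrow> (\<And>t. \<gamma> t \<in> K) \<Longrightarrow> a \<in> tangent K"
  unfolding tangent_def by (rule CollectI, rule exI[of _ \<gamma>]) simp

lemma tangentE:
  assumes "a \<in> tangent K"
  obtains \<gamma> where "identity_curve \<gamma> a" "\<And>t. \<gamma> t \<in> K"
  using assms unfolding tangent_def by blast

lemma identity_curve_tendsto:
  assumes "identity_curve \<gamma> a"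
  shows "((\<lambda>t. snd c (\<gamma> t)) \<longlongrightarrow> u0) (nhds 0)"
proof -
  have "isCont (\<lambda>t. snd c (\<gamma> t)) 0"
    using assms has_vector_derivative_continuous unfolding identity_curve_def by blast
  then show ?thesis using assms by (simp add: continuous_at tendsto_nhds_iff identity_curve_def)
qed

lemma identity_curve_map:
  assumes \<gamma>: "identity_curve \<gamma> a" and U: "open U" "u0 \<in> U" "\<And>u. u \<in> U \<Longrightarrow> f (\<iota> u) \<in> fst c"
    and f: "((\<lambda>u. snd c (f (\<iota> u))) has_derivative f') (at u0)" and f1: "f \<one>\<^bsub>N\<^esub> = \<one>\<^bsub>N\<^esub>"
  shows "identity_curve (\<lambda>t. f (\<gamma> t)) (f' a)"
proof -
  note g = \<gamma>[unfolded identity_curve_def]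
  have eU: "\<forall>\<^sub>F t in nhds 0. snd c (\<gamma> t) \<in> U"
    using identity_curve_tendsto[OF \<gamma>] U(1,2) topological_tendstoD by blast
  have e: "\<forall>\<^sub>F t in nhds 0. f (\<gamma> t) \<in> fst c"
    using eU g[THEN conjunct2, THEN conjunct1]
  proof eventually_elim
    case (elim t)
    then show ?case using U(3)[OF elim(1)] by simp
  qed
  have "((\<lambda>t. snd c (f (\<iota> (snd c (\<gamma> t))))) has_derivative (\<lambda>h. f' (h *\<^sub>R a))) (at 0)"
    using has_derivative_compose[of "\<lambda>t. snd c (\<gamma> t)" "\<lambda>h. h *\<^sub>R a" 0 UNIV "\<lambda>u. snd c (f (\<iota> u))" f'] g f
    by (simp add: has_vector_derivative_def)
  then have "((\<lambda>t. snd c (f (\<iota> (snd c (\<gamma> t))))) has_vector_derivative f' a) (at 0)"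
    using linear_scale[OF has_derivative_linear[OF f]] by (simp add: has_vector_derivative_def)
  then have "((\<lambda>t. snd c (f (\<gamma> t))) has_vector_derivative f' a) (at 0)"
    by (rule has_vector_derivative_transform_nhds) (use g in \<open>auto elim!: eventually_mono\<close>)
  then show ?thesis using e g f1 by (simp add: identity_curve_def)
qed

text \<open>At the identity the differential of multiplication is addition, being the sum of
  \<open>Rho u0\<close> and \<open>Lam u0\<close>.\<close>

lemma identity_curve_mult:
  assumes \<gamma>: "identity_curve \<gamma> a" and \<delta>: "identity_curve \<delta> b"
  shows "identity_curve (\<lambda>t. \<gamma> t \<otimes>\<^bsub>N\<^esub> \<delta> t) (a + b)"
proof -
  note g = \<gamma>[unfolded identity_curve_def] and d = \<delta>[unfolded identity_curve_def]
  let ?f = "\<lambda>t. (snd c (\<gamma> t), snd c (\<delta> t))"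
  have df: "(?f has_derivative (\<lambda>h. (h *\<^sub>R a, h *\<^sub>R b))) (at 0)"
    using g d by (auto simp: has_vector_derivative_def intro: has_derivative_Pair)
  have S00: "(u0, u0) \<in> S" by simp
  have "(?f \<longlongrightarrow> (u0, u0)) (nhds 0)"
    by (intro tendsto_Pair identity_curve_tendsto[OF \<gamma>] identity_curve_tendsto[OF \<delta>])
  then have eS: "\<forall>\<^sub>F t in nhds 0. ?f t \<in> S" using S_open S00 topological_tendstoD by blast
  have ev: "\<forall>\<^sub>F t in nhds 0. \<gamma> t \<otimes>\<^bsub>N\<^esub> \<delta> t \<in> fst c \<and> pmul (?f t) = snd c (\<gamma> t \<otimes>\<^bsub>N\<^esub> \<delta> t)"
    using eS g[THEN conjunct2, THEN conjunct1] d[THEN conjunct2, THEN conjunct1]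
    by eventually_elim (simp add: S_def pmul_def)
  have lin: "FD pmul (u0, u0) (h *\<^sub>R a, h *\<^sub>R b) = h *\<^sub>R (a + b)" for h
  proof -
    have "FD pmul (u0, u0) ((h *\<^sub>R a, 0) + (0, h *\<^sub>R b)) = Rho u0 (h *\<^sub>R a) + Lam u0 (h *\<^sub>R b)"
      by (simp only: linear_add[OF smooth_on_linear[OF pmul_smooth S00]] Lam_eq[OF u0_X] Rho_eq[OF u0_X])
    then show ?thesis by (simp add: scaleR_add_right)
  qed
  have "((\<lambda>t. pmul (?f t)) has_derivative (\<lambda>h. FD pmul (u0, u0) (h *\<^sub>R a, h *\<^sub>R b))) (at 0)"
    using has_derivative_compose[OF df, of pmul "FD pmul (u0, u0)"] pmul_has_derivative[OF S00] g d by simp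
  then have "((\<lambda>t. pmul (?f t)) has_vector_derivative (a + b)) (at 0)"
    by (simp only: lin has_vector_derivative_def)
  then have "((\<lambda>t. snd c (\<gamma> t \<otimes>\<^bsub>N\<^esub> \<delta> t)) has_vector_derivative (a + b)) (at 0)"
    by (rule has_vector_derivative_transform_nhds) (use ev in \<open>auto elim: eventually_mono\<close>)
  then show ?thesis using ev g d by (auto simp: identity_curve_def elim: eventually_mono)
qed

text \<open>Inversion is differentiable in the chart; its differential is then read off from the
  constant product of \<open>\<gamma>\<close> with its inverse.\<close>

lemma identity_curve_inv:
  assumes \<gamma>: "identity_curve \<gamma> a" "\<And>t. \<gamma> t \<in> carrier N"
  shows "identity_curve (\<lambda>t. inv\<^bsub>N\<^esub> \<gamma> t) (- a)"
proof -
  let ?U = "{u \<in> X. inv\<^bsub>N\<^esub> \<iota> u \<in> fst c}" and ?i = "\<lambda>u. snd c (inv\<^bsub>N\<^esub> \<iota> u)"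
  note I = smooth_map_in_charts[OF fm fm inv_smooth c c]
  have U0: "u0 \<in> ?U" using one_c by simp
  have "in_charts c c (\<lambda>x. inv\<^bsub>N\<^esub> x) = ?i" by (simp add: in_charts_def o_def)
  then have "(?i has_derivative FD ?i u0) (at u0)" using smooth_on_has_derivative[OF I(2) U0] by simp
  from identity_curve_map[OF \<gamma>(1) I(1) U0 _ this]
  have i: "identity_curve (\<lambda>t. inv\<^bsub>N\<^esub> \<gamma> t) (FD ?i u0 a)" by simp
  have "identity_curve (\<lambda>t. \<gamma> t \<otimes>\<^bsub>N\<^esub> inv\<^bsub>N\<^esub> \<gamma> t) (a + FD ?i u0 a)"
    by (rule identity_curve_mult[OF \<gamma>(1) i])
  then have "((\<lambda>t::real. u0) has_vector_derivative (a + FD ?i u0 a)) (at 0)"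
    using \<gamma>(2) by (simp add: identity_curve_def)
  then have "a + FD ?i u0 a = 0"
    using vector_derivative_unique_at has_vector_derivative_const by blast
  then have "FD ?i u0 a = - a" by (simp add: add_eq_0_iff)
  then show ?thesis using i by simp
qed

lemma tangent_subspace:
  assumes K: "subgroup K N"
  shows "subspace (tangent K)"
proof (rule subspaceI)
  have "identity_curve (\<lambda>t. \<one>\<^bsub>N\<^esub>) 0" using one_c by (simp add: identity_curve_def)
  then show "0 \<in> tangent K" using subgroup.one_closed[OF K] by (rule tangentI)
next
  fix a b assume "a \<in> tangent K" "b \<in> tangent K"
  then show "a + b \<in> tangent K"
    by (elim tangentE) (rule tangentI[OF identity_curve_mult subgroup.m_closed[OF K]])
next
  fix r a assume "a \<in> tangent K"
  then obtain \<gamma> where \<gamma>: "\<And>t. \<gamma> t \<in> K" "identity_curve \<gamma> a" by (elim tangentE) blast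
  note g = \<gamma>(2)[unfolded identity_curve_def]
  have "((\<lambda>t. r * t) has_vector_derivative r) (at 0)" by (auto intro!: derivative_eq_intros)
  from vector_diff_chain_at[OF this, of "\<lambda>t. snd c (\<gamma> t)" a] g
  have "((\<lambda>t. snd c (\<gamma> (r * t))) has_vector_derivative r *\<^sub>R a) (at 0)" by (simp add: o_def)
  moreover have "((\<lambda>t. r * t) \<longlongrightarrow> 0) (nhds 0)"
    using tendsto_mult[OF tendsto_const[of r] filterlim_ident[of "nhds 0"]] by simp
  then have "\<forall>\<^sub>F t in nhds 0. \<gamma> (r * t) \<in> fst c"
    by (rule eventually_compose_filterlim[OF g[THEN conjunct2, THEN conjunct1]])
  ultimately have "identity_curve (\<lambda>t. \<gamma> (r * t)) (r *\<^sub>R a)" using g by (simp add: identity_curve_def)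
  then show "r *\<^sub>R a \<in> tangent K" using \<gamma>(1) by (rule tangentI)
qed

lemma lower_central_subgroup: "subgroup (group_lower_central N k) N"
proof (induction k)
  case 0
  show ?case by (simp add: N.subgroup_self)
next
  case (Suc k)
  have "{x \<otimes>\<^bsub>N\<^esub> y \<otimes>\<^bsub>N\<^esub> inv\<^bsub>N\<^esub> x \<otimes>\<^bsub>N\<^esub> inv\<^bsub>N\<^esub> y |x y.
       x \<in> carrier N \<and> y \<in> group_lower_central N k} \<subseteq> carrier N"
    using subgroup.mem_carrier[OF Suc] by auto
  then show ?case by (simp add: N.generate_is_subgroup)
qed

text \<open>The commutator of the fixed inverse of \<open>\<iota> u\<close> with a moving
  \<open>\<gamma> t\<close> runs in the next term of the series, and its velocity is
  \<open>Adi u a - a\<close>.\<close>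

lemma tangent_commutator:
  assumes "a \<in> tangent (group_lower_central N k)" and u: "u \<in> X"
  shows "Adi u a - a \<in> tangent (group_lower_central N (Suc k))"
proof -
  obtain \<gamma> where \<gamma>: "\<And>t. \<gamma> t \<in> group_lower_central N k" "identity_curve \<gamma> a"
    using assms(1) by (elim tangentE) blast
  have \<gamma>N: "\<gamma> t \<in> carrier N" for t using \<gamma>(1) subgroup.mem_carrier[OF lower_central_subgroup] by blast
  obtain U where U: "open U" "u0 \<in> U" "U \<subseteq> X" "\<And>w. w\<in>U \<Longrightarrow> conj_map (\<iota> u) (\<iota> w) \<in> fst c"
    "smooth_on UNIV U (\<lambda>w. snd c (conj_map (\<iota> u) (\<iota> w)))"
    using conj_map_chart[OF u] by blast
  have "identity_curve (\<lambda>t. conj_map (\<iota> u) (\<gamma> t)) (Adi u a)"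
    unfolding Adi_def
    by (rule identity_curve_map[OF \<gamma>(2) U(1,2,4) smooth_on_has_derivative[OF U(5,2)]])
       (use u in \<open>auto simp: conj_map_def\<close>)
  from identity_curve_mult[OF this identity_curve_inv[OF \<gamma>(2) \<gamma>N]]
  have "identity_curve (\<lambda>t. conj_map (\<iota> u) (\<gamma> t) \<otimes>\<^bsub>N\<^esub> inv\<^bsub>N\<^esub> \<gamma> t) (Adi u a - a)" by simp
  moreover have "conj_map (\<iota> u) (\<gamma> t) \<otimes>\<^bsub>N\<^esub> inv\<^bsub>N\<^esub> \<gamma> t \<in> group_lower_central N (Suc k)" for t
  proof -
    let ?x = "inv\<^bsub>N\<^esub> \<iota> u"
    have "conj_map (\<iota> u) (\<gamma> t) \<otimes>\<^bsub>N\<^esub> inv\<^bsub>N\<^esub> \<gamma> t = ?x \<otimes>\<^bsub>N\<^esub> \<gamma> t \<otimes>\<^bsub>N\<^esub> inv\<^bsub>N\<^esub> ?x \<otimes>\<^bsub>N\<^esub> inv\<^bsub>N\<^esub> \<gamma> t"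
      using u \<gamma>N by (simp add: conj_map_def N.m_assoc)
    moreover have "?x \<in> carrier N" using u by simp
    ultimately show ?thesis using \<gamma>(1)[of t] by (auto intro!: generate.incl)
  qed
  ultimately show ?thesis by (rule tangentI)
qed

text \<open>The commutator is differentiated in its second argument first, giving
  \<open>Adi u a - a\<close>, and now in \<open>u\<close>. A linear subspace contains the
  derivatives of curves that run in it.\<close>

lemma tangent_br:
  assumes a: "a \<in> tangent (group_lower_central N k)"
  shows "br h a \<in> tangent (group_lower_central N (Suc k))"
proof -
  let ?T = "tangent (group_lower_central N (Suc k))"
  have sT: "subspace ?T" by (rule tangent_subspace[OF lower_central_subgroup])
  define f where "f t = Adi (u0 + t *\<^sub>R h) a - a" for t :: real
  have dl: "((\<lambda>t::real. u0 + t *\<^sub>R h) has_derivative (\<lambda>t. t *\<^sub>R h)) (at 0)" by (auto intro!: derivative_eq_intros)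
  have "((\<lambda>t. Adi (u0 + t *\<^sub>R h) a) has_derivative (\<lambda>t. - br (t *\<^sub>R h) a)) (at 0)"
    using has_derivative_compose[OF dl, of "\<lambda>u. Adi u a"] Adi_has_derivative[of a] by simp
  then have "(f has_derivative (\<lambda>t. - br (t *\<^sub>R h) a - 0)) (at 0)"
    unfolding f_def by (rule has_derivative_diff[OF _ has_derivative_const])
  then have d: "(f has_vector_derivative (- br h a)) (at 0)"
    by (simp add: has_vector_derivative_def br.scaleR_left)
  have "isCont (\<lambda>t::real. u0 + t *\<^sub>R h) 0" by (intro continuous_intros)
  then have "((\<lambda>t::real. u0 + t *\<^sub>R h) \<longlongrightarrow> u0) (nhds 0)" by (simp add: continuous_at tendsto_nhds_iff)
  then have ev: "\<forall>\<^sub>F t in nhds 0. u0 + t *\<^sub>R h \<in> X" using X_open u0_X topological_tendstoD by blast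
  then obtain I where I: "open I" "(0::real) \<in> I" "\<And>t. t \<in> I \<Longrightarrow> u0 + t *\<^sub>R h \<in> X" unfolding eventually_nhds by blast
  have "- br h a \<in> ?T"
    by (rule vector_derivative_in_subspace[OF sT I(1,2) _ d]) (use tangent_commutator[OF a I(3)] in \<open>simp add: f_def\<close>)
  then show ?thesis using subspace_neg[OF sT] by fastforce
qed

lemma tangent_carrier: "a \<in> tangent (carrier N)"
proof -
  have "isCont (\<lambda>t::real. u0 + t *\<^sub>R a) 0" by (intro continuous_intros)
  then have "((\<lambda>t::real. u0 + t *\<^sub>R a) \<longlongrightarrow> u0) (nhds 0)" by (simp add: continuous_at tendsto_nhds_iff)
  then have ev: "\<forall>\<^sub>F t in nhds 0. u0 + t *\<^sub>R a \<in> X" using X_open u0_X topological_tendstoD by blast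
  define \<gamma> where "\<gamma> t = (if u0 + t *\<^sub>R a \<in> X then \<iota> (u0 + t *\<^sub>R a) else \<one>\<^bsub>N\<^esub>)" for t :: real
  have "((\<lambda>t::real. u0 + t *\<^sub>R a) has_vector_derivative a) (at 0)"
    by (auto intro!: derivative_eq_intros)
  then have "((\<lambda>t. snd c (\<gamma> t)) has_vector_derivative a) (at 0)"
    by (rule has_vector_derivative_transform_nhds) (use ev in \<open>auto elim!: eventually_mono simp: \<gamma>_def\<close>)
  then have "identity_curve \<gamma> a" using one_c by (simp add: identity_curve_def \<gamma>_def)
  moreover have "\<gamma> t \<in> carrier N" for t by (simp add: \<gamma>_def)
  ultimately show ?thesis by (rule tangentI)
qed

text \<open>Each Lie algebra term lies in the tangent space of the corresponding group term, and the
  trivial group has tangent space 0.\<close>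

lemma nilpotent_br:
  assumes "nilpotent_group N"
  shows "nilpotent_lie UNIV br"
proof -
  obtain k where k: "group_lower_central N k = {\<one>\<^bsub>N\<^esub>}" using assms by (auto simp: nilpotent_group_def)
  have incl: "lower_central UNIV br k \<subseteq> tangent (group_lower_central N k)" for k
  proof (induction k)
    case 0
    show ?case using tangent_carrier by auto
  next
    case (Suc k)
    have "{br x y |x y. x \<in> UNIV \<and> y \<in> lower_central UNIV br k} \<subseteq> tangent (group_lower_central N (Suc k))"
      using Suc tangent_br by blast
    then show ?case
      unfolding lower_central.simps using span_minimal tangent_subspace[OF lower_central_subgroup] by blast
  qed
  have "a = 0" if "a \<in> tangent {\<one>\<^bsub>N\<^esub>}" for a
  proof -
    obtain \<gamma> where \<gamma>: "identity_curve \<gamma> a" "\<And>t. \<gamma> t \<in> {\<one>\<^bsub>N\<^esub>}"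
      using \<open>a \<in> tangent {\<one>\<^bsub>N\<^esub>}\<close> by (elim tangentE) blast
    then have "\<gamma> = (\<lambda>t. \<one>\<^bsub>N\<^esub>)" by auto
    with \<gamma>(1) have "identity_curve (\<lambda>t. \<one>\<^bsub>N\<^esub>) a" by simp
    then have "((\<lambda>t::real. u0) has_vector_derivative a) (at 0)" by (simp add: identity_curve_def)
    then show ?thesis using vector_derivative_unique_at has_vector_derivative_const by blast
  qed
  then have "lower_central UNIV br k \<subseteq> {0}" using incl[of k] k by auto
  then have "lower_central UNIV br k = {0}" using subspace_0[OF lower_central_subspace[of UNIV br k]] by auto
  then show ?thesis by (auto simp: nilpotent_lie_def)
qed

end

lemma smooth_on_Pair:
  fixes f :: "'a::euclidean_space \<Rightarrow> 'b::euclidean_space" and h :: "'a \<Rightarrow> 'c::euclidean_space"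
  assumes "S \<subseteq> V" "smooth_on V S f" "smooth_on V S h"
  shows "smooth_on V S (\<lambda>x. (f x, h x))"
proof -
  have b: "bounded_linear (\<lambda>u :: 'b. (u, 0 :: 'c))" "bounded_linear (\<lambda>v :: 'c. (0 :: 'b, v))"
    by (intro bounded_linear_Pair bounded_linear_ident bounded_linear_zero)+
  have "smooth_on V S (\<lambda>x. (f x, 0) + (0, h x))"
    by (intro smooth_on_add smooth_on_linear_compose[OF b(1) assms(1,2)] smooth_on_linear_compose[OF b(2) assms(1,3)])
  then show ?thesis by simp
qed

lemma smooth_on_sum:
  assumes "finite A" "\<And>i. i \<in> A \<Longrightarrow> smooth_on V S (f i)"
  shows "smooth_on V S (\<lambda>x. \<Sum>i\<in>A. f i x)"
  using assms by (simp add: smooth_on_def C_on_sum)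

context lorentz_lie_group
begin

subsection \<open>Existence of geodesics\<close>

text \<open>The vector representing the functional \<open>b \<mapsto> ip v (br v b)\<close>, that
  is, the transpose of \<open>ad v\<close> applied to \<open>v\<close>. The frame coordinates make
  its smoothness visible.\<close>

definition euler :: "'v \<Rightarrow> 'v" where
  "euler v = (\<Sum>e\<in>frame. (ip e e * ip v (br v e)) *\<^sub>R e)"

lemma ip_euler: "ip (euler v) b = ip v (br v b)"
proof -
  have "ip v (br v b) = ip v (br v (\<Sum>e\<in>frame. (ip e e * ip b e) *\<^sub>R e))" using frame(2)[of b] by simp
  also have "\<dots> = (\<Sum>e\<in>frame. (ip e e * ip b e) * ip v (br v e))"
    by (simp add: br.sum_right ip.sum_right br.scaleR_right ip.scaleR_right)
  also have "\<dots> = ip (euler v) b"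
    unfolding euler_def ip.sum_left ip.scaleR_left by (rule sum.cong) (simp_all add: ip_form(4)[of b])
  finally show ?thesis by simp
qed

lemma euler_smooth: "smooth_on UNIV V euler"
proof -
  have "smooth_on UNIV V (\<lambda>v. ip v (br v e) *\<^sub>R (ip e e *\<^sub>R e))" for e
    by (intro smooth_on_bilinear[OF bounded_bilinear_scaleR subset_UNIV] smooth_on_const
        smooth_on_bilinear[OF ip.bounded_bilinear_axioms subset_UNIV] smooth_on_bounded_linear
        bounded_linear_ident br.bounded_linear_left)
  then have "smooth_on UNIV V (\<lambda>v. \<Sum>e\<in>frame. ip v (br v e) *\<^sub>R (ip e e *\<^sub>R e))"
    by (intro smooth_on_sum frame(1))
  then show ?thesis by (simp add: euler_def[abs_def] mult.commute)
qed

lemma geodesic_ode: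
  "\<exists>\<epsilon>>0. \<exists>x v. x 0 = u0 \<and> v 0 = T \<and> (\<forall>t. \<bar>t\<bar> < \<epsilon> \<longrightarrow> x t \<in> X \<and>
     (x has_vector_derivative Lam (x t) (v t)) (at t) \<and> (v has_vector_derivative euler (v t)) (at t))"
proof -
  define U :: "('v \<times> 'v) set" where "U = X \<times> UNIV"
  define F where "F z = (Lam (fst z) (snd z), euler (snd z))" for z
  have U: "open U" unfolding U_def using X_open by (simp add: open_Times)
  have sf: "smooth_on UNIV U fst" "smooth_on UNIV U snd"
    by (intro smooth_on_bounded_linear bounded_linear_fst bounded_linear_snd)+
  \<comment> \<open>\<open>Lam\<close> is known to be smooth in \<open>u\<close> for fixed vectors;
    linearity in the second argument gives joint smoothness.\<close>
  have "smooth_on UNIV U (\<lambda>z. \<Sum>i\<in>Basis. (snd z \<bullet> i) *\<^sub>R Lam (fst z) i)"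
    by (intro smooth_on_sum finite_Basis smooth_on_bilinear[OF bounded_bilinear_scaleR subset_UNIV]
        smooth_on_inner[OF U sf(2)] smooth_on_compose[OF U X_open sf(1) Lam_smooth])
       (auto simp: U_def)
  moreover have "(\<Sum>i\<in>Basis. (snd z \<bullet> i) *\<^sub>R Lam (fst z) i) = Lam (fst z) (snd z)" if "z \<in> U" for z
  proof -
    have "linear (Lam (fst z))" using that Lam_linear by (auto simp: U_def)
    then have "Lam (fst z) (\<Sum>i\<in>Basis. (snd z \<bullet> i) *\<^sub>R i) = (\<Sum>i\<in>Basis. (snd z \<bullet> i) *\<^sub>R Lam (fst z) i)"
      by (simp add: linear_sum linear_scale)
    then show ?thesis by (simp add: euclidean_representation)
  qed
  ultimately have 1: "smooth_on UNIV U (\<lambda>z. Lam (fst z) (snd z))"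
    by (rule smooth_on_cong_open[OF U, rotated])
  have 2: "smooth_on UNIV U (\<lambda>z. euler (snd z))"
    by (rule smooth_on_compose[OF U open_UNIV sf(2) euler_smooth]) simp
  have smF: "smooth_on UNIV U F" unfolding F_def by (rule smooth_on_Pair[OF subset_UNIV 1 2])
  have "(u0, T) \<in> U" by (simp add: U_def)
  from picard_local_existence[OF U this smooth_on_has_derivative[OF smF] smooth_on_continuous[OF smooth_on_FD[OF U smF]]]
  obtain \<epsilon> y where y: "\<epsilon> > 0" "y 0 = (u0, T)"
      "\<And>t. \<bar>t\<bar> < \<epsilon> \<Longrightarrow> y t \<in> U \<and> (y has_vector_derivative F (y t)) (at t)" by blast
  have "fst (y t) \<in> X \<and> ((\<lambda>t. fst (y t)) has_vector_derivative Lam (fst (y t)) (snd (y t))) (at t) \<and>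
      ((\<lambda>t. snd (y t)) has_vector_derivative euler (snd (y t))) (at t)" if "\<bar>t\<bar> < \<epsilon>" for t
  proof (intro conjI)
    note yt = y(3)[OF that]
    show "fst (y t) \<in> X" using yt by (auto simp: U_def)
    show "((\<lambda>t. fst (y t)) has_vector_derivative Lam (fst (y t)) (snd (y t))) (at t)"
      using bounded_linear.has_vector_derivative[OF bounded_linear_fst conjunct2[OF yt]] by (simp add: F_def)
    show "((\<lambda>t. snd (y t)) has_vector_derivative euler (snd (y t))) (at t)"
      using bounded_linear.has_vector_derivative[OF bounded_linear_snd conjunct2[OF yt]] by (simp add: F_def)
  qed
  then show ?thesis using y(1,2)
    by (intro exI[of _ \<epsilon>] conjI exI[of _ "\<lambda>t. fst (y t)"] exI[of _ "\<lambda>t. snd (y t)"]) auto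
qed

text \<open>Left-invariant fields have constant inner products, so the derivative of the metric is
  minus the derivatives of the two fields.\<close>

lemma metric_Lam_derivative:
  assumes u: "u \<in> X"
  shows "FD (\<lambda>y. g c y (Lam u a) (Lam u b)) u h
    = - g c u (FD (\<lambda>u. Lam u a) u h) (Lam u b) - g c u (Lam u a) (FD (\<lambda>u. Lam u b) u h)"
proof -
  note has_derivative_form[where \<psi> = "\<lambda>u. u" and g = "g c" and a = "\<lambda>u. Lam u a" and b = "\<lambda>u. Lam u b",
      OF X_open u metric_form(3)[OF c] metric_form(5)[OF c u] has_derivative_ident Lam_has_derivative[OF u] Lam_has_derivative[OF u]]
  then have "((\<lambda>z. ip a b) has_derivative (\<lambda>h. FD (\<lambda>y. g c y (Lam u a) (Lam u b)) u h
     + g c u (FD (\<lambda>u. Lam u a) u h) (Lam u b) + g c u (Lam u a) (FD (\<lambda>u. Lam u b) u h))) (at u)"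
    by (rule has_derivative_transform_within_open[OF _ X_open u]) (simp_all add: Lam_isometry)
  from fun_cong[OF has_derivative_unique[OF this has_derivative_const], of h] show ?thesis by simp
qed

text \<open>With a left-invariant test vector, the derivatives of the metric turn into derivatives
  of the fields \<open>Lam u v\<close> and \<open>Lam u b\<close>. One of them cancels the
  acceleration of the frame, and the others combine into a bracket of left-invariant fields.\<close>

lemma geodesic_form_left_invariant:
  assumes u: "u \<in> X"
  shows "geodesic_form (g c) u (Lam u v) (FD (\<lambda>u. Lam u v) u (Lam u v) + Lam u z) (Lam u b)
    = ip z b - ip v (br v b)"
proof -
  interpret gu: bounded_bilinear "g c u" by (rule metric_form(3)[OF c u])
  note sym = metric_form(4)[OF c u]
  have "g c u (Lam u v) (FD (\<lambda>u. Lam u b) u (Lam u v)) - g c u (Lam u v) (FD (\<lambda>u. Lam u v) u (Lam u b))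
     = ip v (br v b)"
    unfolding gu.diff_right[symmetric] left_invariant_fields_br[OF u] by (rule Lam_isometry[OF u])
  then show ?thesis
    unfolding geodesic_form_def metric_Lam_derivative[OF u] gu.add_left Lam_isometry[OF u]
    using sym[of "FD (\<lambda>u. Lam u v) u (Lam u b)" "Lam u v"] by simp
qed

lemma metric_preserves_id: "preserves_metric M g (\<lambda>x. x)"
  using lorentz by (simp add: lorentz_metric_def pseudo_riemannian_metric_def)

lemma chart_change:
  assumes d: "d \<in> atlas M"
  defines "U \<equiv> {u \<in> X. \<iota> u \<in> fst d}"
  shows "open U" and "smooth_on UNIV U (\<lambda>u. snd d (\<iota> u))"
    and "u \<in> U \<Longrightarrow> snd d (\<iota> u) \<in> dom d"
    and "u \<in> U \<Longrightarrow> g d (snd d (\<iota> u)) (FD (\<lambda>u. snd d (\<iota> u)) u v) (FD (\<lambda>u. snd d (\<iota> u)) u w) = g c u v w"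
proof -
  show "open U" unfolding U_def
    by (rule open_preimage_top_of_set[OF X_open chart_inv_continuous[OF c] chart_open[OF d]])
  have "U = snd c ` (fst c \<inter> fst d)" by (auto simp: U_def)
  moreover have "smooth_on UNIV (snd c ` (fst c \<inter> fst d)) (in_charts c d (\<lambda>p. p))"
    using manifold c d unfolding smooth_manifold_def model by blast
  ultimately show "smooth_on UNIV U (\<lambda>u. snd d (\<iota> u))" by (simp add: in_charts_def o_def)
  show "snd d (\<iota> u) \<in> dom d" if "u \<in> U" using that by (simp add: U_def)
  assume u: "u \<in> U"
  have "\<forall>p. p \<in> fst c \<and> p \<in> fst d \<longrightarrow> (\<forall>v\<in>UNIV. \<forall>w\<in>UNIV.
        g d (snd d p) (FD (in_charts c d (\<lambda>x. x)) (snd c p) v) (FD (in_charts c d (\<lambda>x. x)) (snd c p) w) = g c (snd c p) v w)"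
    using metric_preserves_id c d unfolding preserves_metric_def model by blast
  from this[rule_format, of "\<iota> u" v w] u
  show "g d (snd d (\<iota> u)) (FD (\<lambda>u. snd d (\<iota> u)) u v) (FD (\<lambda>u. snd d (\<iota> u)) u w) = g c u v w"
    by (simp add: U_def in_charts_def o_def)
qed

lemma geodesic_exists:
  "\<exists>\<epsilon>>0. \<exists>x v. x 0 = u0 \<and> v 0 = T \<and> (\<forall>t. \<bar>t\<bar> < \<epsilon> \<longrightarrow> x t \<in> X \<and>
     (x has_vector_derivative Lam (x t) (v t)) (at t) \<and> (v has_vector_derivative euler (v t)) (at t)) \<and>
     geodesic M g {-\<epsilon><..<\<epsilon>} (\<lambda>t. \<iota> (x t))"
proof -
  obtain \<epsilon> x v where e: "\<epsilon> > 0" and x0: "x 0 = u0" "v 0 = T" and xv0: "\<forall>t. \<bar>t\<bar> < \<epsilon> \<longrightarrow> x t \<in> X \<and>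
     (x has_vector_derivative Lam (x t) (v t)) (at t) \<and> (v has_vector_derivative euler (v t)) (at t)"
    using geodesic_ode[of T] by (elim exE conjE) (rule that)
  have xv: "x t \<in> X" "(x has_vector_derivative Lam (x t) (v t)) (at t)"
      "(v has_vector_derivative euler (v t)) (at t)" if "\<bar>t\<bar> < \<epsilon>" for t
    using xv0[rule_format, OF that] by simp_all
  let ?I = "{-\<epsilon><..<\<epsilon>}"
  have I: "t \<in> ?I \<longleftrightarrow> \<bar>t\<bar> < \<epsilon>" for t by auto
  have xc: "continuous_on ?I x"
    by (intro continuous_at_imp_continuous_on ballI has_vector_derivative_continuous[OF xv(2)]) (simp only: I)
  have cont: "continuous_map (top_of_set ?I) (mtop M) (\<lambda>t. \<iota> (x t))"
  proof -
    have "continuous_map (top_of_set ?I) (top_of_set X) x" using xc xv(1) I by auto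
    from continuous_map_compose[OF this chart_inv_continuous[OF c]] show ?thesis by (simp add: o_def)
  qed
  \<comment> \<open>\<open>geodesic\<close> requires the equation in every chart that the curve
    meets, so the solution found in \<open>c\<close> is carried to \<open>d\<close> by the
    covariance of \<open>geodesic_form\<close>.\<close>
  have local: "let y = (\<lambda>s. snd d (\<iota> (x s))); y' = (\<lambda>s. vector_derivative y (at s));
             y'' = (\<lambda>s. vector_derivative y' (at s))
         in y differentiable (at t) \<and> y' differentiable (at t) \<and>
            (\<forall>w\<in>model M. g d (y t) (y'' t) w + D_in (model M) (\<lambda>u. g d u (y' t) w) (y t) (y' t)
               - 1/2 * D_in (model M) (\<lambda>u. g d u (y' t) (y' t)) (y t) w = 0)"
    if d: "d \<in> atlas M" and t: "t \<in> ?I" and td: "\<iota> (x t) \<in> fst d" for d t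
  proof -
    let ?U = "{u \<in> X. \<iota> u \<in> fst d}" and ?\<psi> = "\<lambda>u. snd d (\<iota> u)"
    note CC = chart_change[OF d]
    define y where "y s = ?\<psi> (x s)" for s
    define y' where "y' s = vector_derivative y (at s)" for s
    define y'' where "y'' s = vector_derivative y' (at s)" for s
    define x' where "x' s = Lam (x s) (v s)" for s
    define x'' where "x'' = FD (\<lambda>u. Lam u (v t)) (x t) (Lam (x t) (v t)) + Lam (x t) (euler (v t))"
    have t': "\<bar>t\<bar> < \<epsilon>" using t I by blast
    have xt: "x t \<in> ?U" using td xv(1)[OF t'] by blast
    define J where "J = x -` ?U \<inter> ?I"
    have "open J" unfolding J_def using continuous_on_open_vimage[OF open_greaterThanLessThan] xc CC(1) by blast
    moreover have "t \<in> J" using xt t unfolding J_def by blast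
    ultimately have J: "open J" "t \<in> J" "\<And>s. s \<in> J \<Longrightarrow> s \<in> ?I \<and> x s \<in> ?U" unfolding J_def by blast+
    have dx: "(x has_derivative (\<lambda>h. h *\<^sub>R x' s)) (at s)" if "\<bar>s\<bar> < \<epsilon>" for s
      using xv(2)[OF that] by (simp add: has_vector_derivative_def x'_def)
    have dy: "(y has_vector_derivative FD ?\<psi> (x s) (x' s)) (at s)" if "s \<in> J" for s
    proof -
      have s: "\<bar>s\<bar> < \<epsilon>" "x s \<in> ?U" using J(3)[OF that] I by blast+
      note d\<psi> = smooth_on_has_derivative[OF CC(2) s(2)]
      show ?thesis
        using has_derivative_compose[OF dx[OF s(1)] d\<psi>] linear_scale[OF has_derivative_linear[OF d\<psi>]]
        by (simp add: y_def[abs_def] has_vector_derivative_def)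
    qed
    have y': "y' s = FD ?\<psi> (x s) (x' s)" if "s \<in> J" for s
      unfolding y'_def by (rule vector_derivative_at[OF dy[OF that]])
    have dx': "(x' has_derivative (\<lambda>h. h *\<^sub>R x'')) (at t)"
    proof -
      have "(x' has_derivative (\<lambda>h. FD (\<lambda>u. Lam u (v t)) (x t) (h *\<^sub>R x' t) + Lam (x t) (h *\<^sub>R euler (v t)))) (at t)"
        unfolding x'_def
        by (rule Lam_family_derivative[OF xv(1)[OF t'] dx[OF t', unfolded x'_def]])
           (use xv(3)[OF t'] in \<open>simp add: has_vector_derivative_def\<close>)
      then show ?thesis
        by (simp add: x''_def linear_scale[OF Lam_linear[OF xv(1)[OF t']]] x'_def scaleR_add_right
            linear_scale[OF has_derivative_linear[OF Lam_has_derivative[OF xv(1)[OF t']]]])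
    qed
    have lin\<psi>: "linear (FD ?\<psi> (x t))" by (rule smooth_on_linear[OF CC(2) xt])
    note dd\<psi> = smooth_on_has_derivative[OF smooth_on_FD[OF CC(1,2)] xt]
    have dy': "(y' has_vector_derivative (FD (\<lambda>u. FD ?\<psi> u (x' t)) (x t) (x' t) + FD ?\<psi> (x t) x'')) (at t)"
    proof -
      have ch: "((\<lambda>s. FD ?\<psi> (x s) w) has_derivative (\<lambda>h. FD (\<lambda>u. FD ?\<psi> u w) (x t) (h *\<^sub>R x' t))) (at t)" for w
        by (rule has_derivative_compose[OF dx[OF t'] dd\<psi>])
      have lin: "\<forall>\<^sub>F s in nhds t. linear (FD ?\<psi> (x s))"
        using eventually_nhds_in_open[OF J(1,2)]
        by eventually_elim (use J(3) smooth_on_linear[OF CC(2)] in blast)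
      have "((\<lambda>s. FD ?\<psi> (x s) (x' s)) has_derivative
          (\<lambda>h. FD (\<lambda>u. FD ?\<psi> u (x' t)) (x t) (h *\<^sub>R x' t) + FD ?\<psi> (x t) (h *\<^sub>R x''))) (at t)"
        using has_derivative_linear_family[OF lin _ dx'] ch unfolding FD_eq[OF ch] differentiable_def by blast
      then have "((\<lambda>s. FD ?\<psi> (x s) (x' s)) has_vector_derivative
          (FD (\<lambda>u. FD ?\<psi> u (x' t)) (x t) (x' t) + FD ?\<psi> (x t) x'')) (at t)"
        by (simp add: has_vector_derivative_def linear_scale[OF lin\<psi>] scaleR_add_right
            linear_scale[OF has_derivative_linear[OF dd\<psi>]])
      then show ?thesis
        by (rule has_vector_derivative_transform_within_open[OF _ J(1,2)]) (simp add: y')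
    qed
    have y'': "y'' t = FD (\<lambda>u. FD ?\<psi> u (x' t)) (x t) (x' t) + FD ?\<psi> (x t) x''"
      unfolding y''_def by (rule vector_derivative_at[OF dy'])
    \<comment> \<open>A transition map preserves the nondegenerate metric, so its differential is
      injective and hence onto. Every test vector in \<open>d\<close> thus comes from some
      \<open>Lam (x t) b\<close>.\<close>
    have inj: "inj (FD ?\<psi> (x t))"
    proof (rule linear_injective_0[OF lin\<psi>, THEN iffD2], intro allI impI)
      fix w assume w: "FD ?\<psi> (x t) w = 0"
      have "g c (x t) w z = 0" for z
        using CC(4)[OF xt, of w z] w bounded_bilinear.zero_left[OF metric_form(3)[OF d CC(3)[OF xt]]] by simp
      then have "ip (Linv (x t) w) b = 0" for b
        using Lam_isometry[OF xv(1)[OF t'], of "Linv (x t) w" b] Lam_Linv[OF xv(1)[OF t'], of w] by simp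
      then have "Linv (x t) w = 0" by (rule ip_nondegenerate)
      then show "w = 0" using Lam_Linv[OF xv(1)[OF t'], of w] linear_0[OF Lam_linear[OF xv(1)[OF t']]] by simp
    qed
    have eq: "geodesic_form (g d) (y t) (y' t) (y'' t) w = 0" for w
    proof -
      obtain w1 where w1: "w = FD ?\<psi> (x t) w1"
        using linear_injective_imp_surjective[OF lin\<psi> inj] by blast
      define b where "b = Linv (x t) w1"
      have w1': "w1 = Lam (x t) b" unfolding b_def using Lam_Linv[OF xv(1)[OF t']] by simp
      have "geodesic_form (g d) (?\<psi> (x t)) (FD ?\<psi> (x t) (x' t))
          (FD (\<lambda>u. FD ?\<psi> u (x' t)) (x t) (x' t) + FD ?\<psi> (x t) x'') (FD ?\<psi> (x t) w1)
        = geodesic_form (g c) (x t) (x' t) x'' w1"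
        by (rule geodesic_form_covariant[OF CC(1) xt CC(2) dom_open[OF d] CC(3)[OF xt] metric_form(3)[OF d]
              metric_form(4)[OF d CC(3)[OF xt]] metric_form(5)[OF d CC(3)[OF xt]] CC(4)])
      also have "\<dots> = 0"
        unfolding x'_def x''_def w1' geodesic_form_left_invariant[OF xv(1)[OF t']] by (simp add: ip_euler)
      finally show ?thesis unfolding y'[OF J(2)] y'' w1 y_def .
    qed
    have "y differentiable (at t)" "y' differentiable (at t)"
      using dy[OF J(2)] dy' unfolding has_vector_derivative_def differentiable_def by blast+
    then have "y differentiable (at t) \<and> y' differentiable (at t) \<and>
            (\<forall>w\<in>model M. g d (y t) (y'' t) w + D_in (model M) (\<lambda>u. g d u (y' t) w) (y t) (y' t)
               - 1/2 * D_in (model M) (\<lambda>u. g d u (y' t) (y' t)) (y t) w = 0)"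
      using eq unfolding geodesic_form_def model by blast
    then show ?thesis unfolding Let_def y''_def y'_def[abs_def] y_def[abs_def] .
  qed
  have "geodesic M g ?I (\<lambda>t. \<iota> (x t))"
    unfolding geodesic_def using e cont local by (simp add: is_interval_oo del: greaterThanLessThan_iff) 
  then show ?thesis
    by (intro exI[of _ \<epsilon>] conjI e exI[of _ x] exI[of _ v] x0 xv0)
qed

end

context lorentz_lie_group
begin

subsection \<open>The geodesic lemma\<close>

text \<open>An isometry \<open>f\<close> that normalizes the left translations satisfies \<open>f (x y) = f x h y\<close> for the
  automorphism \<open>h y = (f 1)\<^sup>-\<^sup>1 f y\<close>, whose differential at the identity is \<open>linear_part f\<close>.\<close>

definition linear_part :: "('g \<Rightarrow> 'g) \<Rightarrow> 'v \<Rightarrow> 'v" where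
  "linear_part f b = Linv (snd c (f \<one>\<^bsub>N\<^esub>)) (FD (\<lambda>u. snd c (f (\<iota> u))) u0 b)"

lemma linear_part:
  assumes f: "f \<in> carrier (isometry_group M g)" and f1: "f \<one>\<^bsub>N\<^esub> \<in> fst c"
    and norm: "\<And>n. n \<in> carrier N \<Longrightarrow> \<exists>n'\<in>carrier N. \<forall>y\<in>carrier N. f (n \<otimes>\<^bsub>N\<^esub> y) = n' \<otimes>\<^bsub>N\<^esub> f y"
  shows "linear (linear_part f)"
    and "FD (\<lambda>u. snd c (f (\<iota> u))) u0 b = Lam (snd c (f \<one>\<^bsub>N\<^esub>)) (linear_part f b)"
    and "ip (linear_part f a) (linear_part f b) = ip a b"
    and "linear_part f (br a b) = br (linear_part f a) (linear_part f b)"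
proof -
  let ?n = "f \<one>\<^bsub>N\<^esub>"
  have nN: "?n \<in> carrier N" using f1 fst_c_carrier by blast
  have inN: "inv\<^bsub>N\<^esub> ?n \<in> carrier N" using nN by simp
  define h where "h y = inv\<^bsub>N\<^esub> ?n \<otimes>\<^bsub>N\<^esub> f y" for y
  have fN: "f y \<in> carrier N" if "y \<in> carrier N" for y using isometry(2)[OF f that] .
  have hN: "h y \<in> carrier N" if "y \<in> carrier N" for y using fN that inN by (simp add: h_def)
  have fh: "f (x \<otimes>\<^bsub>N\<^esub> y) = f x \<otimes>\<^bsub>N\<^esub> h y" if xy: "x \<in> carrier N" "y \<in> carrier N" for x y
  proof -
    obtain n' where n': "n' \<in> carrier N" "\<And>y. y \<in> carrier N \<Longrightarrow> f (x \<otimes>\<^bsub>N\<^esub> y) = n' \<otimes>\<^bsub>N\<^esub> f y"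
      using norm[OF xy(1)] by blast
    have "f x = n' \<otimes>\<^bsub>N\<^esub> ?n" using n'(2)[of "\<one>\<^bsub>N\<^esub>"] xy by simp
    then have "n' = f x \<otimes>\<^bsub>N\<^esub> inv\<^bsub>N\<^esub> ?n" using n'(1) nN fN xy by (simp add: N.inv_solve_right)
    then show ?thesis using n'(2)[OF xy(2)] fN xy inN by (simp add: h_def N.m_assoc)
  qed
  have h1: "h \<one>\<^bsub>N\<^esub> = \<one>\<^bsub>N\<^esub>" using nN by (simp add: h_def)
  have hh: "h (x \<otimes>\<^bsub>N\<^esub> y) = h x \<otimes>\<^bsub>N\<^esub> h y" if "x \<in> carrier N" "y \<in> carrier N" for x y
    using fh[OF that] fN hN that inN by (simp add: h_def N.m_assoc)
  let ?U = "{u \<in> X. f (\<iota> u) \<in> fst c}" and ?V = "{u \<in> X. ltrans (inv\<^bsub>N\<^esub> ?n) (\<iota> u) \<in> fst c}"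
  note F = smooth_map_in_charts[OF fm fm isometry(1)[OF f] c c]
  note L = smooth_map_in_charts[OF fm fm isometry(1)[OF ltrans_isometry[OF inN]] c c]
  have F2: "smooth_on UNIV ?U (\<lambda>u. snd c (f (\<iota> u)))" using F(2) by (simp add: in_charts_def o_def)
  let ?W = "{u \<in> ?U. snd c (f (\<iota> u)) \<in> ?V}"
  have "open ((\<lambda>u. snd c (f (\<iota> u))) -` ?V \<inter> ?U)"
    using continuous_on_open_vimage[OF F(1)] smooth_on_continuous[OF F2] L(1) by blast
  moreover have "?W = (\<lambda>u. snd c (f (\<iota> u))) -` ?V \<inter> ?U" by auto
  ultimately have oW: "open ?W" by simp
  have val: "ltrans (inv\<^bsub>N\<^esub> ?n) (\<iota> (snd c (f (\<iota> u)))) = h (\<iota> u)" if "u \<in> ?U" for u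
    using that fN by (simp add: ltrans_def h_def)
  have "smooth_on UNIV ?W (\<lambda>u. in_charts c c (ltrans (inv\<^bsub>N\<^esub> ?n)) (snd c (f (\<iota> u))))"
    by (rule smooth_on_compose[OF oW L(1) smooth_on_subset[OF F2] L(2)]) auto
  then have sW: "smooth_on UNIV ?W (\<lambda>u. snd c (h (\<iota> u)))"
  proof (rule smooth_on_cong_open[OF oW, rotated])
    fix u assume "u \<in> ?W"
    then have "u \<in> ?U" by blast
    from val[OF this] show "in_charts c c (ltrans (inv\<^bsub>N\<^esub> ?n)) (snd c (f (\<iota> u))) = snd c (h (\<iota> u))"
      by (simp only: in_charts_def o_def)
  qed
  have hW: "h (\<iota> u) \<in> fst c" if "u \<in> ?W" for u
  proof -
    have "u \<in> ?U" using that by blast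
    from val[OF this] show ?thesis using that by auto
  qed
  have U0: "u0 \<in> ?U" using f1 by simp
  have W0: "u0 \<in> ?W"
  proof -
    have "ltrans (inv\<^bsub>N\<^esub> ?n) (\<iota> (snd c (f (\<iota> u0)))) = \<one>\<^bsub>N\<^esub>" using val[OF U0] h1 by simp
    then show ?thesis using U0 one_c f1 by simp
  qed
  let ?A = "FD (\<lambda>u. snd c (h (\<iota> u))) u0"
  have nX: "snd c ?n \<in> X" using f1 by blast
  have WX: "?W \<subseteq> X" by blast
  have UX: "?U \<subseteq> X" by blast
  have FA: "FD (\<lambda>u. snd c (f (\<iota> u))) u0 b = Lam (snd c ?n) (?A b)" for b
  proof -
    have "FD (\<lambda>u. snd c (f (\<iota> u))) u0 (Lam u0 b) = Lam (snd c (f (\<iota> u0))) (?A b)"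
      by (rule intertwine[of f h ?U ?W u0 b, OF fh h1 F(1) UX _ F2 oW W0 WX hW sW U0]) blast+
    then show ?thesis by (simp only: Lam_u0 \<iota>_u0)
  qed
  have A: "linear_part f b = ?A b" for b
    unfolding linear_part_def FA by (rule Linv_Lam[OF nX])
  then have A': "linear_part f = ?A" by (rule ext)
  show "FD (\<lambda>u. snd c (f (\<iota> u))) u0 b = Lam (snd c ?n) (linear_part f b)" unfolding A by (rule FA)
  show "linear (linear_part f)" unfolding A' by (rule smooth_on_linear[OF sW W0])
  show "linear_part f (br a b) = br (linear_part f a) (linear_part f b)"
    unfolding A by (rule automorphism_br[OF hh h1 oW W0 WX hW sW])
  have "g c (snd c (f (\<iota> u0))) (FD (in_charts c c f) u0 a) (FD (in_charts c c f) u0 b) = ip a b"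
    by (rule isometry(4)[OF f c c u0_X]) (use f1 in simp)
  then have "g c (snd c ?n) (Lam (snd c ?n) (?A a)) (Lam (snd c ?n) (?A b)) = ip a b"
    by (simp add: in_charts_def o_def FA)
  then show "ip (linear_part f a) (linear_part f b) = ip a b"
    unfolding A Lam_isometry[OF nX] .
qed

text \<open>The defining identities of isometric automorphisms, differentiated at 0, where
  \<open>A\<close> is the identity. Differentiability at 0 of each \<open>A t b\<close>
  suffices.\<close>

lemma linear_part_derivation:
  fixes A :: "real \<Rightarrow> 'v \<Rightarrow> 'v"
  assumes ev: "\<forall>\<^sub>F t in nhds 0. linear (A t) \<and> (\<forall>a b. ip (A t a) (A t b) = ip a b) \<and>
      (\<forall>a b. A t (br a b) = br (A t a) (A t b))"
    and A0: "\<And>b. A 0 b = b" and B: "\<And>b. ((\<lambda>t. A t b) has_vector_derivative B b) (at 0)"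
  shows "linear B" "B (br a b) = br (B a) b + br a (B b)" "ip (B a) b = - ip a (B b)"
proof -
  have add: "B (a + b) = B a + B b" for a b
  proof -
    have "((\<lambda>t. A t a + A t b) has_vector_derivative (B a + B b)) (at 0)"
      by (rule has_vector_derivative_add[OF B B])
    then have "((\<lambda>t. A t (a + b)) has_vector_derivative (B a + B b)) (at 0)"
      by (rule has_vector_derivative_transform_nhds) (rule eventually_mono[OF ev], simp add: linear_add)
    then show ?thesis using B vector_derivative_unique_at by blast
  qed
  have scale: "B (r *\<^sub>R a) = r *\<^sub>R B a" for r a
  proof -
    have "((\<lambda>t. r *\<^sub>R A t a) has_vector_derivative (r *\<^sub>R B a)) (at 0)"
      by (rule bounded_linear.has_vector_derivative[OF bounded_linear_scaleR_right B])
    then have "((\<lambda>t. A t (r *\<^sub>R a)) has_vector_derivative (r *\<^sub>R B a)) (at 0)"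
      by (rule has_vector_derivative_transform_nhds) (rule eventually_mono[OF ev], simp add: linear_scale)
    then show ?thesis using B vector_derivative_unique_at by blast
  qed
  show "linear B" using add scale by (rule linearI)
  have "((\<lambda>t. br (A t a) (A t b)) has_vector_derivative (br a (B b) + br (B a) b)) (at 0)"
    using br.has_vector_derivative[OF B[of a] B[of b]] by (simp add: A0)
  then have "((\<lambda>t. A t (br a b)) has_vector_derivative (br a (B b) + br (B a) b)) (at 0)"
    by (rule has_vector_derivative_transform_nhds) (rule eventually_mono[OF ev], simp)
  then have "B (br a b) = br a (B b) + br (B a) b" using B vector_derivative_unique_at by blast
  then show "B (br a b) = br (B a) b + br a (B b)" by simp
  have "((\<lambda>t. ip (A t a) (A t b)) has_vector_derivative (ip a (B b) + ip (B a) b)) (at 0)"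
    using ip.has_vector_derivative[OF B[of a] B[of b]] by (simp add: A0)
  then have "((\<lambda>t. ip a b) has_vector_derivative (ip a (B b) + ip (B a) b)) (at (0::real))"
    by (rule has_vector_derivative_transform_nhds) (rule eventually_mono[OF ev], simp)
  then have "ip a (B b) + ip (B a) b = 0"
    using vector_derivative_unique_at has_vector_derivative_const by blast
  then show "ip (B a) b = - ip a (B b)" by linarith
qed

text \<open>If the geodesic is the orbit of the identity in the parameter \<open>s t\<close>, its
  trivialized velocity is \<open>v t = s' t *\<^sub>R A\<^sub>s\<^sub>(\<^sub>t\<^sub>) X0\<close>,
  with \<open>A\<close> the linear parts of the subgroup. Comparing the derivative at 0 with
  \<open>euler T\<close> gives \<open>s' 0\<close> times \<open>B\<close>, the derivative of the
  linear parts, as the derivation, and the logarithmic derivative \<open>s'' / s' 0\<close> of the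
  speed as \<open>k\<close>.\<close>

lemma geodesic_lemma:
  assumes G: "G \<subseteq> carrier (isometry_group M g)"
    and norm: "\<And>f n. f \<in> G \<Longrightarrow> n \<in> carrier N \<Longrightarrow> \<exists>n'\<in>carrier N. \<forall>y\<in>carrier N. f (n \<otimes>\<^bsub>N\<^esub> y) = n' \<otimes>\<^bsub>N\<^esub> f y"
    and go: "geodesic_orbit M g G"
  shows "\<exists>A k. linear A \<and> (\<forall>y z. A (br y z) = br (A y) z + br y (A z)) \<and>
        (\<forall>y z. ip (A y) z = - ip y (A z)) \<and> (\<forall>y. ip (br T y + A y) T = k * ip T y)"
proof -
  obtain \<epsilon> x v where e: "\<epsilon> > 0" and x0: "x 0 = u0" "v 0 = T" and xv0: "\<forall>t. \<bar>t\<bar> < \<epsilon> \<longrightarrow> x t \<in> X \<and>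
     (x has_vector_derivative Lam (x t) (v t)) (at t) \<and> (v has_vector_derivative euler (v t)) (at t)"
    and geo: "geodesic M g {-\<epsilon><..<\<epsilon>} (\<lambda>t. \<iota> (x t))"
    using geodesic_exists[of T] by (elim exE conjE) (rule that)
  have xv: "x t \<in> X" "(x has_vector_derivative Lam (x t) (v t)) (at t)"
      "(v has_vector_derivative euler (v t)) (at t)" if "\<bar>t\<bar> < \<epsilon>" for t
    using xv0[rule_format, OF that] by simp_all
  have "0 \<in> {-\<epsilon><..<\<epsilon>}" using e by simp
  with go geo have "\<exists>\<phi> s J. one_parameter_subgroup M G \<phi> \<and>
           open J \<and> is_interval J \<and> 0 \<in> J \<and> J \<subseteq> {-\<epsilon><..<\<epsilon>} \<and>
           smooth_on UNIV J s \<and> (\<forall>t\<in>J. deriv s t \<noteq> (0::real)) \<and> s 0 = 0 \<and>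
           (\<forall>t\<in>J. \<iota> (x t) = \<phi> (s t) (\<iota> (x 0)))"
    unfolding geodesic_orbit_def by blast
  then obtain \<phi> s J where \<phi>: "one_parameter_subgroup M G \<phi>" and J: "open J" "0 \<in> J" "J \<subseteq> {-\<epsilon><..<\<epsilon>}"
    and s: "smooth_on UNIV J s" "\<forall>t\<in>J. deriv s t \<noteq> (0::real)" "s 0 = 0"
    and orb: "\<forall>t\<in>J. \<iota> (x t) = \<phi> (s t) (\<iota> (x 0))"
    by (elim exE conjE) (rule that)
  have \<phi>G: "\<phi> t \<in> G" and \<phi>add: "\<phi> (t + t') = compose (carrier N) (\<phi> t) (\<phi> t')"
    and \<phi>smooth: "smooth_map (prod_manifold real_line M) M (\<lambda>(t, p). \<phi> t p)" for t t'
    using \<phi> by (simp_all add: one_parameter_subgroup_def carrier_N)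
  have \<phi>iso: "\<phi> t \<in> carrier (isometry_group M g)" for t using \<phi>G G by blast
  \<comment> \<open>The definition does not demand this: \<open>\<phi> 0\<close> is idempotent by
    the homomorphism law and injective as an isometry.\<close>
  have \<phi>0: "\<phi> 0 y = y" if y: "y \<in> carrier N" for y
  proof -
    have "\<phi> 0 y \<in> carrier N" using isometry(2)[OF \<phi>iso y] .
    moreover have "\<phi> 0 (\<phi> 0 y) = \<phi> 0 y" using \<phi>add[of 0 0] y by (simp add: compose_def fun_eq_iff split: if_splits)
    ultimately show ?thesis using isometry(3)[OF \<phi>iso] y by (auto simp: bij_betw_def inj_on_def)
  qed
  interpret R: full_manifold real_line
    by unfold_locales (simp_all add: real_line_flat smooth_manifold_flat)
  have rc: "(UNIV, \<lambda>t. t) \<in> atlas real_line" by (simp add: real_line_def)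
  have ri: "chart_inv (UNIV, \<lambda>t. t) t = t" for t :: real by (rule chart_inv_flat) simp
  define S\<phi> where "S\<phi> = {z. snd z \<in> X \<and> \<phi> (fst z) (\<iota> (snd z)) \<in> fst c}"
  define \<Phi> where "\<Phi> z = snd c (\<phi> (fst z) (\<iota> (snd z)))" for z
  have S\<phi>: "open S\<phi>" "smooth_on UNIV S\<phi> \<Phi>"
    using smooth_map_prod_in_charts[OF R.full_manifold_axioms fm fm \<phi>smooth rc c c]
    by (simp_all add: S\<phi>_def \<Phi>_def[abs_def] ri)
  define n where "n t = \<Phi> (t, u0)" for t
  have n_eq: "n t = snd c (\<phi> t \<one>\<^bsub>N\<^esub>)" for t by (simp add: n_def \<Phi>_def)
  have S0: "(0, u0) \<in> S\<phi>" using one_c by (simp add: S\<phi>_def \<phi>0)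
  have nX: "n t \<in> X" and \<phi>1: "\<phi> t \<one>\<^bsub>N\<^esub> \<in> fst c" if "(t, u0) \<in> S\<phi>" for t
    using that by (auto simp: n_def S\<phi>_def \<Phi>_def)
  have n0: "n 0 = u0" by (simp add: n_eq \<phi>0)
  let ?A = "\<lambda>t. linear_part (\<phi> t)"
  note LP = linear_part[OF \<phi>iso \<phi>1 norm[OF \<phi>G]]
  have d\<Phi>: "(\<Phi> has_derivative FD \<Phi> z) (at z)" if "z \<in> S\<phi>" for z by (rule smooth_on_has_derivative[OF S\<phi>(2) that])
  have space: "FD (\<lambda>u. snd c (\<phi> t (\<iota> u))) u0 b = FD \<Phi> (t, u0) (0, b)" if t: "(t, u0) \<in> S\<phi>" for t b
  proof (rule FD_apply)
    show "((\<lambda>u. snd c (\<phi> t (\<iota> u))) has_derivative (\<lambda>b. FD \<Phi> (t, u0) (0, b))) (at u0)"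
      using has_derivative_compose[OF has_derivative_Pair[OF has_derivative_const has_derivative_ident] d\<Phi>[OF t]]
      by (simp add: \<Phi>_def)
  qed
  have dn: "(n has_vector_derivative FD \<Phi> (t, u0) (1, 0)) (at t)" if t: "(t, u0) \<in> S\<phi>" for t
  proof -
    have "(n has_derivative (\<lambda>h. FD \<Phi> (t, u0) (h, 0))) (at t)"
      using has_derivative_compose[OF has_derivative_Pair[OF has_derivative_ident has_derivative_const] d\<Phi>[OF t]]
      by (simp add: n_def[abs_def])
    moreover have "FD \<Phi> (t, u0) (h, 0) = h *\<^sub>R FD \<Phi> (t, u0) (1, 0)" for h
      using linear_scale[OF has_derivative_linear[OF d\<Phi>[OF t]], of h "(1, 0)"] by simp
    then have "(\<lambda>h. FD \<Phi> (t, u0) (h, 0)) = (\<lambda>h. h *\<^sub>R FD \<Phi> (t, u0) (1, 0))" by (rule ext)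
    ultimately show ?thesis by (simp only: has_vector_derivative_def)
  qed
  define X0 where "X0 = FD \<Phi> (0, u0) (1, 0)"
  \<comment> \<open>From \<open>n (t + h) = \<phi> t (n h)\<close> in the chart: the velocity at
    \<open>t\<close> is the differential of \<open>\<phi> t\<close> at the identity applied to the
    initial velocity \<open>X0\<close>.\<close>
  have dn': "(n has_vector_derivative Lam (n t) (?A t X0)) (at t)" if t: "(t, u0) \<in> S\<phi>" for t
  proof -
    have n0': "(n has_derivative (\<lambda>h. h *\<^sub>R X0)) (at 0)"
      using dn[OF S0] by (simp add: X0_def has_vector_derivative_def)
    have dt: "((\<lambda>u. snd c (\<phi> t (\<iota> u))) has_derivative (\<lambda>b. FD \<Phi> (t, u0) (0, b))) (at u0)"
      using has_derivative_compose[OF has_derivative_Pair[OF has_derivative_const has_derivative_ident] d\<Phi>[OF t]]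
      by (simp add: \<Phi>_def)
    have "((\<lambda>h. snd c (\<phi> t (\<iota> (n h)))) has_derivative (\<lambda>h. FD \<Phi> (t, u0) (0, h *\<^sub>R X0))) (at 0)"
      using has_derivative_compose[OF n0', of "\<lambda>u. snd c (\<phi> t (\<iota> u))"] dt n0 by simp
    moreover have "FD \<Phi> (t, u0) (0, h *\<^sub>R X0) = h *\<^sub>R Lam (n t) (?A t X0)" for h
      using linear_scale[OF has_derivative_linear[OF d\<Phi>[OF t]], of h "(0, X0)"] LP(2)[OF t, of X0] space[OF t, of X0]
      by (simp add: n_eq)
    ultimately have 1: "((\<lambda>h. snd c (\<phi> t (\<iota> (n h)))) has_vector_derivative Lam (n t) (?A t X0)) (at 0)"
      by (simp add: has_vector_derivative_def)
    have "((\<lambda>h. (h, u0)) \<longlongrightarrow> (0, u0)) (nhds (0::real))" by (intro tendsto_Pair tendsto_const filterlim_ident)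
    then have "\<forall>\<^sub>F h in nhds (0::real). (h, u0) \<in> S\<phi>" using S\<phi>(1) S0 topological_tendstoD by blast
    then have "\<forall>\<^sub>F h in nhds 0. snd c (\<phi> t (\<iota> (n h))) = n (t + h)"
    proof eventually_elim
      case (elim h)
      have "\<iota> (n h) = \<phi> h \<one>\<^bsub>N\<^esub>" using \<phi>1[OF elim] by (simp add: n_eq)
      then show ?case using \<phi>add[of t h] by (simp add: n_eq compose_def)
    qed
    from has_vector_derivative_transform_nhds[OF 1 this]
    have "((\<lambda>h. n (t + h)) has_vector_derivative Lam (n t) (?A t X0)) (at 0)" .
    moreover have "((\<lambda>t'. t' - t) has_vector_derivative 1) (at t)" by (auto intro!: derivative_eq_intros)
    ultimately show ?thesis
      using vector_diff_chain_at[of "\<lambda>t'. t' - t" 1 t "\<lambda>h. n (t + h)"] by (simp add: o_def)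
  qed
  have A0: "?A 0 b = b" for b
  proof -
    have "FD (\<lambda>u. snd c (\<phi> 0 (\<iota> u))) u0 b = b" by (rule FD_identity[OF X_open u0_X]) (simp add: \<phi>0)
    then show ?thesis using LP(2)[OF S0, of b] by (simp add: \<phi>0)
  qed
  \<comment> \<open>The linear part is \<open>Linv\<close> applied to a partial derivative of the
    smooth action, and both depend differentiably on \<open>t\<close>.\<close>
  have "\<exists>B. \<forall>b. ((\<lambda>t. ?A t b) has_vector_derivative B b) (at 0)"
  proof -
    have "\<exists>D. ((\<lambda>t. ?A t b) has_vector_derivative D) (at 0)" for b
    proof -
      have dn0: "(n has_derivative (\<lambda>h. h *\<^sub>R FD \<Phi> (0, u0) (1, 0))) (at 0)"
        using dn[OF S0] by (simp add: has_vector_derivative_def)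
      have da: "((\<lambda>t. FD \<Phi> (t, u0) (0, b)) has_derivative (\<lambda>h. FD (\<lambda>z. FD \<Phi> z (0, b)) (0, u0) (h, 0))) (at 0)"
        by (rule has_derivative_compose[OF has_derivative_Pair[OF has_derivative_ident has_derivative_const]
              smooth_on_has_derivative[OF smooth_on_FD[OF S\<phi>] S0]])
      have "n 0 \<in> X" by (simp add: n0)
      from Linv_differentiable[OF this dn0 da]
      obtain D where D: "((\<lambda>t. Linv (n t) (FD \<Phi> (t, u0) (0, b))) has_vector_derivative D) (at 0)"
        using vector_derivative_works by blast
      have "((\<lambda>h. (h, u0)) \<longlongrightarrow> (0, u0)) (nhds (0::real))" by (intro tendsto_Pair tendsto_const filterlim_ident)
      then have "\<forall>\<^sub>F h in nhds (0::real). (h, u0) \<in> S\<phi>" using S\<phi>(1) S0 topological_tendstoD by blast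
      then have "\<forall>\<^sub>F t in nhds 0. Linv (n t) (FD \<Phi> (t, u0) (0, b)) = ?A t b"
        by eventually_elim (simp add: linear_part_def space n_eq)
      from has_vector_derivative_transform_nhds[OF D this] show ?thesis by blast
    qed
    then show ?thesis by metis
  qed
  then obtain B where B: "\<And>b. ((\<lambda>t. ?A t b) has_vector_derivative B b) (at 0)" by blast
  have evA: "\<forall>\<^sub>F t in nhds 0. linear (?A t) \<and> (\<forall>a b. ip (?A t a) (?A t b) = ip a b) \<and>
      (\<forall>a b. ?A t (br a b) = br (?A t a) (?A t b))"
  proof -
    have "((\<lambda>h. (h, u0)) \<longlongrightarrow> (0, u0)) (nhds (0::real))" by (intro tendsto_Pair tendsto_const filterlim_ident)
    then have "\<forall>\<^sub>F h in nhds (0::real). (h, u0) \<in> S\<phi>" using S\<phi>(1) S0 topological_tendstoD by blast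
    then show ?thesis by eventually_elim (use LP in blast)
  qed
  note BD = linear_part_derivation[of ?A B, OF evA A0 B]
  define s' where "s' t = FD s t 1" for t
  have ds: "(s has_vector_derivative s' t) (at t)" if "t \<in> J" for t
  proof -
    note d = smooth_on_has_derivative[OF s(1) that]
    have "FD s t h = h *\<^sub>R s' t" for h
      using linear_scale[OF has_derivative_linear[OF d], of h 1] by (simp add: s'_def)
    then have "FD s t = (\<lambda>h. h *\<^sub>R s' t)" by (rule ext)
    then show ?thesis using d by (simp only: has_vector_derivative_def)
  qed
  have s'0: "s' 0 \<noteq> 0"
  proof -
    have "deriv s 0 = s' 0"
      using ds[OF J(2)] by (intro DERIV_imp_deriv) (simp add: has_real_derivative_iff_has_vector_derivative)
    then show ?thesis using s(2) J(2) by auto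
  qed
  obtain s'' where ds': "(s' has_vector_derivative s'') (at 0)"
  proof -
    have "s' differentiable (at 0)" unfolding s'_def
      using smooth_on_has_derivative[OF smooth_on_FD[OF J(1) s(1)] J(2), of 1] unfolding differentiable_def by blast
    then show ?thesis using that vector_derivative_works by blast
  qed
  have xn: "x t = n (s t)" and sS: "(s t, u0) \<in> S\<phi>" if t: "t \<in> J" for t
  proof -
    have te: "\<bar>t\<bar> < \<epsilon>" using subsetD[OF J(3) t] by auto
    have eq: "\<iota> (x t) = \<phi> (s t) \<one>\<^bsub>N\<^esub>" using orb t x0 by simp
    then show "(s t, u0) \<in> S\<phi>" using \<iota>_in[OF xv(1)[OF te]] by (simp add: S\<phi>_def)
    show "x t = n (s t)" unfolding n_eq eq[symmetric] using xv(1)[OF te] by simp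
  qed
  have v_eq: "v t = s' t *\<^sub>R ?A (s t) X0" if t: "t \<in> J" for t
  proof -
    have te: "\<bar>t\<bar> < \<epsilon>" using subsetD[OF J(3) t] by auto
    have "((\<lambda>t. n (s t)) has_vector_derivative s' t *\<^sub>R Lam (n (s t)) (?A (s t) X0)) (at t)"
      using vector_diff_chain_at[OF ds[OF t] dn'[OF sS[OF t]]] by (simp add: o_def)
    then have "(x has_vector_derivative s' t *\<^sub>R Lam (n (s t)) (?A (s t) X0)) (at t)"
      by (rule has_vector_derivative_transform_within_open[OF _ J(1) t]) (simp add: xn)
    then have "Lam (x t) (v t) = s' t *\<^sub>R Lam (x t) (?A (s t) X0)"
      using xv(2)[OF te] vector_derivative_unique_at xn[OF t] by simp
    also have "\<dots> = Lam (x t) (s' t *\<^sub>R ?A (s t) X0)"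
      by (simp add: linear_scale[OF Lam_linear[OF xv(1)[OF te]]])
    finally have "Linv (x t) (Lam (x t) (v t)) = Linv (x t) (Lam (x t) (s' t *\<^sub>R ?A (s t) X0))" by simp
    then show ?thesis unfolding Linv_Lam[OF xv(1)[OF te]] .
  qed
  have T: "T = s' 0 *\<^sub>R X0" using v_eq[OF J(2)] by (simp add: x0 s A0)
  have dA: "((\<lambda>t. ?A (s t) X0) has_vector_derivative s' 0 *\<^sub>R B X0) (at 0)"
    using vector_diff_chain_at[OF ds[OF J(2)], of "\<lambda>t. ?A t X0" "B X0"] B[of X0] s(3) by (simp add: o_def)
  have "((\<lambda>t. s' t *\<^sub>R ?A (s t) X0) has_vector_derivative s' 0 *\<^sub>R (s' 0 *\<^sub>R B X0) + s'' *\<^sub>R ?A (s 0) X0) (at 0)"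
    by (rule bounded_bilinear.has_vector_derivative[OF bounded_bilinear_scaleR ds' dA])
  then have "(v has_vector_derivative s' 0 *\<^sub>R (s' 0 *\<^sub>R B X0) + s'' *\<^sub>R ?A (s 0) X0) (at 0)"
    by (rule has_vector_derivative_transform_within_open[OF _ J(1,2)]) (simp add: v_eq)
  moreover have "(v has_vector_derivative euler T) (at 0)" using xv(3)[of 0] e x0 by simp
  ultimately have "euler T = s' 0 *\<^sub>R (s' 0 *\<^sub>R B X0) + s'' *\<^sub>R X0"
    using vector_derivative_unique_at by (simp add: s(3) A0) blast
  also have "\<dots> = s' 0 *\<^sub>R B T + (s'' / s' 0) *\<^sub>R T"
    unfolding T linear_scale[OF BD(1)] using s'0 by simp
  finally have Q: "euler T = s' 0 *\<^sub>R B T + (s'' / s' 0) *\<^sub>R T" .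
  define A where "A b = s' 0 *\<^sub>R B b" for b
  have "ip (br T y + A y) T = (s'' / s' 0) * ip T y" for y
  proof -
    have "ip (br T y) T = ip (euler T) y" using ip_euler[of T y] ip_form(4)[of T "br T y"] by simp
    also have "\<dots> = s' 0 * ip (B T) y + (s'' / s' 0) * ip T y" unfolding Q by (simp add: ip.add_left ip.scaleR_left)
    finally have "ip (br T y) T = s' 0 * ip (B T) y + (s'' / s' 0) * ip T y" .
    moreover have "ip (A y) T = - s' 0 * ip (B T) y"
      using BD(3)[of T y] ip_form(4)[of T "B y"] by (simp add: A_def ip.scaleR_left)
    ultimately show ?thesis by (simp add: ip.add_left)
  qed
  moreover have "linear A" unfolding A_def
    by (rule linearI) (simp_all add: linear_add[OF BD(1)] linear_scale[OF BD(1)] scaleR_add_right)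
  moreover have "A (br y z) = br (A y) z + br y (A z)" for y z
    by (simp add: A_def BD(2) br.scaleR_left br.scaleR_right scaleR_add_right)
  moreover have "ip (A y) z = - ip y (A z)" for y z
    by (simp add: A_def BD(3)[of y z] ip.scaleR_left ip.scaleR_right)
  ultimately show ?thesis by blast
qed

end

theorem theorem3:
  fixes N :: "'g monoid" and M :: "('g, 'v::euclidean_space) manifold"
    and ds2 :: "('g, 'v) metric_tensor" and G H :: "('g \<Rightarrow> 'g) set" and c :: "('g, 'v) chart"
  assumes "lie_group N M" and "model M = UNIV" and "connected_space (mtop M)"
    and "nilpotent_group N"
    and "lorentz_metric M ds2"
    and "subgroup G (isometry_group M ds2)"
    and "H = stabilizer ((isometry_group M ds2)\<lparr>carrier := G\<rparr>) (\<lambda>g. g) \<one>\<^bsub>N\<^esub>"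
    and "semidirect_product ((isometry_group M ds2)\<lparr>carrier := G\<rparr>) (left_translations N) H"
    and "geodesic_orbit M ds2 G"
    and "c \<in> atlas M" and "\<one>\<^bsub>N\<^esub> \<in> fst c"
    and "degenerate_on (derived_algebra UNIV (lie_bracket N M c)) (ds2 c (snd c \<one>\<^bsub>N\<^esub>))"
  shows "\<exists>m0 br0 ip0.
    lorentz_double_extension UNIV (lie_bracket N M c) (ds2 c (snd c \<one>\<^bsub>N\<^esub>)) m0 br0 ip0 \<and>
    riemannian_go_nilmanifold_algebra m0 br0 ip0 \<and>
    (abelian_lie m0 br0 \<or> two_step_nilpotent_lie m0 br0)"
proof -
  let ?I = "isometry_group M ds2" and ?L = "left_translations N"
  let ?G = "?I\<lparr>carrier := G\<rparr>"
  have GI: "G \<subseteq> carrier ?I" using assms(6) by (rule subgroup.subset)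
  have normal: "?L \<lhd> ?G" using assms(8) by (simp add: semidirect_product_def)
  then have LG: "?L \<subseteq> G" using normal.axioms(1) subgroup.subset by fastforce
  interpret lorentz_lie_group M N ds2 c
    using assms LG GI by unfold_locales (auto simp: lie_group_def)
  have bij: "f \<in> Bij (carrier N)" if "f \<in> G" for f
    using that GI by (auto simp: isometry_group_def carrier_N)
  have mult: "f \<otimes>\<^bsub>?G\<^esub> f' = compose (carrier N) f f'" if "f \<in> G" "f' \<in> G" for f f'
    using bij[OF that(1)] bij[OF that(2)] by (simp add: isometry_group_def BijGroup_def carrier_N)
  have norm: "\<exists>n'\<in>carrier N. \<forall>y\<in>carrier N. f (n \<otimes>\<^bsub>N\<^esub> y) = n' \<otimes>\<^bsub>N\<^esub> f y"
    if f: "f \<in> G" and n: "n \<in> carrier N" for f n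
  proof -
    \<comment> \<open>Normality of the left translations is used as equality of left and right
      cosets: \<open>f\<close> composed with the translation by \<open>n\<close> is a translation by
      some \<open>n'\<close> composed with \<open>f\<close>.\<close>
    have nL: "ltrans n \<in> ?L" using n by (simp add: left_translations_def ltrans_def)
    have "f \<otimes>\<^bsub>?G\<^esub> ltrans n \<in> f <#\<^bsub>?G\<^esub> ?L" using nL by (auto simp: l_coset_def)
    also have "f <#\<^bsub>?G\<^esub> ?L = ?L #>\<^bsub>?G\<^esub> f" using normal.coset_eq[OF normal] f by simp
    finally obtain k where k: "k \<in> ?L" "f \<otimes>\<^bsub>?G\<^esub> ltrans n = k \<otimes>\<^bsub>?G\<^esub> f" by (auto simp: r_coset_def)
    then obtain n' where n': "n' \<in> carrier N" "k = ltrans n'" by (auto simp: left_translations_def ltrans_def)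
    have eq: "compose (carrier N) f (ltrans n) = compose (carrier N) k f"
      using k(2) mult[OF f subsetD[OF LG nL]] mult[OF subsetD[OF LG k(1)] f] by simp
    have "f (n \<otimes>\<^bsub>N\<^esub> y) = n' \<otimes>\<^bsub>N\<^esub> f y" if y: "y \<in> carrier N" for y
    proof -
      have "f y \<in> carrier N" using isometry(2) f GI y by blast
      then show ?thesis using fun_cong[OF eq, of y] y n n' by (simp add: compose_def ltrans_def)
    qed
    then show ?thesis using n'(1) by blast
  qed
  obtain q where q: "\<And>x. ip x q = 0 \<Longrightarrow> x \<noteq> 0 \<Longrightarrow> ip x x > 0"
    using lorentz_signature_timelike[OF ip_form(2,3)] by blast
  obtain e where e: "e \<in> derived_algebra UNIV br" "e \<noteq> 0" "\<And>y. y \<in> derived_algebra UNIV br \<Longrightarrow> ip e y = 0"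
    using assms(12) by (auto simp: degenerate_on_def)
  have "lorentz_go_algebra br ip q e"
    using lie_algebra_br nilpotent_br[OF assms(4)] ip_form(1) q geodesic_lemma[OF GI norm assms(9)] e
    by (rule lorentz_go_algebra.intro)
  then obtain m0 pr br0 where ext: "lorentz_double_extension UNIV br ip m0 br0 ip" and riem: "riem_go_algebra m0 pr br0 ip"
    using lorentz_go_algebra.double_extension by blast
  then show ?thesis
    using riem_go_algebra.riemannian_go_nilmanifold[OF riem] riem_go_algebra.abelian_or_two_step[OF riem] by blast
qed

end
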